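(* Excluded minors for $\mathcal{M}_3$ occur at every rank from $7$ to $10$: the matroids $M(K_{3,5}), M(G_1), M(G_2), M(G_3), M(G_4), M(G_5)$ are excluded minors for $\mathcal{M}_3$, $M(K_{3,5})$ has rank $7$, $M(G_1)$ has rank $8$, $M(G_3), M(G_4), M(G_5)$ have rank $9$, and $M(G_2)$ has rank $10$. Here $G_1,\dots,G_5$ are the explicit graphs defined in the context and $M(G)$ denotes the graphic (cycle) matroid of $G$.
   Context: **Class $\mathcal{M}_\ell$.** Let $\ell$ be a prime. Let $R$ be a regular matroid of rank $g$ on a finite ground set $S$, and choose a totally unimodular matrix $A\in\mathbb{Z}^{g\times|S|}$ of rank $g$ (columns indexed by $S$, of the form $(I_g\mid D)$ after ordering $S$) realizing $R$. Let $U=U(R)\subset\mathbb{Z}^S$ be the lattice spanned by the rows of $A$ (for a graphic matroid $M(G)$, $U$ is the cut lattice of $G$), and let $\bar U\subset\mathbb{F}_\ell^S$ be its reduction mod $\ell$, of dimension $g$. The notions below do not depend on the choice of $A$. The Albanese graph $\mathrm{Alb}_\ell(R)$ is the oriented $S$-colored graph with vertex set $V=\mathbb{F}_\ell^S/\bar U$ and, for each $[v]\in V$ and $s\in S$, exactly one oriented edge of color $s$ from $[v]$ to $[v+e_s]$, where $e_s$ is the standard basis vector. A 1-chain is an $\mathbb{F}_\ell$-linear combination of oriented edges; the boundary $\partial$ sends an edge from $[v]$ to $[w]$ to $[w]-[v]$; a 1-chain is closed if its boundary is $0$. The color profile is the linear map $\lambda$ from 1-chains to $\mathbb{F}_\ell^S$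 sending each edge of color $s$ to $e_s$; $\lambda_s(b)$ is the $s$-component of $\lambda(b)$. A $\mathbb{Z}/\ell$-solution of $R$ in $\mathrm{Alb}_\ell(R)$ is a family $(b_s)_{s\in S}$ of 1-chains over $\mathbb{F}_\ell$, with $b_s$ supported on the edges of color $s$, such that $\sum_{s}c_s b_s$ is closed whenever $\sum_s c_s e_s\in\bar U$. $\mathcal{M}_\ell$ is the class of regular matroids $R$ admitting a $\mathbb{Z}/\ell$-solution in $\mathrm{Alb}_\ell(R)$ for which there is $c\in(\mathbb{Z}/\ell)^\times$ with $\lambda_s(b_s)=c$ for all $s\in S$. This class is closed under taking minors. An excluded minor for $\mathcal{M}_\ell$ is a regular matroid not in $\mathcal{M}_\ell$ all of whose proper minors are in $\mathcal{M}_\ell$. **Graphs.** $ij$ denotes the edge between vertices $i$ and $j$. $G_1$: vertex set $\{1,\dots,9\}$, edges $15,25,35,16,26,46,17,37,47,28,38,48,19,29,39,49$. $G_2$: the graph obtained from $K_4$ by subdividing each of its six edges once and adding a new vertex joined to the six subdivision vertices (11 vertices, 18 edges). $G_3,G_4,G_5$ have vertex set $\{0,\dots,9\}$ and 17 edges: $E(G_3)=\{04,06,07,15,16,17,26,27,28,37,38,39,48,49,58,59,69\}$; $E(G_4)=\{05,07,08,15,17,18,26,27,29,36,38,39,47,48,49,56,59\}$; $E(G_5)=\{03,05,06,14,16,18,25,26,27,37,38,39,47,49,58,59,69\}$. $K_{3,5}$ is the complete bipartite graph. *)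

theory Defs
  imports
    "Jordan_Normal_Form.Determinant"
    "Graph_Theory.Digraph"
    "HOL-Library.Numeral_Type"
    "HOL-Library.Function_Algebras"
    "HOL-Library.Set_Algebras"
begin

section \<open>Matroids and minors\<close>

record 'a matroid =
  ground :: "'a set"
  indep :: "'a set set"

definition is_matroid :: "'a matroid \<Rightarrow> bool" where
  "is_matroid M \<longleftrightarrow>
     finite (ground M) \<and> indep M \<subseteq> Pow (ground M) \<and> {} \<in> indep M \<and>
     (\<forall>X Y. X \<in> indep M \<longrightarrow> Y \<subseteq> X \<longrightarrow> Y \<in> indep M) \<and>
     (\<forall>X Y. X \<in> indep M \<longrightarrow> Y \<in> indep M \<longrightarrow> card X < card Y \<longrightarrow>
        (\<exists>y \<in> Y - X. insert y X \<in> indep M))"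

definition rank :: "'a matroid \<Rightarrow> nat" where
  "rank M = Max (card ` indep M)"

definition basis_in :: "'a matroid \<Rightarrow> 'a set \<Rightarrow> 'a set \<Rightarrow> bool" where
  "basis_in M X B \<longleftrightarrow>
     B \<in> indep M \<and> B \<subseteq> X \<and> (\<forall>B' \<in> indep M. B \<subseteq> B' \<longrightarrow> B' \<subseteq> X \<longrightarrow> B' = B)"

definition deletion :: "'a matroid \<Rightarrow> 'a set \<Rightarrow> 'a matroid" where
  "deletion M X = \<lparr>ground = ground M - X, indep = {I \<in> indep M. I \<subseteq> ground M - X}\<rparr>"

definition contraction :: "'a matroid \<Rightarrow> 'a set \<Rightarrow> 'a matroid" where
  "contraction M X =
     \<lparr>ground = ground M - X,
      indep = {I. I \<subseteq> ground M - X \<and> (\<exists>B. basis_in M X B \<and> I \<union> B \<in> indep M)}\<rparr>"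

definition minor :: "'a matroid \<Rightarrow> 'a matroid \<Rightarrow> bool" where
  "minor N M \<longleftrightarrow>
     (\<exists>X Y. X \<subseteq> ground M \<and> Y \<subseteq> ground M \<and> X \<inter> Y = {} \<and>
        N = deletion (contraction M X) Y)"

definition proper_minor :: "'a matroid \<Rightarrow> 'a matroid \<Rightarrow> bool" where
  "proper_minor N M \<longleftrightarrow> minor N M \<and> N \<noteq> M"


section \<open>Totally unimodular realizations and regular matroids\<close>

text \<open>A \<open>g \<times> S\<close> matrix is a function \<open>A\<close> whose entries \<open>A i s\<close> matter only for
  \<open>i < g\<close> and \<open>s \<in> S\<close>.\<close>

definition totally_unimodular :: "nat \<Rightarrow> 'a set \<Rightarrow> (nat \<Rightarrow> 'a \<Rightarrow> int) \<Rightarrow> bool" where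
  "totally_unimodular g S A \<longleftrightarrow>
     (\<forall>k r c. inj_on r {..<k} \<longrightarrow> r ` {..<k} \<subseteq> {..<g} \<longrightarrow>
              inj_on c {..<k} \<longrightarrow> c ` {..<k} \<subseteq> S \<longrightarrow>
        det (mat k k (\<lambda>(i, j). A (r i) (c j))) \<in> {-1, 0, 1})"

text \<open>Independence is that of the family of columns, so that equal columns at two
  different elements are dependent.\<close>

definition columns_independent :: "nat \<Rightarrow> (nat \<Rightarrow> 'a \<Rightarrow> int) \<Rightarrow> 'a set \<Rightarrow> bool" where
  "columns_independent g A X \<longleftrightarrow>
     (\<forall>c :: 'a \<Rightarrow> real. (\<forall>i<g. (\<Sum>s\<in>X. c s * real_of_int (A i s)) = 0) \<longrightarrow> (\<forall>s\<in>X. c s = 0))"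

text \<open>The map \<open>b\<close> selects the columns that form the identity block of \<open>(I\<^sub>g | D)\<close>;
  in particular \<open>A\<close> has rank \<open>g\<close>.\<close>

definition tu_realization :: "'a matroid \<Rightarrow> (nat \<Rightarrow> 'a \<Rightarrow> int) \<Rightarrow> bool" where
  "tu_realization M A \<longleftrightarrow>
     totally_unimodular (rank M) (ground M) A \<and>
     (\<exists>b. (\<forall>j<rank M. b j \<in> ground M) \<and>
          (\<forall>i<rank M. \<forall>j<rank M. A i (b j) = (if i = j then 1 else 0))) \<and>
     indep M = {X. X \<subseteq> ground M \<and> columns_independent (rank M) A X}"

definition regular :: "'a matroid \<Rightarrow> bool" where
  "regular M \<longleftrightarrow> is_matroid M \<and> (\<exists>A. tu_realization M A)"


section \<open>The Albanese graph\<close>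

text \<open>The coefficient ring \<open>\<int>/\<ell>\<close> is a type \<open>'f\<close>: a commutative unital ring with a prime
  number \<open>\<ell>\<close> of elements is \<open>\<int>/\<ell>\<close>. The type \<open>3\<close> of the numeral types carries arithmetic
  modulo 3. Vectors indexed by \<open>S\<close> are functions that vanish outside \<open>S\<close>, with the pointwise
  operations.\<close>

definition vectors :: "'a set \<Rightarrow> ('a \<Rightarrow> 'f::zero) set" where
  "vectors S = {v. \<forall>s. s \<notin> S \<longrightarrow> v s = 0}"

definition basis_vector :: "'a \<Rightarrow> ('a \<Rightarrow> 'f::zero_neq_one)" where
  "basis_vector s = (\<lambda>t. if t = s then 1 else 0)"

definition row_lattice :: "nat \<Rightarrow> 'a set \<Rightarrow> (nat \<Rightarrow> 'a \<Rightarrow> int) \<Rightarrow> ('a \<Rightarrow> int) set" where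
  "row_lattice g S A =
     {(\<lambda>s. if s \<in> S then (\<Sum>i<g. z i * A i s) else 0) | z. True}"

definition reduction :: "('a \<Rightarrow> int) set \<Rightarrow> ('a \<Rightarrow> 'f::comm_ring_1) set" where
  "reduction U = (\<lambda>u s. of_int (u s)) ` U"

text \<open>The class \<open>[v]\<close> modulo \<open>W\<close> is the coset \<open>v +o W\<close>, so \<open>[v + e\<^sub>s]\<close> is \<open>e\<^sub>s +o [v]\<close>. The
  unique edge of color \<open>s\<close> leaving the vertex \<open>x\<close> is the pair \<open>(x, s)\<close>.\<close>

definition albanese ::
  "'a set \<Rightarrow> ('a \<Rightarrow> 'f::comm_ring_1) set \<Rightarrow> (('a \<Rightarrow> 'f) set, ('a \<Rightarrow> 'f) set \<times> 'a) pre_digraph"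
where
  "albanese S W =
     \<lparr>verts = (\<lambda>v. v +o W) ` vectors S,
      arcs = ((\<lambda>v. v +o W) ` vectors S) \<times> S,
      tail = fst,
      head = (\<lambda>(x, s). basis_vector s +o x)\<rparr>"

definition chains :: "('v, 'e) pre_digraph \<Rightarrow> ('e \<Rightarrow> 'f::comm_ring_1) set" where
  "chains G = {b. \<forall>e. e \<notin> arcs G \<longrightarrow> b e = 0}"

definition boundary :: "('v, 'e) pre_digraph \<Rightarrow> ('e \<Rightarrow> 'f::comm_ring_1) \<Rightarrow> ('v \<Rightarrow> 'f)" where
  "boundary G b =
     (\<lambda>x. \<Sum>e\<in>arcs G. b e * (basis_vector (head G e) x - basis_vector (tail G e) x))"

definition closed_chain :: "('v, 'e) pre_digraph \<Rightarrow> ('e \<Rightarrow> 'f::comm_ring_1) \<Rightarrow> bool" where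
  "closed_chain G b \<longleftrightarrow> b \<in> chains G \<and> (\<forall>x. boundary G b x = 0)"

definition color_profile ::
  "('v, 'v \<times> 'a) pre_digraph \<Rightarrow> ('v \<times> 'a \<Rightarrow> 'f::comm_ring_1) \<Rightarrow> ('a \<Rightarrow> 'f)" where
  "color_profile G b = (\<lambda>s. \<Sum>e\<in>arcs G. b e * basis_vector (snd e) s)"

definition is_solution ::
  "'a set \<Rightarrow> ('a \<Rightarrow> 'f::comm_ring_1) set \<Rightarrow> ('a \<Rightarrow> (('a \<Rightarrow> 'f) set \<times> 'a \<Rightarrow> 'f)) \<Rightarrow> bool" where
  "is_solution S W b \<longleftrightarrow>
     (\<forall>s\<in>S. b s \<in> chains (albanese S W) \<and> (\<forall>e. b s e \<noteq> 0 \<longrightarrow> snd e = s)) \<and>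
     (\<forall>c \<in> W. closed_chain (albanese S W) (\<lambda>e. \<Sum>s\<in>S. c s * b s e))"


section \<open>The class of matroids and its excluded minors\<close>

text \<open>The realization \<open>A\<close> is quantified existentially; the condition on it does not depend
  on the choice of \<open>A\<close>.\<close>

definition M_class :: "'f::{comm_ring_1, finite} itself \<Rightarrow> 'a matroid set" where
  "M_class _ =
     {R. regular R \<and>
         (\<exists>A W b. tu_realization R A \<and>
            W = (reduction (row_lattice (rank R) (ground R) A) :: ('a \<Rightarrow> 'f) set) \<and>
            is_solution (ground R) W b \<and>
            (\<exists>c :: 'f. c dvd 1 \<and>
               (\<forall>s \<in> ground R. color_profile (albanese (ground R) W) (b s) s = c)))}"

definition excluded_minor :: "'f::{comm_ring_1, finite} itself \<Rightarrow> 'a matroid \<Rightarrow> bool" where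
  "excluded_minor F R \<longleftrightarrow>
     regular R \<and> R \<notin> M_class F \<and> (\<forall>N. proper_minor N R \<longrightarrow> N \<in> M_class F)"


section \<open>Graphs and cycle matroids\<close>

type_synonym 'v graph = "'v set \<times> 'v set set"

definition cycle_edges :: "'v list \<Rightarrow> 'v set set" where
  "cycle_edges vs = {{vs ! i, vs ! (Suc i mod length vs)} | i. i < length vs}"

definition cycle_matroid :: "'v graph \<Rightarrow> 'v set matroid" where
  "cycle_matroid G =
     \<lparr>ground = snd G,
      indep = {X. X \<subseteq> snd G \<and>
                  \<not> (\<exists>vs. distinct vs \<and> 3 \<le> length vs \<and> cycle_edges vs \<subseteq> X)}\<rparr>"

definition edges_of :: "('v \<times> 'v) list \<Rightarrow> 'v set set" where
  "edges_of xs = (\<lambda>(i, j). {i, j}) ` set xs"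

definition complete_bipartite :: "nat \<Rightarrow> nat \<Rightarrow> nat graph" where
  "complete_bipartite m n = ({..<m + n}, {{i, j} | i j. i < m \<and> m \<le> j \<and> j < m + n})"

definition G1 :: "nat graph" where
  "G1 = ({1..9}, edges_of
     [(1,5), (2,5), (3,5), (1,6), (2,6), (4,6), (1,7), (3,7), (4,7), (2,8), (3,8), (4,8),
      (1,9), (2,9), (3,9), (4,9)])"

text \<open>In \<open>G2\<close> the vertices of \<open>K\<^sub>4\<close> are 1, 2, 3, 4, the vertex subdividing the edge \<open>ij\<close>
  (with \<open>i < j\<close>) is \<open>10 * i + j\<close>, and the additional vertex is 0.\<close>

definition G2 :: "nat graph" where
  "G2 = ({0} \<union> {1..4} \<union> {10 * i + j | i j. 1 \<le> i \<and> i < j \<and> j \<le> 4},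
     \<Union> {{{i, 10 * i + j}, {j, 10 * i + j}, {0, 10 * i + j}} | i j. 1 \<le> i \<and> i < j \<and> j \<le> 4})"

definition G3 :: "nat graph" where
  "G3 = ({0..9}, edges_of
     [(0,4), (0,6), (0,7), (1,5), (1,6), (1,7), (2,6), (2,7), (2,8), (3,7), (3,8), (3,9),
      (4,8), (4,9), (5,8), (5,9), (6,9)])"

definition G4 :: "nat graph" where
  "G4 = ({0..9}, edges_of
     [(0,5), (0,7), (0,8), (1,5), (1,7), (1,8), (2,6), (2,7), (2,9), (3,6), (3,8), (3,9),
      (4,7), (4,8), (4,9), (5,6), (5,9)])"

definition G5 :: "nat graph" where
  "G5 = ({0..9}, edges_of
     [(0,3), (0,5), (0,6), (1,4), (1,6), (1,8), (2,5), (2,6), (2,7), (3,7), (3,8), (3,9),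
      (4,7), (4,9), (5,8), (5,9), (6,9)])"

end

(* All matroids here are coordinate matroids of spaces of coboundaries of potentials on the
   vertices of a graph: a set of edges is independent iff the coboundaries restrict onto it.
   A nonzero value of a coboundary on an edge is also the value +-1 there of the coboundary of
   an indicator function, without new nonzero values; this makes the fundamental matrices of
   all minors totally unimodular, and it lets solutions descend to deletions and contractions,
   so that only the minors obtained by removing one edge matter.

   A family of chains is a solution iff it pairs to zero with all functions h on the vertices of
   the Albanese graph. For a graph embedded in the projective plane the faces are a basis of the
   cycles modulo 3, every e_s is a sum of two elements +-eps_i, +-eps_j of the dual basis, and
   b_s = [-+eps_i] + [-+eps_j] is a solution, since the face boundaries are closed. All but three
   of the one-edge minors are projective, and the three others have explicit solutions of a
   similar symmetric form.

   The six graphs themselves have no solution: for each there are functions Phi_v on the vertices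
   of the Albanese graph, cubic polynomials, such that for each edge s = ab the function
   Phi_a - Phi_b grows by a constant kappa_s along all edges of color s, and the kappa_s have sum 1.
   Pairing the closed chain of the star of v with Phi_v and adding up gives c = 0 for the common
   color profile c. That every totally unimodular realization gives the same relations up to
   signs follows from the fact that the stars of a 2-connected graph are bonds. *)

theory Submission
  imports Defs
begin

section \<open>Matroids of function spaces and total unimodularity\<close>

section \<open>Function spaces and their coordinate matroids\<close>

text \<open>The two halves are asymmetric: \<open>M_class\<close> asks for some realization, so the
  minors may use the most convenient fundamental matrix, while the exclusion has to cope with an
  arbitrary one. Function spaces replace matrices because a contraction is then a subspace and a
  deletion a restriction of coordinates, without pivoting. All six graphs have cycle spaces of
  dimension 8, so their Albanese graphs have 3^8 vertices, too many to inspect one by one. Both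
  kinds of certificates therefore trade functions on the vertices for formal sums: closedness of a
  chain becomes cancellation among finitely many symbols \<open>\<delta> x\<close>, and the
  condition on the functions \<Phi> an identity of polynomials. The symmetry of the solutions comes
  from x -> - x, which maps the edge leaving \<open>u\<close> in color \<open>s\<close> to the
  reversed edge leaving - u - e_s. It halves the data, makes \<delta> odd, and explains the profile
  2: every listed base point brings its mirror image along.\<close>

locale fun_space =
  fixes P :: "('a \<Rightarrow> real) set"
  assumes zero_mem: "(\<lambda>_. 0) \<in> P"
    and comb_mem: "p \<in> P \<Longrightarrow> q \<in> P \<Longrightarrow> (\<lambda>s. a * p s + b * q s) \<in> P"
begin

text \<open>For finite \<open>I\<close> this says that \<open>P\<close> restricts onto all real
  functions on \<open>I\<close>, or that the coordinates in \<open>I\<close> are linearly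
  independent functionals on \<open>P\<close>. If \<open>P\<close> is the row space of a matrix,
  these are the independent sets of columns.\<close>

definition free :: "'a set \<Rightarrow> bool" where
  "free I \<longleftrightarrow> (\<forall>s\<in>I. \<exists>p\<in>P. p s \<noteq> 0 \<and> (\<forall>t\<in>I - {s}. p t = 0))"

definition dual_on :: "'a set \<Rightarrow> ('a \<Rightarrow> 'a \<Rightarrow> real) \<Rightarrow> bool" where
  "dual_on I d \<longleftrightarrow> (\<forall>s\<in>I. d s \<in> P \<and> (\<forall>t\<in>I. d s t = (if s = t then 1 else 0)))"

text \<open>For subsets of the ground set this is matroid closure, \<open>T\<close> being contained
  in the closure of \<open>B\<close>, expressed without bases.\<close>

definition spans :: "'a set \<Rightarrow> 'a set \<Rightarrow> bool" where
  "spans B T \<longleftrightarrow> (\<forall>p\<in>P. (\<forall>s\<in>B. p s = 0) \<longrightarrow> (\<forall>t\<in>T. p t = 0))"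

lemma scale_mem: "p \<in> P \<Longrightarrow> (\<lambda>s. a * p s) \<in> P"
  using comb_mem[of p p a 0] by simp

lemma sum_mem:
  assumes "finite I" "\<And>i. i \<in> I \<Longrightarrow> p i \<in> P"
  shows "(\<lambda>s. \<Sum>i\<in>I. a i * p i s) \<in> P"
  using assms
proof (induction I rule: finite_induct)
  case empty then show ?case using zero_mem by simp
next
  case (insert i I)
  have "(\<lambda>s. a i * p i s + 1 * (\<Sum>j\<in>I. a j * p j s)) \<in> P"
    by (rule comb_mem) (use insert in auto)
  then show ?case using insert by simp
qed

lemma free_empty: "free {}"
  by (simp add: free_def)

lemma free_subset: "free I \<Longrightarrow> J \<subseteq> I \<Longrightarrow> free J"
  unfolding free_def by blast

lemma free_dual:
  assumes "free I"
  obtains d where "dual_on I d"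
proof -
  have "\<exists>p\<in>P. \<forall>t\<in>I. p t = (if s = t then 1 else 0)" if s: "s \<in> I" for s
  proof -
    obtain p where "p \<in> P" "p s \<noteq> 0" "\<forall>t\<in>I - {s}. p t = 0"
      using assms s unfolding free_def by blast
    then show ?thesis
      by (intro bexI[of _ "\<lambda>t. (1 / p s) * p t"] scale_mem) auto
  qed
  then obtain d where "\<forall>s\<in>I. d s \<in> P \<and> (\<forall>t\<in>I. d s t = (if s = t then 1 else 0))"
    by metis
  then show ?thesis using that unfolding dual_on_def by blast
qed

text \<open>A function that is nonzero at \<open>x\<close> and zero on \<open>I\<close> serves as
  witness for \<open>x\<close> and also repairs the dual functions of \<open>I\<close>: a multiple
  of it is subtracted to make them vanish at \<open>x\<close>.\<close>

lemma free_insert_iff: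
  assumes "finite I" "free I" "x \<notin> I"
  shows "free (insert x I) \<longleftrightarrow> (\<exists>p\<in>P. p x \<noteq> 0 \<and> (\<forall>t\<in>I. p t = 0))"
proof
  assume "free (insert x I)"
  then show "\<exists>p\<in>P. p x \<noteq> 0 \<and> (\<forall>t\<in>I. p t = 0)"
    unfolding free_def using assms(3) by auto
next
  assume "\<exists>p\<in>P. p x \<noteq> 0 \<and> (\<forall>t\<in>I. p t = 0)"
  then obtain p where p: "p \<in> P" "p x \<noteq> 0" "\<forall>t\<in>I. p t = 0" by blast
  obtain d where d: "dual_on I d" using free_dual[OF assms(2)] .
  show "free (insert x I)"
    unfolding free_def
  proof
    fix s assume s: "s \<in> insert x I"
    show "\<exists>p\<in>P. p s \<noteq> 0 \<and> (\<forall>t\<in>insert x I - {s}. p t = 0)"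
    proof (cases "s = x")
      case True then show ?thesis using p assms(3) by auto
    next
      case False
      with s have sI: "s \<in> I" by simp
      have "(\<lambda>t. 1 * d s t + (- d s x / p x) * p t) \<in> P"
        by (rule comb_mem) (use d sI p in \<open>auto simp: dual_on_def\<close>)
      moreover have "d s t = (if s = t then 1 else 0)" if "t \<in> I" for t
        using d sI that by (simp add: dual_on_def)
      ultimately show ?thesis
        by (intro bexI[of _ "\<lambda>t. 1 * d s t + (- d s x / p x) * p t"])
          (use sI p False in \<open>auto split: if_splits\<close>)
    qed
  qed
qed

text \<open>Either the restriction to \<open>X\<close> is onto, or a nonzero functional kills its
  image. This links \<open>free\<close>, which speaks of elements of \<open>P\<close>, with column
  independence, which speaks of coefficients.\<close>

lemma free_or_dependent:
  assumes "finite X"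
  shows "free X \<or> (\<exists>c. (\<exists>s\<in>X. c s \<noteq> 0) \<and> (\<forall>p\<in>P. (\<Sum>s\<in>X. c s * p s) = (0::real)))"
  using assms
proof (induction X rule: finite_induct)
  case empty then show ?case by (simp add: free_empty)
next
  case (insert x X)
  show ?case
  proof (cases "free X")
    case False
    then obtain c s where c: "s \<in> X" "c s \<noteq> 0" "\<forall>p\<in>P. (\<Sum>s\<in>X. c s * p s) = 0"
      using insert by blast
    have "(\<Sum>s\<in>insert x X. (c(x := 0)) s * p s) = 0" if "p \<in> P" for p
    proof -
      have "(\<Sum>s\<in>X. (c(x := 0)) s * p s) = (\<Sum>s\<in>X. c s * p s)"
        by (rule sum.cong) (use insert in auto)
      then show ?thesis using insert c(3) that by simp
    qed
    moreover have "(c(x := 0)) s \<noteq> 0" using c insert by auto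
    ultimately show ?thesis using c(1) by blast
  next
    case True
    obtain d where d: "dual_on X d" using free_dual[OF True] .
    show ?thesis
    proof (cases "free (insert x X)")
      case False
      then have nx: "p x = 0" if "p \<in> P" "\<forall>t\<in>X. p t = 0" for p
        using free_insert_iff[OF insert(1) True insert(2)] that by blast
      \<comment> \<open>Every \<open>p\<close> in \<open>P\<close> agrees at \<open>x\<close> with
        its interpolation from \<open>X\<close>, since the difference vanishes on \<open>X\<close>;
        these coefficients express that relation.\<close>
      define c where "c = (\<lambda>s. if s = x then 1 else - d s x)"
      have "(\<Sum>s\<in>insert x X. c s * p s) = 0" if p: "p \<in> P" for p
      proof -
        define q where "q = (\<lambda>t. 1 * p t + (- 1) * (\<Sum>s\<in>X. p s * d s t))"
        have "q \<in> P" unfolding q_def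
          by (intro comb_mem p sum_mem) (use insert d in \<open>auto simp: dual_on_def\<close>)
        moreover have "q t = 0" if "t \<in> X" for t
        proof -
          have "(\<Sum>s\<in>X. p s * d s t) = (\<Sum>s\<in>X. if s = t then p s else 0)"
            by (rule sum.cong) (use d that in \<open>auto simp: dual_on_def\<close>)
          then show ?thesis using that insert(1) by (simp add: q_def)
        qed
        ultimately have "q x = 0" using nx by blast
        moreover have "(\<Sum>s\<in>X. c s * p s) = (\<Sum>s\<in>X. - (p s * d s x))"
          by (rule sum.cong) (use insert(2) in \<open>auto simp: c_def\<close>)
        ultimately show ?thesis
          using insert by (simp add: c_def q_def sum_negf)
      qed
      then show ?thesis by (intro disjI2 exI[of _ c]) (simp add: c_def)
    qed simp
  qed
qed

lemma maximal_free:
  assumes "finite T" "free J" "J \<subseteq> T"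
  obtains B where "J \<subseteq> B" "B \<subseteq> T" "free B" "spans B T"
proof -
  let ?A = "{B. J \<subseteq> B \<and> B \<subseteq> T \<and> free B}"
  have "finite ?A" by (rule finite_subset[of _ "Pow T"]) (use assms in auto)
  moreover have "?A \<noteq> {}" using assms by auto
  ultimately obtain B where B: "B \<in> ?A" "\<forall>C\<in>?A. B \<subseteq> C \<longrightarrow> B = C"
    by (rule bexE[OF finite_has_maximal])
  have "p t = 0" if p: "p \<in> P" "\<forall>s\<in>B. p s = 0" "t \<in> T" for p t
  proof (rule ccontr)
    assume n: "p t \<noteq> 0"
    have tB: "t \<notin> B" using n p by auto
    have "finite B" using B(1) assms(1) finite_subset by blast
    then have "free (insert t B)"
      using free_insert_iff[of B t] B(1) tB p n by blast
    then have "B = insert t B" using B p by blast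
    then show False using tB by blast
  qed
  then have "spans B T" unfolding spans_def by blast
  then show ?thesis using that B(1) by blast
qed

lemma dual_expansion:
  assumes "finite B" "dual_on B d" "spans B T" "p \<in> P" "t \<in> T"
  shows "p t = (\<Sum>s\<in>B. p s * d s t)"
proof -
  define q where "q = (\<lambda>t. 1 * p t + (- 1) * (\<Sum>s\<in>B. p s * d s t))"
  have "q \<in> P" unfolding q_def
    by (intro comb_mem sum_mem) (use assms in \<open>auto simp: dual_on_def\<close>)
  moreover have "q t = 0" if "t \<in> B" for t
  proof -
    have "(\<Sum>s\<in>B. p s * d s t) = (\<Sum>s\<in>B. if s = t then p s else 0)"
      by (rule sum.cong) (use assms that in \<open>auto simp: dual_on_def\<close>)
    then show ?thesis using that assms(1) by (simp add: q_def)
  qed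
  ultimately have "q t = 0" using assms(3,5) unfolding spans_def by blast
  then show ?thesis by (simp add: q_def)
qed

end

text \<open>Gaussian elimination with one pivot per induction step. Equations and unknowns are
  indexed by arbitrary finite sets, since the applications count edges against vertices.\<close>

lemma underdetermined_system:
  fixes m :: "'x \<Rightarrow> 'y \<Rightarrow> real"
  assumes "finite X" "finite Y" "card X < card Y"
  shows "\<exists>\<alpha>. (\<exists>y\<in>Y. \<alpha> y \<noteq> 0) \<and> (\<forall>x\<in>X. (\<Sum>y\<in>Y. m x y * \<alpha> y) = 0)"
  using assms
proof (induction X arbitrary: Y m rule: finite_induct)
  case empty
  then obtain y where "y \<in> Y" by (metis card_gt_0_iff ex_in_conv card.empty)
  then show ?case by (intro exI[of _ "\<lambda>_. 1"]) auto
next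
  case (insert x X)
  show ?case
  proof (cases "\<forall>y\<in>Y. m x y = 0")
    case True
    have "card X < card Y" using insert by simp
    then obtain \<alpha> where "\<exists>y\<in>Y. \<alpha> y \<noteq> 0" "\<forall>x\<in>X. (\<Sum>y\<in>Y. m x y * \<alpha> y) = 0"
      using insert.IH[of Y m] insert by blast
    then show ?thesis using True by (intro exI[of _ \<alpha>]) auto
  next
    case False
    then obtain z where z: "z \<in> Y" "m x z \<noteq> 0" by blast
    \<comment> \<open>Eliminates the unknown \<open>z\<close> from the remaining equations, with
      pivot \<open>m x z\<close>.\<close>
    define m' where "m' = (\<lambda>u y. m u y - m u z * m x y / m x z)"
    have "card X < card (Y - {z})" using insert z by simp
    then obtain \<alpha> where a: "\<exists>y\<in>Y - {z}. \<alpha> y \<noteq> 0"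
      "\<forall>u\<in>X. (\<Sum>y\<in>Y - {z}. m' u y * \<alpha> y) = 0"
      using insert.IH[of "Y - {z}" m'] insert by blast
    \<comment> \<open>The value at \<open>z\<close> is the one that solves equation
      \<open>x\<close>.\<close>
    define \<beta> where "\<beta> = \<alpha>(z := - (\<Sum>y\<in>Y - {z}. m x y * \<alpha> y) / m x z)"
    have split: "(\<Sum>y\<in>Y. m u y * \<beta> y) = m u z * \<beta> z + (\<Sum>y\<in>Y - {z}. m u y * \<alpha> y)" for u
    proof -
      have "(\<Sum>y\<in>Y - {z}. m u y * \<beta> y) = (\<Sum>y\<in>Y - {z}. m u y * \<alpha> y)"
        by (rule sum.cong) (auto simp: \<beta>_def)
      then show ?thesis using sum.remove[OF insert(4) z(1), of "\<lambda>y. m u y * \<beta> y"] by simp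
    qed
    have "(\<Sum>y\<in>Y. m u y * \<beta> y) = 0" if "u \<in> insert x X" for u
    proof (cases "u = x")
      case True then show ?thesis using z by (subst split) (simp add: \<beta>_def)
    next
      case False
      have "(\<Sum>y\<in>Y - {z}. m' u y * \<alpha> y) =
          (\<Sum>y\<in>Y - {z}. m u y * \<alpha> y) - m u z / m x z * (\<Sum>y\<in>Y - {z}. m x y * \<alpha> y)"
        by (simp add: m'_def algebra_simps sum_subtractf sum_distrib_left)
      then show ?thesis using False that a(2) by (subst split) (simp add: \<beta>_def)
    qed
    moreover have "\<exists>y\<in>Y. \<beta> y \<noteq> 0" using a(1) by (auto simp: \<beta>_def)
    ultimately show ?thesis by blast
  qed
qed

definition coordinate_matroid :: "'a set \<Rightarrow> ('a \<Rightarrow> real) set \<Rightarrow> 'a matroid" where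
  "coordinate_matroid T P = \<lparr>ground = T, indep = {I. I \<subseteq> T \<and> fun_space.free P I}\<rparr>"

context fun_space begin

text \<open>If no element of \<open>Y\<close> enlarges \<open>X\<close>, then \<open>X\<close> spans
  \<open>Y\<close>, so on \<open>Y\<close> all of \<open>P\<close> consists of combinations of the
  \<open>card X\<close> dual functions of \<open>X\<close>. Nonzero coefficients \<alpha> on
  \<open>Y\<close> that annihilate these few functions would annihilate the dual functions of
  \<open>Y\<close> too, and those read off the entries of \<alpha>.\<close>

lemma free_augment:
  assumes "finite X" "finite Y" "free X" "free Y" "card X < card Y"
  shows "\<exists>y\<in>Y - X. free (insert y X)"
proof (rule ccontr)
  assume neg: "\<not> ?thesis"
  have "p t = 0" if "p \<in> P" "\<forall>s\<in>X. p s = 0" "t \<in> Y" for p t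
    using neg free_insert_iff[OF assms(1,3)] that by blast
  then have van: "spans X Y" unfolding spans_def by blast
  obtain d where d: "dual_on X d" using free_dual[OF assms(3)] .
  obtain e where e: "dual_on Y e" using free_dual[OF assms(4)] .
  obtain \<alpha> y where a: "y \<in> Y" "\<alpha> y \<noteq> 0" "\<forall>x\<in>X. (\<Sum>y\<in>Y. d x y * \<alpha> y) = 0"
    using underdetermined_system[OF assms(1,2,5), of d] by blast
  have ey: "e y \<in> P" using e a(1) by (simp add: dual_on_def)
  have "(\<Sum>t\<in>Y. e y t * \<alpha> t) = (\<Sum>t\<in>Y. \<Sum>s\<in>X. e y s * (d s t * \<alpha> t))"
  proof (rule sum.cong)
    fix t assume "t \<in> Y"
    then have "e y t = (\<Sum>s\<in>X. e y s * d s t)"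
      by (rule dual_expansion[OF assms(1) d van ey])
    then show "e y t * \<alpha> t = (\<Sum>s\<in>X. e y s * (d s t * \<alpha> t))"
      by (simp add: sum_distrib_right mult.assoc)
  qed simp
  also have "\<dots> = (\<Sum>s\<in>X. e y s * (\<Sum>t\<in>Y. d s t * \<alpha> t))"
    by (subst sum.swap) (simp add: sum_distrib_left)
  also have "\<dots> = 0" using a(3) by simp
  finally have "(\<Sum>t\<in>Y. e y t * \<alpha> t) = 0" .
  moreover have "(\<Sum>t\<in>Y. e y t * \<alpha> t) = (\<Sum>t\<in>Y. if t = y then \<alpha> t else 0)"
    by (rule sum.cong) (use e a(1) in \<open>auto simp: dual_on_def\<close>)
  ultimately show False using a assms(2) by simp
qed

lemma coordinate_matroid_is_matroid:
  assumes "finite T" shows "is_matroid (coordinate_matroid T P)"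
proof -
  have "\<exists>y\<in>Y - X. insert y X \<subseteq> T \<and> free (insert y X)"
    if "X \<subseteq> T" "free X" "Y \<subseteq> T" "free Y" "card X < card Y" for X Y
  proof -
    have "finite X" "finite Y" using that finite_subset[OF _ assms] by simp_all
    then show ?thesis using free_augment[of X Y] that by blast
  qed
  moreover have "free Y" if "free X" "Y \<subseteq> X" for X Y using that by (rule free_subset)
  ultimately show ?thesis
    unfolding is_matroid_def coordinate_matroid_def
    using assms free_empty by (intro conjI; simp) blast+
qed

text \<open>A larger free set would contain an element that can be added to \<open>B\<close>,
  against \<open>spans B T\<close>.\<close>

lemma rank_coordinate_matroid:
  assumes "finite T" "B \<subseteq> T" "free B" "spans B T"
  shows "rank (coordinate_matroid T P) = card B"
proof -
  have "Max (card ` {I. I \<subseteq> T \<and> free I}) = card B"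
  proof (rule Max_eqI)
    show "finite (card ` {I. I \<subseteq> T \<and> free I})" using assms(1) by simp
    show "card B \<in> card ` {I. I \<subseteq> T \<and> free I}" using assms by blast
    fix k assume "k \<in> card ` {I. I \<subseteq> T \<and> free I}"
    then obtain I where I: "I \<subseteq> T" "free I" "k = card I" by blast
    show "k \<le> card B"
    proof (rule ccontr)
      assume "\<not> ?thesis"
      moreover have fin: "finite I" "finite B" using I assms finite_subset by blast+
      ultimately obtain y where y: "y \<in> I - B" "free (insert y B)"
        using free_augment[of B I] I assms by (meson not_le)
      then obtain p where "p \<in> P" "p y \<noteq> 0" "\<forall>t\<in>B. p t = 0"
        using free_insert_iff[of B y] assms fin by blast
      then show False using assms(4) I y unfolding spans_def by blast
    qed
  qed
  then show ?thesis by (simp add: rank_def coordinate_matroid_def)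
qed

lemma fun_space_vanishing: "fun_space {p \<in> P. \<forall>t\<in>X. p t = 0}"
  by unfold_locales (auto simp: zero_mem comb_mem)

text \<open>A function that vanishes on \<open>B\<close> vanishes on \<open>X\<close>, so the
  witnesses for \<open>I \<union> B\<close> at elements of \<open>I\<close> already lie in the
  subspace. Conversely, the elements of \<open>I\<close> are added to \<open>B\<close> one at a time
  with witnesses from the subspace.\<close>

lemma free_Un_iff_free_vanishing:
  assumes "finite E" "X \<subseteq> E" "B \<subseteq> X" "free B" "spans B X" "I \<subseteq> E - X"
  shows "free (I \<union> B) \<longleftrightarrow> fun_space.free {p \<in> P. \<forall>t\<in>X. p t = 0} I"
proof -
  interpret Q: fun_space "{p \<in> P. \<forall>t\<in>X. p t = 0}" by (rule fun_space_vanishing)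
  show ?thesis
  proof
    assume f: "free (I \<union> B)"
    show "Q.free I"
      unfolding Q.free_def
    proof
      fix s assume s: "s \<in> I"
      then obtain p where p: "p \<in> P" "p s \<noteq> 0" "\<forall>t\<in>I \<union> B - {s}. p t = 0"
        using f unfolding free_def by blast
      have "\<forall>t\<in>B. p t = 0" using p s assms(3,6) by blast
      then have "\<forall>t\<in>X. p t = 0" using assms(5) p(1) unfolding spans_def by blast
      then show "\<exists>p\<in>{p \<in> P. \<forall>t\<in>X. p t = 0}. p s \<noteq> 0 \<and> (\<forall>t\<in>I - {s}. p t = 0)"
        using p by blast
    qed
  next
    assume f: "Q.free I"
    have fB: "finite B" using finite_subset[OF assms(2,1)] assms(3) finite_subset by blast
    have "finite I" using assms(1,6) finite_subset by blast
    then show "free (I \<union> B)" using f assms(6)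
    proof (induction I rule: finite_induct)
      case empty then show ?case using assms by simp
    next
      case (insert x I)
      have "free (I \<union> B)" using insert Q.free_subset[of "insert x I" I] by blast
      moreover have "x \<notin> I \<union> B" using insert assms(3) by blast
      moreover obtain p where "p \<in> P" "\<forall>t\<in>X. p t = 0" "p x \<noteq> 0" "\<forall>t\<in>I. p t = 0"
        using insert.prems(1) insert.hyps unfolding Q.free_def by auto
      ultimately show ?case
        using free_insert_iff[of "I \<union> B" x] insert.hyps fB assms(3) by auto
    qed
  qed
qed

lemma basis_in_coordinate_matroid:
  assumes "finite X" "X \<subseteq> E"
  shows "basis_in (coordinate_matroid E P) X B \<longleftrightarrow> B \<subseteq> X \<and> free B \<and> spans B X"
proof
  assume b: "basis_in (coordinate_matroid E P) X B"
  then have B: "B \<subseteq> X" "free B" by (auto simp: basis_in_def coordinate_matroid_def)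
  obtain C where C: "B \<subseteq> C" "C \<subseteq> X" "free C" "spans C X"
    using maximal_free[OF assms(1) B(2,1)] .
  have "C = B" using b C assms(2) by (auto simp: basis_in_def coordinate_matroid_def)
  then show "B \<subseteq> X \<and> free B \<and> spans B X" using C by blast
next
  assume b: "B \<subseteq> X \<and> free B \<and> spans B X"
  have "C = B" if C: "C \<subseteq> X" "free C" "B \<subseteq> C" for C
  proof (rule ccontr)
    assume "C \<noteq> B"
    then obtain x where x: "x \<in> C - B" using C by blast
    then obtain p where "p \<in> P" "p x \<noteq> 0" "\<forall>t\<in>C - {x}. p t = 0"
      using C(2) unfolding free_def by blast
    then show False using b x C unfolding spans_def by blast
  qed
  then show "basis_in (coordinate_matroid E P) X B"
    using b assms(2) by (auto simp: basis_in_def coordinate_matroid_def)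
qed

text \<open>All bases of \<open>X\<close> yield the same independent sets, namely those of the
  subspace that vanishes on \<open>X\<close>, so the basis in the definition of contraction
  disappears.\<close>

lemma minor_coordinate_matroid:
  assumes "finite E" "X \<subseteq> E"
  shows "deletion (contraction (coordinate_matroid E P) X) Y =
    coordinate_matroid (E - X - Y) {p \<in> P. \<forall>t\<in>X. p t = 0}"
proof -
  have fin: "finite X" using assms finite_subset by blast
  note basis = basis_in_coordinate_matroid[OF fin assms(2)]
  obtain B where B: "{} \<subseteq> B" "B \<subseteq> X" "free B" "spans B X"
    using maximal_free[OF fin free_empty empty_subsetI] .
  have "(\<exists>B. basis_in (coordinate_matroid E P) X B \<and> I \<union> B \<in> indep (coordinate_matroid E P)) \<longleftrightarrow>
      fun_space.free {p \<in> P. \<forall>t\<in>X. p t = 0} I" if I: "I \<subseteq> E - X" for I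
  proof -
    have "I \<union> C \<in> indep (coordinate_matroid E P) \<longleftrightarrow>
        fun_space.free {p \<in> P. \<forall>t\<in>X. p t = 0} I"
      if C: "basis_in (coordinate_matroid E P) X C" for C
    proof -
      have C: "C \<subseteq> X" "free C" "spans C X" using C unfolding basis by auto
      have "I \<union> C \<in> indep (coordinate_matroid E P) \<longleftrightarrow> free (I \<union> C)"
        using I C assms by (auto simp: coordinate_matroid_def)
      then show ?thesis using free_Un_iff_free_vanishing[OF assms C I] by simp
    qed
    moreover have "basis_in (coordinate_matroid E P) X B" unfolding basis using B by blast
    ultimately show ?thesis by blast
  qed
  then show ?thesis
    unfolding deletion_def contraction_def by (auto simp: coordinate_matroid_def)
qed

end

section \<open>Regular chain groups\<close>

lemma det_of_left_invertible:
  fixes D E :: "int mat"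
  assumes "D \<in> carrier_mat k k" "E \<in> carrier_mat k k" "E * D = 1\<^sub>m k"
  shows "det D \<in> {-1, 0, 1}"
proof -
  have "det E * det D = 1" using det_mult[OF assms(2,1)] assms(3) by simp
  then have "det D dvd 1" by (metis dvd_triv_right)
  then show ?thesis by (simp add: zdvd1_eq) linarith
qed

text \<open>Tutte's regular chain groups: every nonzero coordinate of an element of \<open>P\<close> is the
  coordinate 1 of an integral element of no larger support.\<close>

locale regular_chain_group = fun_space P for P :: "('a \<Rightarrow> real) set" +
  fixes L :: "('a \<Rightarrow> int) set"
  assumes integral_zero: "(\<lambda>_. 0) \<in> L"
    and integral_comb: "p \<in> L \<Longrightarrow> q \<in> L \<Longrightarrow> (\<lambda>s. a * p s + b * q s) \<in> L"
    and integral_subset: "q \<in> L \<Longrightarrow> (\<lambda>s. real_of_int (q s)) \<in> P"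
    and primitive: "x \<in> P \<Longrightarrow> x s \<noteq> 0 \<Longrightarrow> \<exists>q\<in>L. q s = 1 \<and> (\<forall>t. x t = 0 \<longrightarrow> q t = 0)"
begin

lemma integral_sum:
  assumes "finite I" "\<And>i. i \<in> I \<Longrightarrow> p i \<in> L"
  shows "(\<lambda>s. \<Sum>i\<in>I. a i * p i s) \<in> L"
  using assms
proof (induction I rule: finite_induct)
  case empty then show ?case using integral_zero by simp
next
  case (insert i I)
  have "(\<lambda>s. a i * p i s + 1 * (\<Sum>j\<in>I. a j * p j s)) \<in> L"
    by (rule integral_comb) (use insert in auto)
  then show ?case using insert by simp
qed

text \<open>Primitive witnesses acquire no new nonzero coordinates, so they remain in the subspace;
  the structure thus survives contraction.\<close>

lemma vanishing:
  "regular_chain_group {p \<in> P. \<forall>t\<in>X. p t = 0} {q \<in> L. \<forall>t\<in>X. q t = 0}"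
proof -
  interpret Q: fun_space "{p \<in> P. \<forall>t\<in>X. p t = 0}" by (rule fun_space_vanishing)
  show ?thesis
  proof unfold_locales
    fix p s assume p: "p \<in> {p \<in> P. \<forall>t\<in>X. p t = 0}" "p s \<noteq> 0"
    then obtain q where "q \<in> L" "q s = 1" "\<forall>t. p t = 0 \<longrightarrow> q t = 0" using primitive by blast
    then show "\<exists>q\<in>{q \<in> L. \<forall>t\<in>X. q t = 0}. q s = 1 \<and> (\<forall>t. p t = 0 \<longrightarrow> q t = 0)"
      using p by blast
  qed (auto simp: integral_zero integral_comb integral_subset)
qed

lemma integral_dual:
  assumes "free I"
  obtains d where "\<forall>s\<in>I. d s \<in> L" "\<forall>s\<in>I. \<forall>t\<in>I. d s t = (if s = t then 1 else 0)"
proof -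
  have "\<exists>q\<in>L. \<forall>t\<in>I. q t = (if s = t then 1 else 0)" if s: "s \<in> I" for s
  proof -
    obtain p where p: "p \<in> P" "p s \<noteq> 0" "\<forall>t\<in>I - {s}. p t = 0"
      using assms s unfolding free_def by blast
    then obtain q where "q \<in> L" "q s = 1" "\<forall>t. p t = 0 \<longrightarrow> q t = 0" using primitive by blast
    then show ?thesis using p by (intro bexI[of _ q]) auto
  qed
  then obtain d where "\<forall>s\<in>I. d s \<in> L \<and> (\<forall>t\<in>I. d s t = (if s = t then 1 else 0))"
    by metis
  then show ?thesis using that by blast
qed

lemma integral_expansion:
  assumes "finite B" "\<forall>s\<in>B. d s \<in> L" "\<forall>s\<in>B. \<forall>t\<in>B. d s t = (if s = t then 1 else 0)"
    "spans B T" "q \<in> L" "t \<in> T"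
  shows "q t = (\<Sum>s\<in>B. q s * d s t)"
proof -
  have "dual_on B (\<lambda>s t. real_of_int (d s t))"
    using assms(2,3) integral_subset by (simp add: dual_on_def)
  from dual_expansion[OF assms(1) this assms(4) integral_subset[OF assms(5)] assms(6)]
  have "real_of_int (q t) = real_of_int (\<Sum>s\<in>B. q s * d s t)" by simp
  then show ?thesis by (simp only: of_int_eq_iff)
qed

text \<open>A nonsingular square submatrix \<open>D\<close> has an integral left inverse. Cramer's
  rule gives combinations of its rows that are nonzero on just one of its columns; primitivity
  replaces each of them by an integral element with value 1 there, and that element is again a
  combination of the same rows.\<close>

lemma totally_unimodular_dual:
  assumes "finite T" "B \<subseteq> T" "spans B T"
    and d: "\<forall>s\<in>B. d s \<in> L" "\<forall>s\<in>B. \<forall>t\<in>B. d s t = (if s = t then 1 else 0)"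
    and b: "bij_betw b {..<g} B"
  shows "totally_unimodular g T (\<lambda>i. d (b i))"
  unfolding totally_unimodular_def
proof (intro allI impI)
  fix k and r :: "nat \<Rightarrow> nat" and c :: "nat \<Rightarrow> 'a"
  assume r: "inj_on r {..<k}" "r ` {..<k} \<subseteq> {..<g}" and c: "inj_on c {..<k}" "c ` {..<k} \<subseteq> T"
  define D where "D = mat k k (\<lambda>(i, j). d (b (r i)) (c j))"
  have D: "D \<in> carrier_mat k k" by (simp add: D_def)
  have bB: "b (r i) \<in> B" if "i < k" for i using b r(2) that by (force simp: bij_betw_def)
  have fB: "finite B" using assms finite_subset by blast
  show "det (mat k k (\<lambda>(i, j). d (b (r i)) (c j))) \<in> {-1, 0, 1}"
  proof (cases "det D = 0")
    case True then show ?thesis by (simp add: D_def)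
  next
    case False
    have cT: "c j \<in> T" if "j < k" for j using c that by blast
    define R where "R = (\<lambda>i. b (r i)) ` {..<k}"
    have inj: "inj_on (\<lambda>i. b (r i)) {..<k}"
      using comp_inj_on[OF r(1) inj_on_subset[OF bij_betw_imp_inj_on[OF b] r(2)]]
      by (simp add: comp_def)
    have RB: "R \<subseteq> B" using bB by (auto simp: R_def)
    \<comment> \<open>Row \<open>j\<close> of the adjugate: \<open>p j\<close> has the value
      \<open>det D\<close> at the column \<open>c j\<close> and 0 at the other chosen
      columns.\<close>
    define p where "p = (\<lambda>j t. \<Sum>l<k. adj_mat D $$ (j, l) * d (b (r l)) t)"
    have pL: "p j \<in> L" for j
      unfolding p_def by (rule integral_sum) (use bB d in auto)
    have pc: "p j (c m) = (if j = m then det D else 0)" if jm: "j < k" "m < k" for j m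
    proof -
      have "p j (c m) = (\<Sum>l<k. adj_mat D $$ (j, l) * D $$ (l, m))"
        using jm by (simp add: p_def D_def)
      also have "\<dots> = (adj_mat D * D) $$ (j, m)"
        using adj_mat(1)[OF D] D jm by (simp add: scalar_prod_def atLeast0LessThan)
      also have "\<dots> = (if j = m then det D else 0)" using adj_mat(3)[OF D] jm by simp
      finally show ?thesis .
    qed
    have pB: "p j s = 0" if "s \<in> B - R" for j s
      unfolding p_def
    proof (rule sum.neutral, rule ballI)
      fix l assume "l \<in> {..<k}"
      then show "adj_mat D $$ (j, l) * d (b (r l)) s = 0"
        using that bB[of l] d(2) by (auto simp: R_def)
    qed
    have "\<exists>q\<in>L. q (c j) = 1 \<and> (\<forall>t. p j t = 0 \<longrightarrow> q t = 0)" if j: "j < k" for j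
      using primitive[OF integral_subset[OF pL[of j]], of "c j"] pc[OF j j] False by simp
    then obtain q where q: "\<And>j. j < k \<Longrightarrow> q j \<in> L" "\<And>j. j < k \<Longrightarrow> q j (c j) = 1"
      "\<And>j t. j < k \<Longrightarrow> p j t = 0 \<Longrightarrow> q j t = 0" by metis
    have qc: "q j (c m) = (if j = m then 1 else 0)" if jm: "j < k" "m < k" for j m
      using q(2)[OF jm(1)] q(3)[OF jm(1), of "c m"] pc[OF jm] by auto
    define E where "E = mat k k (\<lambda>(j, l). q j (b (r l)))"
    have E: "E \<in> carrier_mat k k" by (simp add: E_def)
    have "(E * D) $$ (j, m) = (if j = m then 1 else 0)" if jm: "j < k" "m < k" for j m
    proof -
      have "(E * D) $$ (j, m) = (\<Sum>l<k. q j (b (r l)) * d (b (r l)) (c m))"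
        using jm D E by (simp add: scalar_prod_def atLeast0LessThan D_def E_def)
      also have "\<dots> = (\<Sum>s\<in>R. q j s * d s (c m))"
        unfolding R_def by (subst sum.reindex[OF inj]) simp
      \<comment> \<open>Basis elements outside \<open>R\<close> contribute nothing:
        \<open>p j\<close> vanishes there, and \<open>q j\<close> has no new nonzero values.\<close>
      also have "\<dots> = (\<Sum>s\<in>B. q j s * d s (c m))"
        by (rule sum.mono_neutral_left[OF fB RB]) (use q(3)[OF jm(1)] pB in auto)
      also have "\<dots> = q j (c m)"
        by (rule integral_expansion[OF fB d assms(3) q(1)[OF jm(1)] cT[OF jm(2)], symmetric])
      finally show ?thesis using qc[OF jm] by simp
    qed
    then have "E * D = 1\<^sub>m k" using D E by (intro eq_matI) auto
    from det_of_left_invertible[OF D E this] show ?thesis by (simp add: D_def)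
  qed
qed

text \<open>The rows are the integral dual functions of a basis \<open>B\<close>, which form the
  identity block on the columns in \<open>B\<close>. Their integer combinations give back all of
  \<open>L\<close> on \<open>T\<close>, so that afterwards the Albanese graph is described by
  \<open>L\<close> alone.\<close>

lemma coordinate_matroid_realization:
  assumes "finite T"
  obtains A where "tu_realization (coordinate_matroid T P) A"
    "row_lattice (rank (coordinate_matroid T P)) T A = (\<lambda>q s. if s \<in> T then q s else 0) ` L"
proof -
  obtain B where B: "{} \<subseteq> B" "B \<subseteq> T" "free B" "spans B T"
    using maximal_free[OF assms free_empty empty_subsetI] .
  have fB: "finite B" using B assms finite_subset by blast
  let ?M = "coordinate_matroid T P"
  have g: "rank ?M = card B" by (rule rank_coordinate_matroid[OF assms B(2-4)])
  obtain b where b: "bij_betw b {..<card B} B"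
    using ex_bij_betw_nat_finite[OF fB] by (auto simp: atLeast0LessThan)
  obtain d where d: "\<forall>s\<in>B. d s \<in> L" "\<forall>s\<in>B. \<forall>t\<in>B. d s t = (if s = t then 1 else (0::int))"
    using integral_dual[OF B(3)] .
  define A where "A = (\<lambda>i. d (b i))"
  have bB: "b i \<in> B" if "i < card B" for i using b that by (auto simp: bij_betw_def)
  have bi: "b i = b j \<longleftrightarrow> i = j" if "i < card B" "j < card B" for i j
    using b that by (auto simp: bij_betw_def inj_on_def)
  have AL: "A i \<in> L" if "i < card B" for i using d bB[OF that] by (simp add: A_def)
  have expand: "q t = (\<Sum>i<card B. q (b i) * A i t)" if "q \<in> L" "t \<in> T" for q t
    using integral_expansion[OF fB d B(4) that]
      sum.reindex_bij_betw[OF b, of "\<lambda>s. q s * d s t"] by (simp add: A_def)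
  have ci: "columns_independent (card B) A I \<longleftrightarrow> free I" if I: "I \<subseteq> T" for I
  proof
    have fI: "finite I" using I assms finite_subset by blast
    assume c: "columns_independent (card B) A I"
    show "free I"
    proof (rule ccontr)
      assume "\<not> free I"
      then obtain c s where cs: "s \<in> I" "c s \<noteq> 0" "\<forall>p\<in>P. (\<Sum>s\<in>I. c s * p s) = 0"
        using free_or_dependent[OF fI] by blast
      have "\<forall>i<card B. (\<Sum>s\<in>I. c s * real_of_int (A i s)) = 0"
        using bspec[OF cs(3) integral_subset[OF AL]] by blast
      then show False using c cs(1,2) unfolding columns_independent_def by blast
    qed
  next
    assume f: "free I"
    have fI: "finite I" using I assms finite_subset by blast
    obtain e where e: "\<forall>s\<in>I. e s \<in> L" "\<forall>s\<in>I. \<forall>t\<in>I. e s t = (if s = t then 1 else (0::int))"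
      using integral_dual[OF f] .
    show "columns_independent (card B) A I"
      unfolding columns_independent_def
    proof (intro allI impI ballI)
      fix c :: "'a \<Rightarrow> real" and u
      assume c: "\<forall>i<card B. (\<Sum>s\<in>I. c s * real_of_int (A i s)) = 0" and u: "u \<in> I"
      \<comment> \<open>Pairing with the dual element \<open>e u\<close> isolates
        \<open>c u\<close>, and \<open>e u\<close> is a combination of rows, with which
        \<open>c\<close> pairs to 0.\<close>
      have "c u = (\<Sum>s\<in>I. c s * real_of_int (e u s))"
      proof -
        have "(\<Sum>s\<in>I. c s * real_of_int (e u s)) = (\<Sum>s\<in>I. if s = u then c s else 0)"
          by (rule sum.cong) (use e u in auto)
        then show ?thesis using fI u by simp
      qed
      also have "\<dots> = (\<Sum>s\<in>I. \<Sum>i<card B. real_of_int (e u (b i)) * (c s * real_of_int (A i s)))"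
      proof (rule sum.cong)
        fix s assume "s \<in> I"
        then have "e u s = (\<Sum>i<card B. e u (b i) * A i s)"
          using expand[of "e u" s] e(1) u I by blast
        from arg_cong[OF this, of real_of_int]
        have "real_of_int (e u s) = (\<Sum>i<card B. real_of_int (e u (b i)) * real_of_int (A i s))"
          by simp
        then show "c s * real_of_int (e u s) =
            (\<Sum>i<card B. real_of_int (e u (b i)) * (c s * real_of_int (A i s)))"
          by (simp add: sum_distrib_left algebra_simps)
      qed simp
      also have "\<dots> = (\<Sum>i<card B. real_of_int (e u (b i)) * (\<Sum>s\<in>I. c s * real_of_int (A i s)))"
        by (subst sum.swap) (simp add: sum_distrib_left)
      also have "\<dots> = 0" using c by simp
      finally show "c u = 0" .
    qed
  qed
  have "tu_realization ?M A"
    unfolding tu_realization_def g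
  proof (intro conjI)
    show "totally_unimodular (card B) (ground ?M) A"
      using totally_unimodular_dual[OF assms B(2,4) d b]
      by (simp add: A_def coordinate_matroid_def)
    show "\<exists>b. (\<forall>j<card B. b j \<in> ground ?M) \<and>
        (\<forall>i<card B. \<forall>j<card B. A i (b j) = (if i = j then 1 else 0))"
      using bB B(2) d(2) bi by (intro exI[of _ b]) (auto simp: A_def coordinate_matroid_def)
    show "indep ?M = {X. X \<subseteq> ground ?M \<and> columns_independent (card B) A X}"
      using ci by (auto simp: coordinate_matroid_def)
  qed
  moreover have "row_lattice (rank ?M) T A = (\<lambda>q s. if s \<in> T then q s else 0) ` L"
  proof (rule equalityI; rule subsetI)
    fix u assume "u \<in> row_lattice (rank ?M) T A"
    then obtain z where u: "u = (\<lambda>s. if s \<in> T then (\<Sum>i<card B. z i * A i s) else 0)"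
      unfolding row_lattice_def g by blast
    have "(\<lambda>s. \<Sum>i<card B. z i * A i s) \<in> L" by (rule integral_sum) (use AL in auto)
    then show "u \<in> (\<lambda>q s. if s \<in> T then q s else 0) ` L"
      unfolding u by (rule image_eqI[rotated]) simp
  next
    fix u assume "u \<in> (\<lambda>q s. if s \<in> T then q s else 0) ` L"
    then obtain q where q: "q \<in> L" "u = (\<lambda>s. if s \<in> T then q s else 0)" by blast
    have "u = (\<lambda>s. if s \<in> T then (\<Sum>i<card B. q (b i) * A i s) else 0)"
      using expand[OF q(1)] q(2) by auto
    then show "u \<in> row_lattice (rank ?M) T A"
      unfolding row_lattice_def g by (intro CollectI exI[of _ "\<lambda>i. q (b i)"]) simp
  qed
  ultimately show ?thesis using that by blast
qed

end

section \<open>Solutions modulo 3 and their passage to minors\<close>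

section \<open>Solutions given by lists of base points\<close>

lemma UNIV_3: "(UNIV :: 3 set) = {0, 1, 2}"
proof -
  have "x \<in> {0, 1, 2}" for x :: 3
  proof (cases x)
    case (of_int z)
    then have "z = 0 \<or> z = 1 \<or> z = 2" by auto
    then show ?thesis using of_int by auto
  qed
  then show ?thesis by blast
qed

lemma finite_vectors: "finite S \<Longrightarrow> finite (vectors S :: ('a \<Rightarrow> 'f::{zero, finite}) set)"
  by (rule finite_subset[OF _ finite_set_of_finite_funs[of S UNIV "0 :: 'f"]])
    (auto simp: vectors_def)

lemma finite_arcs_albanese:
  fixes W :: "('a \<Rightarrow> 'f::{comm_ring_1, finite}) set"
  shows "finite S \<Longrightarrow> finite (arcs (albanese S W))"
  by (simp add: albanese_def finite_vectors)

lemma sum_basis_vector: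
  assumes "finite A" "x \<in> A"
  shows "(\<Sum>y\<in>A. h y * basis_vector x y) = (h x :: 'f::comm_ring_1)"
proof -
  have "(\<Sum>y\<in>A. h y * basis_vector x y) = (\<Sum>y\<in>A. if y = x then h y else 0)"
    by (rule sum.cong) (auto simp: basis_vector_def)
  then show ?thesis using assms by simp
qed

text \<open>Summation by parts: the boundary is paired with \<open>h\<close> and the order of
  summation exchanged. Heads of edges are vertices again because the basis vector of a color in
  \<open>S\<close> is supported in \<open>S\<close>.\<close>

lemma closed_chain_pairing:
  fixes W :: "('a \<Rightarrow> 'f::{comm_ring_1, finite}) set"
  assumes "finite S" "closed_chain (albanese S W) b"
  shows "(\<Sum>e\<in>arcs (albanese S W). b e *
    (h (head (albanese S W) e) - h (tail (albanese S W) e))) = 0"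
proof -
  let ?G = "albanese S W"
  have fv: "finite (verts ?G)" using assms(1) by (simp add: albanese_def finite_vectors)
  have ends: "head ?G e \<in> verts ?G" "tail ?G e \<in> verts ?G" if "e \<in> arcs ?G" for e
  proof -
    have "fst e \<in> (\<lambda>v. v +o W) ` vectors S" "snd e \<in> S"
      using that by (auto simp: albanese_def)
    then obtain v s where e: "e = (v +o W, s)" "v \<in> vectors S" "s \<in> S"
      by (cases e) auto
    have "basis_vector s + v \<in> vectors S"
      using e(2,3) by (auto simp: vectors_def basis_vector_def)
    moreover have "head ?G e = (basis_vector s + v) +o W"
      by (simp add: e(1) albanese_def set_plus_rearrange2)
    ultimately show "head ?G e \<in> verts ?G" by (simp add: albanese_def)
    show "tail ?G e \<in> verts ?G" using e by (auto simp: albanese_def)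
  qed
  have "0 = (\<Sum>x\<in>verts ?G. h x * boundary ?G b x)"
    using assms(2) by (simp add: closed_chain_def)
  also have "\<dots> = (\<Sum>x\<in>verts ?G. \<Sum>e\<in>arcs ?G.
      b e * (h x * basis_vector (head ?G e) x - h x * basis_vector (tail ?G e) x))"
    by (simp add: boundary_def sum_distrib_left algebra_simps)
  also have "\<dots> = (\<Sum>e\<in>arcs ?G. b e * ((\<Sum>x\<in>verts ?G. h x * basis_vector (head ?G e) x) -
      (\<Sum>x\<in>verts ?G. h x * basis_vector (tail ?G e) x)))"
    by (subst sum.swap) (simp add: sum_distrib_left sum_subtractf algebra_simps)
  also have "\<dots> = (\<Sum>e\<in>arcs ?G. b e * (h (head ?G e) - h (tail ?G e)))"
    by (rule sum.cong) (use fv ends in \<open>simp_all add: sum_basis_vector\<close>)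
  finally show ?thesis by simp
qed

text \<open>The list \<open>L s\<close> collects, with multiplicity, the tails of the edges of color \<open>s\<close>; closedness
  is tested against all functions \<open>h\<close> on the vertices.\<close>

definition solvable :: "'a set \<Rightarrow> ('a \<Rightarrow> 3) set \<Rightarrow> bool" where
  "solvable T W \<longleftrightarrow> (\<exists>L.
     (\<forall>s\<in>T. set (L s) \<subseteq> vectors T \<and> of_nat (length (L s)) = (2 :: 3)) \<and>
     (\<forall>c\<in>W. \<forall>h :: ('a \<Rightarrow> 3) \<Rightarrow> 3. (\<forall>x. \<forall>w\<in>W. h (x + w) = h x) \<longrightarrow>
        (\<Sum>s\<in>T. c s * (\<Sum>x\<leftarrow>L s. h (x + basis_vector s) - h x)) = 0))"

text \<open>Closedness at a vertex is the test against its indicator function, which is constant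
  along \<open>W\<close>. The profile counts the entries of a list modulo 3, hence the value
  2.\<close>

lemma solvable_imp_solution:
  assumes "finite T" "solvable T W" and W: "\<And>v w. v \<in> W \<Longrightarrow> w \<in> W \<Longrightarrow> v + w \<in> W"
    "\<And>w. w \<in> W \<Longrightarrow> - w \<in> W"
  shows "\<exists>b. is_solution T W b \<and> (\<forall>s\<in>T. color_profile (albanese T W) (b s) s = 2)"
proof -
  from assms(2) obtain L where
    L12: "\<forall>s\<in>T. set (L s) \<subseteq> vectors T \<and> of_nat (length (L s)) = (2 :: 3)" and
    L3: "\<forall>c\<in>W. \<forall>h :: ('a \<Rightarrow> 3) \<Rightarrow> 3. (\<forall>x. \<forall>w\<in>W. h (x + w) = h x) \<longrightarrow>
        (\<Sum>s\<in>T. c s * (\<Sum>x\<leftarrow>L s. h (x + basis_vector s) - h x)) = 0"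
    unfolding solvable_def by (elim exE conjE)
  have L: "set (L s) \<subseteq> vectors T" "of_nat (length (L s)) = (2 :: 3)" if "s \<in> T" for s
    using L12 that by blast+
  note L = L L3[rule_format]
  let ?G = "albanese T W"
  have fin: "finite (arcs ?G)" by (rule finite_arcs_albanese[OF assms(1)])
  have ends: "head ?G (x, s) = basis_vector s +o x" "tail ?G (x, s) = x" for x s
    by (simp_all add: albanese_def)
  define b :: "'a \<Rightarrow> ('a \<Rightarrow> 3) set \<times> 'a \<Rightarrow> 3" where
    "b = (\<lambda>s e. \<Sum>x\<leftarrow>L s. basis_vector (x +o W, s) e)"
  have pair: "(\<Sum>e\<in>arcs ?G. b s e * f e) = (\<Sum>x\<leftarrow>L s. f (x +o W, s))" if s: "s \<in> T" for s f
  proof -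
    have "(\<Sum>e\<in>arcs ?G. (\<Sum>x\<leftarrow>xs. basis_vector (x +o W, s) e) * f e) = (\<Sum>x\<leftarrow>xs. f (x +o W, s))"
      if "set xs \<subseteq> vectors T" for xs
      using that
    proof (induction xs)
      case Nil then show ?case by simp
    next
      case (Cons x xs)
      have "(x +o W, s) \<in> arcs ?G" using Cons s by (auto simp: albanese_def)
      then have "(\<Sum>e\<in>arcs ?G. f e * basis_vector (x +o W, s) e) = f (x +o W, s)"
        by (rule sum_basis_vector[OF fin])
      then show ?case using Cons by (simp add: distrib_left sum.distrib mult.commute[of _ "f _"])
    qed
    then show ?thesis unfolding b_def using L(1)[OF s] by simp
  qed
  have supp: "b s e = 0" if "s \<in> T" "e \<notin> arcs ?G \<or> snd e \<noteq> s" for s e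
  proof -
    have "(\<Sum>x\<leftarrow>xs. basis_vector (x +o W, s) e) = (0::3)" if "set xs \<subseteq> vectors T" for xs
      using that \<open>s \<in> T\<close> \<open>e \<notin> arcs ?G \<or> snd e \<noteq> s\<close>
      by (induction xs) (auto simp: basis_vector_def albanese_def)
    then show ?thesis unfolding b_def using L(1)[OF that(1)] by simp
  qed
  have "closed_chain ?G (\<lambda>e. \<Sum>s\<in>T. c s * b s e)" if c: "c \<in> W" for c
    unfolding closed_chain_def
  proof (intro conjI allI)
    show "(\<lambda>e. \<Sum>s\<in>T. c s * b s e) \<in> chains ?G" by (simp add: chains_def supp)
    fix y
    define h where "h = (\<lambda>x. basis_vector (x +o W) y :: 3)"
    have coset: "(x + w) +o W = x +o W" if "w \<in> W" for x w
    proof -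
      have "\<exists>u\<in>W. x + w + v = x + u" if "v \<in> W" for v
        using W(1)[OF \<open>w \<in> W\<close> that] by (metis add.assoc)
      moreover have "\<exists>u\<in>W. x + v = x + w + u" if "v \<in> W" for v
        using W(1)[OF W(2)[OF \<open>w \<in> W\<close>] that] by (intro bexI[of _ "- w + v"]) (simp_all add: algebra_simps)
      ultimately show ?thesis unfolding elt_set_plus_def by blast
    qed
    have h: "h (x + w) = h x" if "w \<in> W" for x w using coset[OF that] by (simp add: h_def)
    have "boundary ?G (\<lambda>e. \<Sum>s\<in>T. c s * b s e) y = (\<Sum>s\<in>T. c s *
        (\<Sum>e\<in>arcs ?G. b s e * (basis_vector (head ?G e) y - basis_vector (tail ?G e) y)))"
      unfolding boundary_def by (simp add: sum_distrib_right sum_distrib_left mult.assoc) (rule sum.swap)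
    also have "\<dots> = (\<Sum>s\<in>T. c s * (\<Sum>x\<leftarrow>L s. h (x + basis_vector s) - h x))"
      by (rule sum.cong) (simp_all add: pair ends h_def set_plus_rearrange2 add.commute)
    also have "\<dots> = 0" using L(3)[OF c h] .
    finally show "boundary ?G (\<lambda>e. \<Sum>s\<in>T. c s * b s e) y = 0" .
  qed
  then have "is_solution T W b" unfolding is_solution_def chains_def using supp by blast
  moreover have "color_profile ?G (b s) s = 2" if s: "s \<in> T" for s
    unfolding color_profile_def pair[OF s] using L(2)[OF s]
    by (simp add: basis_vector_def sum_list_triv)
  ultimately show ?thesis by blast
qed

section \<open>Minors\<close>

text \<open>The subspace that defines the Albanese graph of a minor: the lattice of the contraction
  by \<open>X\<close>, restricted to the surviving elements \<open>T\<close> and reduced modulo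
  3.\<close>

definition residue_space :: "('a \<Rightarrow> int) set \<Rightarrow> 'a set \<Rightarrow> 'a set \<Rightarrow> ('a \<Rightarrow> 3) set" where
  "residue_space L X T =
     (\<lambda>q s. if s \<in> T then of_int (q s) else 0) ` {q \<in> L. \<forall>t\<in>X. q t = 0}"

text \<open>The map \<open>r\<close> induces a map of Albanese graphs, along which base points are
  pushed forward. A color outside \<open>T'\<close> drops out of the lifted relation, either because
  its coefficient is 0 or because its edges become loops, which have no boundary.\<close>

lemma solvable_map:
  fixes W :: "('a \<Rightarrow> 3) set"
  assumes "finite T" "solvable T W" "T' \<subseteq> T"
    and r: "\<And>x. r x \<in> vectors T'" "\<And>x y. r (x + y) = r x + r y"
      "\<And>s. s \<in> T' \<Longrightarrow> r (basis_vector s) = basis_vector s" "\<And>w. w \<in> W \<Longrightarrow> r w \<in> W'"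
    and lift: "\<And>c'. c' \<in> W' \<Longrightarrow> \<exists>c\<in>W. (\<forall>s\<in>T'. c s = c' s) \<and>
      (\<forall>s\<in>T - T'. c s = 0 \<or> r (basis_vector s) \<in> W')"
  shows "solvable T' W'"
proof -
  from assms(2) obtain L where
    L12: "\<forall>s\<in>T. set (L s) \<subseteq> vectors T \<and> of_nat (length (L s)) = (2 :: 3)" and
    L3: "\<forall>c\<in>W. \<forall>h :: ('a \<Rightarrow> 3) \<Rightarrow> 3. (\<forall>x. \<forall>w\<in>W. h (x + w) = h x) \<longrightarrow>
        (\<Sum>s\<in>T. c s * (\<Sum>x\<leftarrow>L s. h (x + basis_vector s) - h x)) = 0"
    unfolding solvable_def by (elim exE conjE)
  have L: "set (L s) \<subseteq> vectors T" "of_nat (length (L s)) = (2 :: 3)" if "s \<in> T" for s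
    using L12 that by blast+
  note L = L L3[rule_format]
  have "(\<Sum>s\<in>T'. c' s * (\<Sum>x\<leftarrow>map r (L s). h (x + basis_vector s) - h x)) = 0"
    if c': "c' \<in> W'" and h: "\<forall>x. \<forall>w\<in>W'. h (x + w) = h x" for c' and h :: "('a \<Rightarrow> 3) \<Rightarrow> 3"
  proof -
    obtain c where c: "c \<in> W" "\<And>s. s \<in> T' \<Longrightarrow> c s = c' s"
      "\<And>s. s \<in> T - T' \<Longrightarrow> c s = 0 \<or> r (basis_vector s) \<in> W'"
      using lift[OF c'] by blast
    have hr: "h (r (x + w)) = h (r x)" if "w \<in> W" for x w
      using h r(4)[OF that] by (simp add: r(2))
    have "(\<Sum>s\<in>T. c s * (\<Sum>x\<leftarrow>L s. h (r (x + basis_vector s)) - h (r x))) = 0"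
      by (rule L(3)[OF c(1) hr])
    also have "(\<Sum>s\<in>T. c s * (\<Sum>x\<leftarrow>L s. h (r (x + basis_vector s)) - h (r x))) =
        (\<Sum>s\<in>T'. c s * (\<Sum>x\<leftarrow>L s. h (r (x + basis_vector s)) - h (r x)))"
    proof (rule sum.mono_neutral_right[OF assms(1,3)], rule ballI)
      fix s assume "s \<in> T - T'"
      then have "c s = 0 \<or> (\<forall>x. h (r x + r (basis_vector s)) = h (r x))" using c(3) h by blast
      then show "c s * (\<Sum>x\<leftarrow>L s. h (r (x + basis_vector s)) - h (r x)) = 0"
        by (auto simp: r(2) sum_list_triv)
    qed
    also have "\<dots> = (\<Sum>s\<in>T'. c' s * (\<Sum>x\<leftarrow>map r (L s). h (x + basis_vector s) - h x))"
      by (rule sum.cong) (simp_all add: c(2) r(2,3) comp_def)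
    finally show ?thesis .
  qed
  then show ?thesis
    unfolding solvable_def
    by (intro exI[of _ "\<lambda>s. map r (L s)"]) (use assms(3) L(2) r(1) in auto)
qed

context regular_chain_group begin

lemma residue_space_add:
  assumes "v \<in> residue_space L X T" "w \<in> residue_space L X T"
  shows "v + w \<in> residue_space L X T"
proof -
  obtain p q where "p \<in> {q \<in> L. \<forall>t\<in>X. q t = 0}" "v = (\<lambda>s. if s \<in> T then of_int (p s) else 0)"
    "q \<in> {q \<in> L. \<forall>t\<in>X. q t = 0}" "w = (\<lambda>s. if s \<in> T then of_int (q s) else 0)"
    using assms unfolding residue_space_def by blast
  then show ?thesis
    using integral_comb[of p q 1 1] unfolding residue_space_def
    by (intro image_eqI[of _ _ "\<lambda>s. 1 * p s + 1 * q s"]) auto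
qed

lemma residue_space_minus:
  assumes "w \<in> residue_space L X T" shows "- w \<in> residue_space L X T"
proof -
  obtain p where "p \<in> {q \<in> L. \<forall>t\<in>X. q t = 0}" "w = (\<lambda>s. if s \<in> T then of_int (p s) else 0)"
    using assms unfolding residue_space_def by blast
  then show ?thesis
    using integral_comb[of p p "-1" 0] unfolding residue_space_def
    by (intro image_eqI[of _ _ "\<lambda>s. -1 * p s + 0 * p s"]) auto
qed

text \<open>Forgetting the coordinates in \<open>Y\<close> turns the edges of deleted colors into
  loops, so any lift of a relation will do.\<close>

lemma solvable_delete:
  assumes "finite T" "solvable T (residue_space L X T)"
  shows "solvable (T - Y) (residue_space L X (T - Y))"
proof (rule solvable_map[OF assms(1,2), where r = "\<lambda>x s. if s \<in> T - Y then x s else 0"])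
  fix c' assume "c' \<in> residue_space L X (T - Y)"
  then obtain q where q: "q \<in> L" "\<forall>t\<in>X. q t = 0" "c' = (\<lambda>s. if s \<in> T - Y then of_int (q s) else 0)"
    unfolding residue_space_def by blast
  have "(\<lambda>s. 0) \<in> residue_space L X (T - Y)"
    unfolding residue_space_def using integral_zero by (intro image_eqI[of _ _ "\<lambda>_. 0"]) auto
  moreover have "(\<lambda>t. if t \<in> T - Y then basis_vector s t else 0) = (\<lambda>_. 0 :: 3)"
    if "s \<in> T - (T - Y)" for s
    using that by (auto simp: basis_vector_def)
  moreover have "(\<lambda>s. if s \<in> T then of_int (q s) else 0) \<in> residue_space L X T"
    unfolding residue_space_def using q by blast
  ultimately show "\<exists>c\<in>residue_space L X T. (\<forall>s\<in>T - Y. c s = c' s) \<and> (\<forall>s\<in>T - (T - Y). c s = 0 \<or>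
      (\<lambda>t. if t \<in> T - Y then basis_vector s t else 0) \<in> residue_space L X (T - Y))"
    by (intro bexI[of _ "\<lambda>s. if s \<in> T then of_int (q s) else 0"]) (simp_all add: q(3))
next
  fix w assume "w \<in> residue_space L X T"
  then obtain q where "q \<in> L" "\<forall>t\<in>X. q t = 0" "w = (\<lambda>s. if s \<in> T then of_int (q s) else 0)"
    unfolding residue_space_def by blast
  then show "(\<lambda>s. if s \<in> T - Y then w s else 0) \<in> residue_space L X (T - Y)"
    unfolding residue_space_def by (intro image_eqI[of _ _ q]) auto
qed (auto simp: vectors_def basis_vector_def)

text \<open>If all lattice vectors that vanish on \<open>X\<close> vanish at \<open>f\<close>,
  contracting \<open>f\<close> is the same as deleting it. Otherwise there is such a vector
  \<open>q\<close> with value 1 at \<open>f\<close>, and \<open>r\<close> projects along its residue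
  onto the vectors without \<open>f\<close>. Relations of the contraction vanish at
  \<open>f\<close>, so the lost color has coefficient 0.\<close>

lemma solvable_contract_element:
  assumes "finite T" "solvable T (residue_space L X T)" "f \<in> T"
  shows "solvable (T - {f}) (residue_space L (insert f X) (T - {f}))"
proof (cases "\<exists>q\<in>L. (\<forall>t\<in>X. q t = 0) \<and> q f \<noteq> 0")
  case False
  then have "{q \<in> L. \<forall>t\<in>insert f X. q t = 0} = {q \<in> L. \<forall>t\<in>X. q t = 0}" by auto
  then show ?thesis using solvable_delete[OF assms(1,2), of "{f}"] by (simp add: residue_space_def)
next
  case True
  then obtain p where p: "p \<in> L" "\<forall>t\<in>X. p t = 0" "p f \<noteq> 0" by blast
  obtain q where q: "q \<in> L" "q f = 1" "\<forall>t. p t = 0 \<longrightarrow> q t = 0"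
    using primitive[OF integral_subset[OF p(1)], of f] p(3) by (simp only: of_int_eq_0_iff) blast
  define r :: "('a \<Rightarrow> 3) \<Rightarrow> 'a \<Rightarrow> 3" where
    "r = (\<lambda>x s. if s \<in> T - {f} then x s - x f * of_int (q s) else 0)"
  show ?thesis
  proof (rule solvable_map[OF assms(1,2), where r = r])
    show "T - {f} \<subseteq> T" by blast
    show "r x \<in> vectors (T - {f})" for x by (simp add: r_def vectors_def)
    show "r (x + y) = r x + r y" for x y
      by (rule ext) (simp add: r_def algebra_simps)
    show "r (basis_vector s) = basis_vector s" if "s \<in> T - {f}" for s
    proof (rule ext)
      fix t
      have "s \<in> T" "s \<noteq> f" "f \<noteq> s" using that by blast+
      then show "r (basis_vector s) t = basis_vector s t"
        by (simp only: r_def basis_vector_def mult_zero_left diff_zero if_False) simp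
    qed
    fix c' assume "c' \<in> residue_space L (insert f X) (T - {f})"
    then obtain u where u: "u \<in> L" "\<forall>t\<in>insert f X. u t = 0"
      "c' = (\<lambda>s. if s \<in> T - {f} then of_int (u s) else 0)"
      unfolding residue_space_def by blast
    have "(\<lambda>s. if s \<in> T then of_int (u s) else 0) \<in> residue_space L X T"
      unfolding residue_space_def using u(1,2) by blast
    moreover have "(if s \<in> T then of_int (u s) else 0) = (0 :: 3)" if "s \<in> T - (T - {f})" for s
    proof -
      have "s = f" using that by blast
      moreover have "u f = 0" using u(2) by blast
      ultimately show ?thesis by simp
    qed
    moreover have "(if s \<in> T then of_int (u s) else 0) = c' s" if "s \<in> T - {f}" for s
      using that by (simp add: u(3))
    ultimately show "\<exists>c\<in>residue_space L X T. (\<forall>s\<in>T - {f}. c s = c' s) \<and> (\<forall>s\<in>T - (T - {f}). c s = 0 \<or>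
        r (basis_vector s) \<in> residue_space L (insert f X) (T - {f}))"
      by (intro bexI[of _ "\<lambda>s. if s \<in> T then of_int (u s) else 0"] conjI ballI disjI1)
  next
    fix w assume "w \<in> residue_space L X T"
    then obtain u where u: "u \<in> L" "\<forall>t\<in>X. u t = 0" "w = (\<lambda>s. if s \<in> T then of_int (u s) else 0)"
      unfolding residue_space_def by blast
    have uq: "(\<lambda>s. 1 * u s + (- u f) * q s) \<in> L" by (rule integral_comb[OF u(1) q(1)])
    show "r w \<in> residue_space L (insert f X) (T - {f})"
      unfolding residue_space_def
    proof (rule image_eqI)
      show "r w = (\<lambda>s. if s \<in> T - {f} then of_int (1 * u s + (- u f) * q s) else 0)"
      proof (rule ext)
        fix t
        have w: "w t = (if t \<in> T then of_int (u t) else 0)" for t using u(3) by simp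
        show "r w t = (if t \<in> T - {f} then of_int (1 * u t + (- u f) * q t) else 0)"
          using assms(3) by (simp add: r_def w)
      qed
      have "1 * u t + (- u f) * q t = 0" if "t \<in> insert f X" for t
        using that u(2) p(2) q(2,3) by auto
      then show "(\<lambda>s. 1 * u s + (- u f) * q s) \<in> {q \<in> L. \<forall>t\<in>insert f X. q t = 0}"
        using uq by blast
    qed
  qed
qed

lemma solvable_contract:
  assumes "finite T" "solvable T (residue_space L X T)" "Z \<subseteq> T"
  shows "solvable (T - Z) (residue_space L (X \<union> Z) (T - Z))"
proof -
  have "finite Z" using assms finite_subset by blast
  then show ?thesis using assms(3)
  proof (induction Z rule: finite_induct)
    case empty then show ?case using assms by simp
  next
    case (insert f Z)
    have "solvable (T - Z - {f}) (residue_space L (insert f (X \<union> Z)) (T - Z - {f}))"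
      using insert assms(1) by (intro solvable_contract_element) simp_all
    moreover have "T - Z - {f} = T - insert f Z" by auto
    ultimately show ?case by simp
  qed
qed

lemma minor_in_M_class:
  assumes "finite E" "X \<subseteq> E" "solvable (E - X - Y) (residue_space L X (E - X - Y))"
  shows "deletion (contraction (coordinate_matroid E P) X) Y \<in> M_class TYPE(3)"
proof -
  let ?T = "E - X - Y"
  interpret Q: regular_chain_group "{p \<in> P. \<forall>t\<in>X. p t = 0}" "{q \<in> L. \<forall>t\<in>X. q t = 0}"
    by (rule vanishing)
  let ?N = "coordinate_matroid ?T {p \<in> P. \<forall>t\<in>X. p t = 0}"
  have fT: "finite ?T" using assms(1) by simp
  obtain A where A: "tu_realization ?N A"
    "row_lattice (rank ?N) ?T A = (\<lambda>q s. if s \<in> ?T then q s else 0) ` {q \<in> L. \<forall>t\<in>X. q t = 0}"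
    by (rule Q.coordinate_matroid_realization[OF fT])
  have W: "reduction (row_lattice (rank ?N) (ground ?N) A) = residue_space L X ?T"
    unfolding coordinate_matroid_def residue_space_def reduction_def
    using A(2) by (auto simp: coordinate_matroid_def image_image intro!: image_cong)
  obtain b where b: "is_solution ?T (residue_space L X ?T) b"
    "\<forall>s\<in>?T. color_profile (albanese ?T (residue_space L X ?T)) (b s) s = 2"
    using solvable_imp_solution[OF fT assms(3) residue_space_add residue_space_minus] by blast
  \<comment> \<open>The profile 2 is a unit, as 2 * 2 = 1 modulo 3.\<close>
  have "(2::3) dvd 1" by (rule dvdI[of _ _ 2]) simp
  moreover have "regular ?N"
    unfolding regular_def using Q.coordinate_matroid_is_matroid[OF fT] A(1) by blast
  moreover have g: "ground ?N = ?T" by (simp add: coordinate_matroid_def)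
  ultimately have "?N \<in> M_class TYPE(3)"
    unfolding M_class_def
    by (intro CollectI conjI exI[of _ A] exI[of _ "residue_space L X ?T"] exI[of _ b] exI[of _ "2::3"])
      (insert A(1) W[symmetric] b, simp_all only: g)
  then show ?thesis using minor_coordinate_matroid[OF assms(1,2)] by simp
qed

text \<open>A proper minor removes some element \<open>e\<close>. Removing \<open>e\<close> ahead of
  everything else exhibits it as a minor of a deletion or contraction of one element, from which
  \<open>solvable\<close> descends.\<close>

lemma proper_minors_in_M_class:
  assumes E: "finite E"
    and del: "\<And>e. e \<in> E \<Longrightarrow> solvable (E - {e}) (residue_space L {} (E - {e}))"
    and con: "\<And>e. e \<in> E \<Longrightarrow> solvable (E - {e}) (residue_space L {e} (E - {e}))"
    and N: "proper_minor N (coordinate_matroid E P)"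
  shows "N \<in> M_class TYPE(3)"
proof -
  obtain X Y where XY: "X \<subseteq> E" "Y \<subseteq> E" "X \<inter> Y = {}"
    "N = deletion (contraction (coordinate_matroid E P) X) Y"
    using N unfolding proper_minor_def minor_def by (auto simp: coordinate_matroid_def)
  have "N = coordinate_matroid (E - X - Y) {p \<in> P. \<forall>t\<in>X. p t = 0}"
    using XY minor_coordinate_matroid[OF E XY(1)] by simp
  then have "X \<noteq> {} \<or> Y \<noteq> {}" using N unfolding proper_minor_def by auto
  then have "solvable (E - X - Y) (residue_space L X (E - X - Y))"
  proof
    assume "X \<noteq> {}"
    then obtain e where e: "e \<in> X" by blast
    have "solvable (E - {e} - (X - {e})) (residue_space L ({e} \<union> (X - {e})) (E - {e} - (X - {e})))"
      by (rule solvable_contract) (use E con e XY in auto)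
    moreover have "E - {e} - (X - {e}) = E - X" "{e} \<union> (X - {e}) = X" using e by auto
    ultimately have "solvable (E - X) (residue_space L X (E - X))" by simp
    then show ?thesis using solvable_delete[of "E - X" X Y] E by simp
  next
    assume "Y \<noteq> {}"
    then obtain e where e: "e \<in> Y" by blast
    have "solvable (E - {e} - X) (residue_space L ({} \<union> X) (E - {e} - X))"
      by (rule solvable_contract) (use E del e XY in auto)
    then have "solvable (E - {e} - X - Y) (residue_space L X (E - {e} - X - Y))"
      using solvable_delete[of "E - {e} - X" X Y] E by simp
    moreover have "E - {e} - X - Y = E - X - Y" using e by auto
    ultimately show ?thesis by simp
  qed
  then show ?thesis using minor_in_M_class[OF E XY(1)] XY(4) by simp
qed

end

section \<open>Potentials on graphs and rigidity of realizations\<close>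

section \<open>Cycle matroids\<close>

text \<open>Edges are unordered, so an orientation is fixed by the order of the naturals. The sign
  agrees with the edge lists of the certificates, whose pairs have the smaller end in front.\<close>

definition coboundary :: "(nat \<Rightarrow> 'b::minus) \<Rightarrow> nat set \<Rightarrow> 'b" where
  "coboundary \<phi> e = \<phi> (Min e) - \<phi> (Max e)"

lemma coboundary_doubleton: "coboundary \<phi> {a, b} = \<phi> (min a b) - \<phi> (max a b)"
  by (simp add: coboundary_def)

lemma coboundary_eq_0_iff:
  fixes \<phi> :: "nat \<Rightarrow> 'b::group_add"
  shows "coboundary \<phi> {a, b} = 0 \<longleftrightarrow> \<phi> a = \<phi> b"
  by (auto simp: coboundary_doubleton min_def max_def)

interpretation graphic: regular_chain_group
  "range coboundary :: (nat set \<Rightarrow> real) set" "range coboundary :: (nat set \<Rightarrow> int) set"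
proof
  show "(\<lambda>_. 0) \<in> (range coboundary :: (nat set \<Rightarrow> real) set)"
    by (rule image_eqI[of _ _ "\<lambda>_. 0"]) (auto simp: coboundary_def)
  show "(\<lambda>_. 0) \<in> (range coboundary :: (nat set \<Rightarrow> int) set)"
    by (rule image_eqI[of _ _ "\<lambda>_. 0"]) (auto simp: coboundary_def)
  fix p q :: "nat set \<Rightarrow> real" and a b :: real
  assume "p \<in> range coboundary" "q \<in> range coboundary"
  then obtain \<phi> \<psi> where "p = coboundary \<phi>" "q = coboundary \<psi>" by blast
  then show "(\<lambda>s. a * p s + b * q s) \<in> range coboundary"
    by (intro image_eqI[of _ _ "\<lambda>v. a * \<phi> v + b * \<psi> v"]) (auto simp: coboundary_def algebra_simps)
next
  fix p q :: "nat set \<Rightarrow> int" and a b :: int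
  assume "p \<in> range coboundary" "q \<in> range coboundary"
  then obtain \<phi> \<psi> where "p = coboundary \<phi>" "q = coboundary \<psi>" by blast
  then show "(\<lambda>s. a * p s + b * q s) \<in> range coboundary"
    by (intro image_eqI[of _ _ "\<lambda>v. a * \<phi> v + b * \<psi> v"]) (auto simp: coboundary_def algebra_simps)
next
  fix q :: "nat set \<Rightarrow> int" assume "q \<in> range coboundary"
  then obtain \<phi> where "q = coboundary \<phi>" by blast
  then show "(\<lambda>s. real_of_int (q s)) \<in> range coboundary"
    by (intro image_eqI[of _ _ "\<lambda>v. real_of_int (\<phi> v)"]) (auto simp: coboundary_def)
next
  fix x :: "nat set \<Rightarrow> real" and s
  assume "x \<in> range coboundary" "x s \<noteq> 0"
  then obtain \<phi> where x: "x = coboundary \<phi>" "\<phi> (Min s) \<noteq> \<phi> (Max s)"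
    by (auto simp: coboundary_def)
  \<comment> \<open>The indicator of the level set of \<phi> through one end of \<open>s\<close>. As
    a function of the value of \<phi> it is constant wherever \<phi> is, so its coboundary has no
    new nonzero values.\<close>
  define \<psi> :: "nat \<Rightarrow> int" where "\<psi> = (\<lambda>v. if \<phi> v = \<phi> (Min s) then 1 else 0)"
  have "coboundary \<psi> s = 1" using x(2) by (simp add: coboundary_def \<psi>_def)
  moreover have "\<forall>t. x t = 0 \<longrightarrow> coboundary \<psi> t = 0"
    unfolding x(1) by (simp add: coboundary_def \<psi>_def)
  ultimately show "\<exists>q\<in>range coboundary. q s = (1::int) \<and> (\<forall>t. x t = 0 \<longrightarrow> q t = 0)" by blast
qed

text \<open>A path that runs into one of its own vertices is cut back to the place where that vertex
  occurs.\<close>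

lemma distinct_path:
  assumes "(a, b) \<in> r\<^sup>*"
  shows "\<exists>vs. vs \<noteq> [] \<and> distinct vs \<and> hd vs = a \<and> last vs = b \<and>
    (\<forall>i. Suc i < length vs \<longrightarrow> (vs ! i, vs ! Suc i) \<in> r)"
  using assms
proof (induction rule: rtrancl_induct)
  case base then show ?case by (intro exI[of _ "[a]"]) auto
next
  case (step y z)
  then obtain vs where vs: "vs \<noteq> []" "distinct vs" "hd vs = a" "last vs = y"
    "\<And>i. Suc i < length vs \<Longrightarrow> (vs ! i, vs ! Suc i) \<in> r" by blast
  show ?case
  proof (cases "z \<in> set vs")
    case True
    then obtain k where k: "k < length vs" "vs ! k = z" by (auto simp: in_set_conv_nth)
    let ?ws = "take (Suc k) vs"
    have "?ws \<noteq> []" "distinct ?ws" using vs(1,2) by auto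
    moreover have "hd ?ws = a" using vs(1,3) by simp
    moreover have "last ?ws = z" using k by (simp add: take_Suc_conv_app_nth)
    moreover have "\<forall>i. Suc i < length ?ws \<longrightarrow> (?ws ! i, ?ws ! Suc i) \<in> r" using vs(5) by simp
    ultimately show ?thesis by blast
  next
    case False
    let ?ws = "vs @ [z]"
    have "(?ws ! i, ?ws ! Suc i) \<in> r" if "Suc i < length ?ws" for i
    proof (cases "Suc i < length vs")
      case True then show ?thesis using vs(5)[of i] by (simp add: nth_append)
    next
      case n: False
      then have i: "Suc i = length vs" using that by simp
      then have "vs ! i = y" using vs(1,4) by (simp add: last_conv_nth flip: i)
      then show ?thesis using i step.hyps(2) by (simp add: nth_append)
    qed
    moreover have "?ws \<noteq> []" "distinct ?ws" "hd ?ws = a" "last ?ws = z" using vs False by auto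
    ultimately show ?thesis by blast
  qed
qed

text \<open>The differences of a potential around a cycle add up to 0, so exactly one of them cannot
  be nonzero. Conversely, if \<open>X\<close> has no cycle, the indicator of the component of
  \<open>a\<close> in \<open>X\<close> without the edge \<open>{a, b}\<close> has a nonzero
  coboundary on that edge alone.\<close>

lemma free_iff_no_cycle:
  assumes X: "\<And>e. e \<in> X \<Longrightarrow> \<exists>a b. a \<noteq> b \<and> e = {a, b}"
  shows "graphic.free X \<longleftrightarrow>
    \<not> (\<exists>vs. distinct vs \<and> 3 \<le> length vs \<and> cycle_edges vs \<subseteq> X)"
proof
  assume f: "graphic.free X"
  show "\<not> (\<exists>vs. distinct vs \<and> 3 \<le> length vs \<and> cycle_edges vs \<subseteq> X)"
  proof
    assume "\<exists>vs. distinct vs \<and> 3 \<le> length vs \<and> cycle_edges vs \<subseteq> X"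
    then obtain vs :: "nat list" where vs: "distinct vs" "3 \<le> length vs" "cycle_edges vs \<subseteq> X" by blast
    let ?n = "length vs" and ?s = "{vs ! 0, vs ! 1}"
    have edge: "{vs ! i, vs ! (Suc i mod ?n)} \<in> X" if "i < ?n" for i
      using vs(3) that by (auto simp: cycle_edges_def)
    have "?s \<in> X"
    proof -
      have "0 < ?n" "Suc 0 mod ?n = 1" using vs(2) by auto
      then show ?thesis using edge[of 0] by simp
    qed
    then obtain \<phi> :: "nat \<Rightarrow> real" where p: "coboundary \<phi> ?s \<noteq> 0" "\<forall>t\<in>X - {?s}. coboundary \<phi> t = 0"
      using f unfolding graphic.free_def by blast
    have eq: "\<phi> (vs ! i) = \<phi> (vs ! (Suc i mod ?n))" if i: "0 < i" "i < ?n" for i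
    proof -
      have m: "Suc i mod ?n < ?n" using vs(2) by (intro mod_less_divisor) linarith
      \<comment> \<open>Length at least 3 ensures that the edge at position 0 does not recur; on a
        closed walk of length 2 it would.\<close>
      have "{vs ! i, vs ! (Suc i mod ?n)} \<noteq> ?s"
      proof
        assume a: "{vs ! i, vs ! (Suc i mod ?n)} = ?s"
        have "vs ! i \<noteq> vs ! 0" using vs(1,2) i by (subst nth_eq_iff_index_eq) auto
        then have "vs ! i = vs ! 1" "vs ! (Suc i mod ?n) = vs ! 0" using a by (auto simp: doubleton_eq_iff)
        then have "i = 1" "Suc i mod ?n = 0"
          using nth_eq_iff_index_eq[OF vs(1) i(2), of 1] nth_eq_iff_index_eq[OF vs(1) m, of 0] vs(2)
          by linarith+
        then show False using vs(2) by simp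
      qed
      then show ?thesis using p(2) edge[OF i(2)] coboundary_eq_0_iff[of \<phi>] by blast
    qed
    have "\<phi> (vs ! 1) = \<phi> (vs ! i)" if "0 < i" "i < ?n" for i
      using that
    proof (induction i)
      case 0 then show ?case by simp
    next
      case (Suc i)
      show ?case
      proof (cases "i = 0")
        case False
        then have "\<phi> (vs ! 1) = \<phi> (vs ! i)" using Suc by simp
        also have "\<dots> = \<phi> (vs ! Suc i)" using eq[of i] Suc.prems False by simp
        finally show ?thesis .
      qed simp
    qed
    moreover have n: "0 < ?n - 1" "?n - 1 < ?n" "Suc (?n - 1) = ?n" using vs(2) by linarith+
    ultimately have "\<phi> (vs ! 1) = \<phi> (vs ! (?n - 1))" by blast
    also have "\<dots> = \<phi> (vs ! 0)" using eq[OF n(1,2), unfolded n(3)] by simp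
    finally show False using p(1) coboundary_eq_0_iff[of \<phi> "vs ! 0" "vs ! 1"] by simp
  qed
next
  assume nc: "\<not> (\<exists>vs. distinct vs \<and> 3 \<le> length vs \<and> cycle_edges vs \<subseteq> X)"
  show "graphic.free X"
    unfolding graphic.free_def
  proof
    fix s assume s: "s \<in> X"
    then obtain a b where ab: "a \<noteq> b" "s = {a, b}" using X by blast
    define r where "r = {(x, y). {x, y} \<in> X - {s}}"
    define Z where "Z = {x. (a, x) \<in> r\<^sup>*}"
    have "b \<notin> Z"
    proof
      assume "b \<in> Z"
      then obtain vs where vs: "vs \<noteq> []" "distinct vs" "hd vs = a" "last vs = b"
        "\<And>i. Suc i < length vs \<Longrightarrow> (vs ! i, vs ! Suc i) \<in> r"
        using distinct_path[of a b r] unfolding Z_def by auto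
      have h0: "vs ! 0 = a" and hl: "vs ! (length vs - 1) = b"
        using vs(1,3,4) by (simp_all add: hd_conv_nth last_conv_nth)
      \<comment> \<open>A path with one vertex would give \<open>a = b\<close>, and one with two
        vertices would use \<open>s\<close> itself; any longer one is closed by \<open>s\<close> to
        a cycle.\<close>
      have "length vs \<noteq> 0" using vs(1) by simp
      moreover have "length vs \<noteq> 1" using h0 hl ab(1) by auto
      moreover have "length vs \<noteq> 2"
      proof
        assume "length vs = 2"
        then have "(a, b) \<in> r" using vs(5)[of 0] h0 hl by simp
        then show False by (simp add: r_def ab(2))
      qed
      ultimately have "3 \<le> length vs" by linarith
      moreover have "cycle_edges vs \<subseteq> X"
      proof
        fix e assume "e \<in> cycle_edges vs"
        then obtain i where i: "i < length vs" "e = {vs ! i, vs ! (Suc i mod length vs)}"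
          by (auto simp: cycle_edges_def)
        show "e \<in> X"
        proof (cases "Suc i < length vs")
          case True then show ?thesis using vs(5)[of i] i by (simp add: r_def)
        next
          case False
          then have "Suc i = length vs" using i(1) by linarith
          then have "i = length vs - 1" "Suc i mod length vs = 0" by auto
          then have "e = s" using i(2) h0 hl ab(2) by auto
          then show ?thesis using s by simp
        qed
      qed
      ultimately show False using nc vs(2) by blast
    qed
    have "a \<in> Z" by (simp add: Z_def)
    define \<phi> :: "nat \<Rightarrow> real" where "\<phi> = (\<lambda>v. if v \<in> Z then 1 else 0)"
    have "coboundary \<phi> s \<noteq> 0"
      unfolding ab(2) coboundary_eq_0_iff using \<open>a \<in> Z\<close> \<open>b \<notin> Z\<close> by (simp add: \<phi>_def)
    moreover have "coboundary \<phi> t = 0" if t: "t \<in> X - {s}" for t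
    proof -
      obtain x y where xy: "t = {x, y}" using X t by blast
      then have "(x, y) \<in> r" "(y, x) \<in> r" using t by (auto simp: r_def insert_commute)
      then have "x \<in> Z \<longleftrightarrow> y \<in> Z" unfolding Z_def by (auto intro: rtrancl_into_rtrancl)
      then show ?thesis unfolding xy coboundary_eq_0_iff by (simp add: \<phi>_def)
    qed
    ultimately show "\<exists>p\<in>range coboundary. p s \<noteq> (0::real) \<and> (\<forall>t\<in>X - {s}. p t = 0)" by blast
  qed
qed

lemma cycle_matroid_eq:
  assumes "\<And>e. e \<in> E \<Longrightarrow> \<exists>a b. a \<noteq> b \<and> e = {a, b}"
  shows "cycle_matroid (V, E) = coordinate_matroid E (range coboundary)"
proof -
  have "\<not> (\<exists>vs. distinct vs \<and> 3 \<le> length vs \<and> cycle_edges vs \<subseteq> X) \<longleftrightarrow> graphic.free X"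
    if "X \<subseteq> E" for X
    using free_iff_no_cycle[of X] assms that by blast
  then show ?thesis
    unfolding cycle_matroid_def coordinate_matroid_def by auto
qed

text \<open>Connectivity is phrased by invariant sets of vertices: a set that no edge leaves and
  that meets \<open>V\<close> contains \<open>V\<close>. It is applied in this form to sets cut out
  by the values of a potential, and no paths have to be constructed.\<close>

locale two_connected_graph =
  fixes V :: "nat set" and E :: "nat set set"
  assumes finite_V: "finite V" and V_nonempty: "V \<noteq> {}"
    and edge: "e \<in> E \<Longrightarrow> \<exists>a\<in>V. \<exists>b\<in>V. a < b \<and> e = {a, b}"
    and connected: "(\<And>e. e \<in> E \<Longrightarrow> Min e \<in> Z \<longleftrightarrow> Max e \<in> Z) \<Longrightarrow> x \<in> V \<inter> Z \<Longrightarrow> y \<in> V \<Longrightarrow> y \<in> Z"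
    and two_connected: "v \<in> V \<Longrightarrow> (\<And>e. e \<in> E \<Longrightarrow> v \<notin> e \<Longrightarrow> Min e \<in> Z \<longleftrightarrow> Max e \<in> Z) \<Longrightarrow>
      x \<in> V \<inter> Z - {v} \<Longrightarrow> y \<in> V - {v} \<Longrightarrow> y \<in> Z"
    and star: "v \<in> V \<Longrightarrow> \<exists>e\<in>E. v \<in> e"
begin

abbreviation "M \<equiv> coordinate_matroid E (range coboundary :: (nat set \<Rightarrow> real) set)"

lemma finite_E: "finite E"
proof (rule finite_subset)
  show "E \<subseteq> Pow V" using edge by blast
qed (simp add: finite_V)

lemma edge_ends:
  assumes "e \<in> E"
  shows "Min e \<in> V" "Max e \<in> V" "Min e < Max e" "e = {Min e, Max e}"
proof -
  obtain a b where "a \<in> V" "b \<in> V" "a < b" "e = {a, b}" using edge[OF assms] by blast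
  then show "Min e \<in> V" "Max e \<in> V" "Min e < Max e" "e = {Min e, Max e}"
    by (auto simp: min_def max_def)
qed

lemma coboundary_zero_imp_constant:
  fixes \<phi> :: "nat \<Rightarrow> 'b::group_add"
  assumes "\<And>e. e \<in> E \<Longrightarrow> coboundary \<phi> e = 0" "x \<in> V" "y \<in> V"
  shows "\<phi> x = \<phi> y"
proof -
  have "y \<in> {v. \<phi> x = \<phi> v}"
    by (rule connected[of _ x]) (use assms in \<open>auto simp: coboundary_def\<close>)
  then show ?thesis by simp
qed

lemma coboundary_sum:
  fixes f :: "'i \<Rightarrow> nat \<Rightarrow> 'b::comm_ring_1"
  shows "coboundary (\<lambda>v. \<Sum>i\<in>I. a i * f i v) e = (\<Sum>i\<in>I. a i * coboundary (f i) e)"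
  by (simp add: coboundary_def sum_subtractf algebra_simps)

lemma coboundary_indicator:
  "coboundary (\<lambda>x. if x = v then 1 else 0) e =
    ((if v = Min e then 1 else 0) - (if v = Max e then 1 else 0) :: 'b::ring_1)"
  by (auto simp: coboundary_def)

lemma coboundary_indicator_sum:
  assumes "e \<in> E"
  shows "(\<Sum>v\<in>V. \<phi> v * coboundary (\<lambda>x. if x = v then 1 else 0) e) = (coboundary \<phi> e :: 'b::ring_1)"
proof -
  have "(\<Sum>v\<in>V. \<phi> v * coboundary (\<lambda>x. if x = v then 1 else 0) e) =
      (\<Sum>v\<in>V. (if v = Min e then \<phi> v else 0) - (if v = Max e then \<phi> v else 0))"
    by (rule sum.cong) (auto simp: coboundary_indicator)
  then show ?thesis
    using finite_V edge_ends[OF assms] by (simp add: sum_subtractf coboundary_def)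
qed

text \<open>A basis \<open>B\<close> of edges is compared with the vertices other than a root
  \<open>r\<close>. If \<open>B\<close> were larger, some combination of its dual potentials would
  be constant on \<open>V\<close> and yet have a nonzero coboundary; if it were smaller, a nonzero
  potential vanishing at \<open>r\<close> would have zero coboundary on \<open>B\<close>, hence on
  \<open>E\<close>.\<close>

lemma rank_M: "rank M = card V - 1"
proof -
  obtain B where B: "{} \<subseteq> B" "B \<subseteq> E" "graphic.free B" "graphic.spans B E"
    using graphic.maximal_free[OF finite_E graphic.free_empty empty_subsetI] .
  have fB: "finite B" using B finite_E finite_subset by blast
  obtain r where r: "r \<in> V" using V_nonempty by blast
  obtain d where d: "graphic.dual_on B d" using graphic.free_dual[OF B(3)] .
  have "\<forall>e\<in>B. \<exists>\<phi>. d e = coboundary \<phi>" using d unfolding graphic.dual_on_def by blast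
  then obtain \<Phi> where \<Phi>: "\<And>e. e \<in> B \<Longrightarrow> d e = coboundary (\<Phi> e)" by metis
  have "\<not> card (V - {r}) < card B"
  proof
    assume "card (V - {r}) < card B"
    \<comment> \<open>The dual potentials are normalized to vanish at \<open>r\<close>, which leaves
      one equation for each other vertex.\<close>
    from underdetermined_system[OF _ fB this, of "\<lambda>v e. \<Phi> e v - \<Phi> e r"] finite_V
    obtain \<alpha> f where a: "f \<in> B" "\<alpha> f \<noteq> 0"
      "\<forall>v\<in>V - {r}. (\<Sum>e\<in>B. (\<Phi> e v - \<Phi> e r) * \<alpha> e) = 0" by auto
    define \<psi> where "\<psi> = (\<lambda>v. \<Sum>e\<in>B. \<alpha> e * \<Phi> e v)"
    have "\<psi> v = \<psi> r" if "v \<in> V" for v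
    proof (cases "v = r")
      case False
      then have "(\<Sum>e\<in>B. (\<Phi> e v - \<Phi> e r) * \<alpha> e) = 0" using a(3) that by blast
      then show ?thesis by (simp add: \<psi>_def algebra_simps sum_subtractf)
    qed simp
    then have "coboundary \<psi> f = 0"
      using edge_ends[of f] a(1) B(2) by (auto simp: coboundary_def)
    moreover have "coboundary \<psi> f = (\<Sum>e\<in>B. \<alpha> e * d e f)"
      unfolding \<psi>_def coboundary_sum by (rule sum.cong) (simp_all add: \<Phi>)
    moreover have "(\<Sum>e\<in>B. \<alpha> e * d e f) = (\<Sum>e\<in>B. if e = f then \<alpha> e else 0)"
      by (rule sum.cong) (use d a(1) in \<open>auto simp: graphic.dual_on_def\<close>)
    ultimately show False using a(1,2) fB by simp
  qed
  moreover have "\<not> card B < card (V - {r})"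
  proof
    assume "card B < card (V - {r})"
    moreover have "finite (V - {r})" using finite_V by simp
    ultimately have "\<exists>\<alpha>. (\<exists>u\<in>V - {r}. \<alpha> u \<noteq> 0) \<and>
        (\<forall>e\<in>B. (\<Sum>v\<in>V - {r}. coboundary (\<lambda>x. if x = v then 1 else 0) e * \<alpha> v) = (0::real))"
      by (intro underdetermined_system[OF fB])
    then obtain \<alpha> :: "nat \<Rightarrow> real" and u where a: "u \<in> V - {r}" "\<alpha> u \<noteq> 0"
      "\<forall>e\<in>B. (\<Sum>v\<in>V - {r}. coboundary (\<lambda>x. if x = v then 1 else 0) e * \<alpha> v) = 0"
      by (elim exE conjE bexE)
    define \<phi> where "\<phi> = \<alpha>(r := 0)"
    have "coboundary \<phi> e = 0" if e: "e \<in> B" for e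
    proof -
      have "coboundary \<phi> e = (\<Sum>v\<in>V. \<phi> v * coboundary (\<lambda>x. if x = v then 1 else 0) e)"
        using coboundary_indicator_sum[of e \<phi>] e B(2) by auto
      also have "\<dots> = (\<Sum>v\<in>V - {r}. \<phi> v * coboundary (\<lambda>x. if x = v then 1 else 0) e)"
        using finite_V r by (subst sum.remove) (auto simp: \<phi>_def)
      also have "\<dots> = (\<Sum>v\<in>V - {r}. coboundary (\<lambda>x. if x = v then 1 else 0) e * \<alpha> v)"
        by (rule sum.cong) (auto simp: \<phi>_def)
      finally show ?thesis using a(3) e by simp
    qed
    then have "coboundary \<phi> e = 0" if "e \<in> E" for e
      using B(4) that unfolding graphic.spans_def by blast
    then have "\<phi> u = \<phi> r" by (rule coboundary_zero_imp_constant) (use a r in auto)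
    then show False using a by (simp add: \<phi>_def)
  qed
  ultimately have "card B = card (V - {r})" by linarith
  then show ?thesis
    using graphic.rank_coordinate_matroid[OF finite_E B(2-4)] r finite_V by simp
qed

lemma regular_M: "regular M"
  unfolding regular_def
  using graphic.coordinate_matroid_is_matroid[OF finite_E]
    graphic.coordinate_matroid_realization[OF finite_E] by metis

end

section \<open>Realizations of a 2-connected graph\<close>

definition row_space :: "nat \<Rightarrow> (nat \<Rightarrow> 'a \<Rightarrow> int) \<Rightarrow> ('a \<Rightarrow> real) set" where
  "row_space g A = range (\<lambda>z s. \<Sum>i<g. z i * real_of_int (A i s))"

lemma fun_space_row_space: "fun_space (row_space g A)"
proof
  show "(\<lambda>_. 0) \<in> row_space g A"
    unfolding row_space_def by (rule image_eqI[of _ _ "\<lambda>_. 0"]) auto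
  fix p q a b assume "p \<in> row_space g A" "q \<in> row_space g A"
  then obtain y z where "p = (\<lambda>s. \<Sum>i<g. y i * real_of_int (A i s))"
    "q = (\<lambda>s. \<Sum>i<g. z i * real_of_int (A i s))" unfolding row_space_def by blast
  then show "(\<lambda>s. a * p s + b * q s) \<in> row_space g A"
    unfolding row_space_def
    by (intro image_eqI[of _ _ "\<lambda>i. a * y i + b * z i"])
      (auto simp: sum_distrib_left sum.distrib algebra_simps)
qed

text \<open>Makes bases, closure and dual functions available for an arbitrary matrix through its
  real row space.\<close>

lemma columns_independent_iff_free:
  assumes "finite I"
  shows "columns_independent g A I \<longleftrightarrow> fun_space.free (row_space g A) I"
proof -
  interpret R: fun_space "row_space g A" by (rule fun_space_row_space)
  have row: "(\<lambda>s. real_of_int (A i s)) \<in> row_space g A" if "i < g" for i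
  proof -
    have "(\<Sum>j<g. (if j = i then 1 else 0) * real_of_int (A j s)) =
        (\<Sum>j<g. if j = i then real_of_int (A j s) else 0)" for s
      by (rule sum.cong) auto
    then have "(\<lambda>s. real_of_int (A i s)) = (\<lambda>s. \<Sum>j<g. (if j = i then 1 else 0) * real_of_int (A j s))"
      using that by simp
    then show ?thesis unfolding row_space_def by (rule range_eqI[of _ _ "\<lambda>j. if j = i then 1 else 0"])
  qed
  show ?thesis
  proof
    assume c: "columns_independent g A I"
    show "R.free I"
    proof (rule ccontr)
      assume "\<not> R.free I"
      then obtain c s where cs: "s \<in> I" "c s \<noteq> 0" "\<forall>p\<in>row_space g A. (\<Sum>s\<in>I. c s * p s) = 0"
        using R.free_or_dependent[OF assms] by blast
      have "\<forall>i<g. (\<Sum>s\<in>I. c s * real_of_int (A i s)) = 0" using bspec[OF cs(3) row] by blast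
      then show False using c cs(1,2) unfolding columns_independent_def by blast
    qed
  next
    assume f: "R.free I"
    obtain d where d: "R.dual_on I d" using R.free_dual[OF f] .
    show "columns_independent g A I"
      unfolding columns_independent_def
    proof (intro allI impI ballI)
      fix c :: "'a \<Rightarrow> real" and u
      assume c: "\<forall>i<g. (\<Sum>s\<in>I. c s * real_of_int (A i s)) = 0" and u: "u \<in> I"
      have "d u \<in> row_space g A" using d u by (simp add: R.dual_on_def)
      then obtain z where z: "d u = (\<lambda>s. \<Sum>i<g. z i * real_of_int (A i s))"
        unfolding row_space_def by blast
      have "(\<Sum>s\<in>I. c s * d u s) = (\<Sum>s\<in>I. \<Sum>i<g. z i * (c s * real_of_int (A i s)))"
        unfolding z by (simp add: sum_distrib_left algebra_simps)
      also have "\<dots> = (\<Sum>i<g. z i * (\<Sum>s\<in>I. c s * real_of_int (A i s)))"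
        by (subst sum.swap) (simp add: sum_distrib_left)
      also have "\<dots> = 0" using c by simp
      finally have "(\<Sum>s\<in>I. c s * d u s) = 0" .
      moreover have "(\<Sum>s\<in>I. c s * d u s) = (\<Sum>s\<in>I. if s = u then c s else 0)"
        by (rule sum.cong) (use d u in \<open>auto simp: R.dual_on_def\<close>)
      ultimately show "c u = 0" using assms u by simp
    qed
  qed
qed

text \<open>The square submatrix on a basis has determinant 1 or -1, so its inverse is integral; the
  coefficients are the row of the inverse that belongs to \<open>t\<close>.\<close>

lemma integral_dual_row:
  assumes tu: "totally_unimodular g S A" and B: "B \<subseteq> S" "finite B" "card B = g"
    and ci: "columns_independent g A B" and t: "t \<in> B"
  obtains z :: "nat \<Rightarrow> int" where "\<forall>s\<in>B. (\<Sum>i<g. z i * A i s) = (if s = t then 1 else 0)"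
proof -
  obtain c where c: "bij_betw c {..<g} B"
    using ex_bij_betw_nat_finite[OF B(2)] B(3) by (auto simp: atLeast0LessThan)
  define D where "D = mat g g (\<lambda>(i, j). A i (c j))"
  have D: "D \<in> carrier_mat g g" by (simp add: D_def)
  have "det D \<noteq> 0"
  proof
    assume "det D = 0"
    then obtain v where v: "v \<in> carrier_vec g" "v \<noteq> 0\<^sub>v g" "D *\<^sub>v v = 0\<^sub>v g"
      using det_0_iff_vec_prod_zero[OF D] by blast
    define x where "x = (\<lambda>s. real_of_int (v $ (the_inv_into {..<g} c s)))"
    have xc: "x (c j) = real_of_int (v $ j)" if "j < g" for j
      using that c by (simp add: x_def bij_betw_def the_inv_into_f_f)
    have "(\<Sum>s\<in>B. x s * real_of_int (A i s)) = 0" if i: "i < g" for i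
    proof -
      have "(\<Sum>s\<in>B. x s * real_of_int (A i s)) = (\<Sum>j<g. x (c j) * real_of_int (A i (c j)))"
        by (rule sum.reindex_bij_betw[OF c, symmetric])
      also have "\<dots> = real_of_int (\<Sum>j<g. A i (c j) * v $ j)"
        by (simp add: xc mult.commute)
      also have "(\<Sum>j<g. A i (c j) * v $ j) = (D *\<^sub>v v) $ i"
        using i v(1) by (simp add: D_def scalar_prod_def atLeast0LessThan)
      finally show ?thesis using v(3) i by simp
    qed
    then have "\<forall>s\<in>B. x s = 0" using ci unfolding columns_independent_def by blast
    then have "v $ j = 0" if "j < g" for j
      using xc[OF that] c that by (auto simp: bij_betw_def)
    then show False using v(1,2) by (metis carrier_vecD eq_vecI index_zero_vec)
  qed
  moreover have "det D \<in> {-1, 0, 1}"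
    using tu[unfolded totally_unimodular_def, rule_format, of id g c] c B(1)
    by (simp add: D_def bij_betw_def)
  ultimately have dd: "det D * det D = 1" by auto
  have tc: "the_inv_into {..<g} c t < g" "c (the_inv_into {..<g} c t) = t"
    using c t the_inv_into_into[of c "{..<g}" t "{..<g}"]
    by (auto simp: bij_betw_def f_the_inv_into_f)
  define k where "k = the_inv_into {..<g} c t"
  \<comment> \<open>As \<open>det D\<close> is its own inverse, this is row \<open>k\<close> of the
    inverse of \<open>D\<close>.\<close>
  define z where "z = (\<lambda>i. det D * adj_mat D $$ (k, i))"
  have "(\<Sum>i<g. z i * A i s) = (if s = t then 1 else 0)" if s: "s \<in> B" for s
  proof -
    obtain j where j: "j < g" "s = c j" using c s by (auto simp: bij_betw_def)
    have "(\<Sum>i<g. z i * A i s) = det D * (\<Sum>i<g. adj_mat D $$ (k, i) * D $$ (i, j))"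
      using j by (simp add: z_def D_def sum_distrib_left mult.assoc)
    also have "(\<Sum>i<g. adj_mat D $$ (k, i) * D $$ (i, j)) = (adj_mat D * D) $$ (k, j)"
      using adj_mat(1)[OF D] D j tc(1) by (simp add: scalar_prod_def atLeast0LessThan k_def)
    also have "\<dots> = (if k = j then det D else 0)"
      using adj_mat(3)[OF D] j tc(1) by (simp add: k_def)
    also have "det D * \<dots> = (if k = j then 1 else 0)" using dd by simp
    also have "k = j \<longleftrightarrow> s = t"
      using c j tc by (auto simp: k_def bij_betw_def inj_on_def)
    finally show ?thesis .
  qed
  then show ?thesis using that by blast
qed

context two_connected_graph begin

context
  fixes A :: "nat \<Rightarrow> nat set \<Rightarrow> int"
  assumes realization: "tu_realization M A"
begin

interpretation R: fun_space "row_space (rank M) A" by (rule fun_space_row_space)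

lemma free_iff_row_free: "I \<subseteq> E \<Longrightarrow> graphic.free I \<longleftrightarrow> R.free I"
proof -
  assume I: "I \<subseteq> E"
  then have fin: "finite I" using finite_E finite_subset by blast
  have "indep M = {X. X \<subseteq> E \<and> columns_independent (rank M) A X}"
    using realization by (simp add: tu_realization_def coordinate_matroid_def)
  moreover have "indep M = {X. X \<subseteq> E \<and> graphic.free X}" by (simp add: coordinate_matroid_def)
  ultimately have "graphic.free I \<longleftrightarrow> columns_independent (rank M) A I" using I by blast
  then show ?thesis using columns_independent_iff_free[OF fin] by simp
qed

text \<open>An element outside the closure of a free set enlarges it, so closure can be read off
  from the free sets, which both spaces share.\<close>

lemma row_spans:
  assumes "B \<subseteq> E" "graphic.free B" "T \<subseteq> E" "graphic.spans B T"
  shows "R.spans B T"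
  unfolding R.spans_def
proof (intro ballI impI)
  fix q t assume q: "q \<in> row_space (rank M) A" "\<forall>s\<in>B. q s = 0" "t \<in> T"
  show "q t = 0"
  proof (rule ccontr)
    assume n: "q t \<noteq> 0"
    have fin: "finite B" using assms(1) finite_E finite_subset by blast
    have tB: "t \<notin> B" using n q(2) by blast
    have "R.free B" using free_iff_row_free[OF assms(1)] assms(2) by simp
    then have "R.free (insert t B)" using R.free_insert_iff[OF fin _ tB] q n by blast
    then have "graphic.free (insert t B)" using free_iff_row_free[of "insert t B"] assms q(3) by blast
    then show False
      using graphic.free_insert_iff[OF fin assms(2) tB] assms(4) q(3)
      unfolding graphic.spans_def by blast
  qed
qed

definition row :: "(nat \<Rightarrow> int) \<Rightarrow> nat set \<Rightarrow> int" where
  "row z e = (\<Sum>i<rank M. z i * A i e)"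

lemma row_in_row_space: "(\<lambda>e. real_of_int (row z e)) \<in> row_space (rank M) A"
  unfolding row_space_def row_def by (intro range_eqI[of _ _ "\<lambda>i. real_of_int (z i)"]) simp

lemma row_diff: "row (\<lambda>i. y i - c * z i) e = row y e - c * row z e"
  by (simp add: row_def algebra_simps sum_subtractf sum_distrib_left)

text \<open>By 2-connectedness the star of \<open>v\<close> is a bond: the edges avoiding
  \<open>v\<close> form a hyperplane, and any star edge completes a basis \<open>B0\<close> of it to
  a basis of \<open>E\<close>. Rows vanishing on the hyperplane are thus proportional, and comparing
  the integral rows normalized at two star edges shows that the entries on the star are
  units.\<close>

lemma star_row:
  assumes v: "v \<in> V"
  obtains z where "\<forall>e\<in>E. if v \<in> e then row z e = 1 \<or> row z e = -1 else row z e = 0"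
proof -
  let ?Z = "{e \<in> E. v \<notin> e}"
  have fZ: "finite ?Z" using finite_E by simp
  obtain B0 where B0: "{} \<subseteq> B0" "B0 \<subseteq> ?Z" "graphic.free B0" "graphic.spans B0 ?Z"
    using graphic.maximal_free[OF fZ graphic.free_empty empty_subsetI] .
  have fB0: "finite B0" using B0 fZ finite_subset by blast
  have star_basis: "graphic.free (insert t B0)" "graphic.spans (insert t B0) E" "insert t B0 \<subseteq> E"
    if t: "t \<in> E" "v \<in> t" for t
  proof -
    have tB: "t \<notin> B0" using B0(2) t by blast
    have "coboundary (\<lambda>x. if x = v then 1 else 0 :: real) t \<noteq> 0"
      using t edge_ends[OF t(1)] by (auto simp: coboundary_indicator)
    moreover have "\<forall>e\<in>B0. coboundary (\<lambda>x. if x = v then 1 else 0 :: real) e = 0"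
    proof
      fix e assume "e \<in> B0"
      then have "e \<in> E" "v \<notin> e" using B0(2) by auto
      then have "v \<noteq> Min e" "v \<noteq> Max e" using edge_ends(4)[of e] by blast+
      then show "coboundary (\<lambda>x. if x = v then 1 else 0 :: real) e = 0"
        by (simp add: coboundary_indicator)
    qed
    ultimately show "graphic.free (insert t B0)"
      using graphic.free_insert_iff[OF fB0 B0(3) tB] by blast
    show "insert t B0 \<subseteq> E" using B0(2) t by blast
    show "graphic.spans (insert t B0) E"
      unfolding graphic.spans_def
    proof (intro ballI impI)
      fix p :: "nat set \<Rightarrow> real" and e
      assume p: "p \<in> range coboundary" "\<forall>s\<in>insert t B0. p s = 0" and e: "e \<in> E"
      then obtain \<phi> where \<phi>: "p = coboundary \<phi>" by blast
      have z: "\<phi> (Min e) = \<phi> (Max e)" if "e \<in> E" "v \<notin> e" for e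
        using B0(4) p that unfolding graphic.spans_def \<phi> by (auto simp: coboundary_def)
      define w where "w = (if v = Min t then Max t else Min t)"
      have vt: "v = Min t \<or> v = Max t" using edge_ends(4)[OF t(1)] t(2) by blast
      have w: "w \<in> V - {v}" using edge_ends(1-3)[OF t(1)] vt by (auto simp: w_def)
      have "{v, w} = {Min t, Max t}" using vt by (auto simp: w_def)
      then have tw: "t = {v, w}" using edge_ends(4)[OF t(1)] by simp
      have vw: "\<phi> v = \<phi> w" using p(2) coboundary_eq_0_iff[of \<phi> v w] tw \<phi> by simp
      \<comment> \<open>Zero coboundary off the star makes \<phi> constant on
        \<open>V - {v}\<close>, which is connected; the edge \<open>t\<close> carries the value over
        to \<open>v\<close>.\<close>
      have "x \<in> {x. \<phi> x = \<phi> w}" if x: "x \<in> V - {v}" for x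
        by (rule two_connected[OF v, of _ w]) (use z w x in auto)
      then have "\<phi> x = \<phi> w" if "x \<in> V" for x using vw that by (cases "x = v") auto
      then show "p e = 0" using edge_ends[OF e] by (simp add: \<phi> coboundary_def)
    qed
  qed
  have tu: "totally_unimodular (rank M) E A"
    using realization by (simp add: tu_realization_def coordinate_matroid_def)
  have "\<exists>z. \<forall>s\<in>insert t B0. row z s = (if s = t then 1 else 0)" if t: "t \<in> E" "v \<in> t" for t
  proof -
    note B = star_basis[OF t]
    have "card (insert t B0) = rank M"
      using graphic.rank_coordinate_matroid[OF finite_E B(3,1,2)] by simp
    moreover have "columns_independent (rank M) A (insert t B0)"
      using B free_iff_row_free[OF B(3)] columns_independent_iff_free[of "insert t B0" "rank M" A] fB0
      by simp
    ultimately obtain z where "\<forall>s\<in>insert t B0. (\<Sum>i<rank M. z i * A i s) = (if s = t then 1 else 0)"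
      using integral_dual_row[OF tu B(3), of t] fB0 by auto
    then show ?thesis unfolding row_def by blast
  qed
  then obtain z where z: "\<And>t s. t \<in> E \<Longrightarrow> v \<in> t \<Longrightarrow> s \<in> insert t B0 \<Longrightarrow>
      row (z t) s = (if s = t then 1 else 0)" by metis
  obtain s where s: "s \<in> E" "v \<in> s" using star[OF v] by blast
  have spanned: "row y e = 0" if "\<forall>b\<in>B. row y b = 0" "B \<subseteq> E" "graphic.free B" "T \<subseteq> E"
    "graphic.spans B T" "e \<in> T" for y B T e
    using row_spans[OF that(2-5)] row_in_row_space[of y] that(1,6) unfolding R.spans_def by auto
  have "row (z s) e = 0" if e: "e \<in> E" "v \<notin> e" for e
  proof (rule spanned[of B0 "z s" ?Z])
    show "\<forall>b\<in>B0. row (z s) b = 0" using z[OF s] B0(2) s by auto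
  qed (use B0 e in auto)
  moreover have "row (z s) t = 1 \<or> row (z s) t = -1" if t: "t \<in> E" "v \<in> t" for t
  proof -
    \<comment> \<open>This combination vanishes on the basis \<open>insert t B0\<close>, hence at
      \<open>s\<close>, where it says that two integers have product 1.\<close>
    define y where "y = (\<lambda>i. z s i - row (z s) t * z t i)"
    have y: "row y e = row (z s) e - row (z s) t * row (z t) e" for e
      unfolding y_def by (rule row_diff)
    have "row y b = 0" if b: "b \<in> insert t B0" for b
    proof (cases "b = t")
      case True then show ?thesis using z[OF t, of t] by (simp add: y)
    next
      case False
      then have b0: "b \<in> B0" using b by simp
      then have "b \<noteq> s" using B0(2) s by auto
      then show ?thesis using z[OF t b] z[OF s, of b] b0 False by (simp add: y)
    qed
    then have "row y s = 0"
      using spanned[of "insert t B0" y E s] star_basis[OF t] s(1) by blast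
    then have "row (z s) t * row (z t) s = 1" using z[OF s, of s] by (simp add: y)
    then show ?thesis by (simp add: zmult_eq_1_iff) blast
  qed
  ultimately show ?thesis using that[of "z s"] by auto
qed

text \<open>Rescaled by signs, the \<open>|V|\<close> star rows in a lattice of rank \<open>|V| - 1\<close> satisfy a linear
  relation, which by connectedness is the relation of the vertex coboundaries.\<close>

lemma realization_signs:
  obtains \<sigma> :: "nat set \<Rightarrow> int" where "\<forall>e\<in>E. \<sigma> e = 1 \<or> \<sigma> e = -1"
    "\<forall>v\<in>V. \<exists>z. \<forall>e\<in>E. row z e = \<sigma> e * coboundary (\<lambda>x. if x = v then 1 else 0) e"
    "\<forall>z. \<exists>\<phi>. \<forall>e\<in>E. row z e = \<sigma> e * coboundary \<phi> e"
proof -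
  have "\<forall>v\<in>V. \<exists>z. \<forall>e\<in>E. if v \<in> e then row z e = 1 \<or> row z e = -1 else row z e = 0"
    using star_row by metis
  then obtain Z where Z: "\<And>v e. v \<in> V \<Longrightarrow> e \<in> E \<Longrightarrow>
      if v \<in> e then row (Z v) e = 1 \<or> row (Z v) e = -1 else row (Z v) e = 0" by metis
  obtain r where r: "r \<in> V" using V_nonempty by blast
  have "card V > 0" using r finite_V by (auto simp: card_gt_0_iff)
  \<comment> \<open>There is one star row more than the rank, which forces a relation.\<close>
  then have less: "card {..<rank M} < card V" by (simp add: rank_M)
  have sum2: "(\<Sum>v\<in>V. \<alpha> v * real_of_int (row (Z v) e)) =
      \<alpha> (Min e) * real_of_int (row (Z (Min e)) e) + \<alpha> (Max e) * real_of_int (row (Z (Max e)) e)"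
    if e: "e \<in> E" for e \<alpha>
  proof -
    note ends = edge_ends[OF e]
    have "row (Z v) e = 0" if "v \<in> V - {Min e, Max e}" for v
    proof -
      have "v \<notin> e" using that ends(4) by blast
      then show ?thesis using Z[OF _ e, of v] that by simp
    qed
    then have "(\<Sum>v\<in>V. \<alpha> v * real_of_int (row (Z v) e)) =
        (\<Sum>v\<in>{Min e, Max e}. \<alpha> v * real_of_int (row (Z v) e))"
      by (intro sum.mono_neutral_right) (use finite_V ends(1,2) in auto)
    then show ?thesis using ends(3) by simp
  qed
  have relation: "\<exists>\<alpha>. (\<exists>v\<in>V. \<alpha> v \<noteq> 0) \<and> (\<forall>e. (\<Sum>v\<in>V. \<alpha> v * real_of_int (row (y v) e)) = 0)" for y
  proof -
    obtain \<alpha> where a: "\<exists>v\<in>V. \<alpha> v \<noteq> 0" "\<forall>i\<in>{..<rank M}. (\<Sum>v\<in>V. real_of_int (y v i) * \<alpha> v) = 0"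
      using underdetermined_system[OF _ finite_V less, of "\<lambda>i v. real_of_int (y v i)"] by auto
    have "(\<Sum>v\<in>V. \<alpha> v * real_of_int (row (y v) e)) = 0" for e
    proof -
      have "(\<Sum>v\<in>V. \<alpha> v * real_of_int (row (y v) e)) =
          (\<Sum>v\<in>V. \<Sum>i<rank M. real_of_int (A i e) * (real_of_int (y v i) * \<alpha> v))"
        by (simp add: row_def sum_distrib_left algebra_simps)
      also have "\<dots> = (\<Sum>i<rank M. real_of_int (A i e) * (\<Sum>v\<in>V. real_of_int (y v i) * \<alpha> v))"
        by (subst sum.swap) (simp add: sum_distrib_left)
      finally show ?thesis using a(2) by simp
    qed
    then show ?thesis using a(1) by blast
  qed
  obtain \<alpha> u where a: "u \<in> V" "\<alpha> u \<noteq> 0" "\<And>e. (\<Sum>v\<in>V. \<alpha> v * real_of_int (row (Z v) e)) = 0"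
    using relation[of Z] by blast
  have ends_pm: "row (Z (Min e)) e = 1 \<or> row (Z (Min e)) e = -1"
    "row (Z (Max e)) e = 1 \<or> row (Z (Max e)) e = -1" if "e \<in> E" for e
    using Z[OF edge_ends(1)[OF that] that] Z[OF edge_ends(2)[OF that] that] edge_ends(4)[OF that]
    by (metis insertI1 insertI2)+
  have balance: "\<alpha> (Min e) * real_of_int (row (Z (Min e)) e) + \<alpha> (Max e) * real_of_int (row (Z (Max e)) e) = 0"
    if "e \<in> E" for e using a(3)[of e] sum2[OF that, of \<alpha>] by simp
  \<comment> \<open>Each edge lies in exactly two stars, with entries 1 or -1, so the coefficients
    of a relation have equal absolute values at its ends.\<close>
  have abs_eq: "\<bar>\<alpha> v\<bar> = \<bar>\<alpha> u\<bar>" if v: "v \<in> V" for v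
  proof -
    have "v \<in> {x. \<bar>\<alpha> x\<bar> = \<bar>\<alpha> u\<bar>}"
    proof (rule connected[of _ u])
      fix e assume e: "e \<in> E"
      have "\<bar>\<alpha> (Min e)\<bar> = \<bar>\<alpha> (Max e)\<bar>" using balance[OF e] ends_pm[OF e] by auto
      then show "Min e \<in> {x. \<bar>\<alpha> x\<bar> = \<bar>\<alpha> u\<bar>} \<longleftrightarrow> Max e \<in> {x. \<bar>\<alpha> x\<bar> = \<bar>\<alpha> u\<bar>}" by simp
    qed (use a v in auto)
    then show ?thesis by simp
  qed
  define \<tau> :: "nat \<Rightarrow> int" where "\<tau> = (\<lambda>v. if \<alpha> v > 0 then 1 else -1)"
  have \<tau>: "\<tau> v * \<tau> v = 1" for v by (simp add: \<tau>_def)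
  have \<alpha>\<tau>: "\<alpha> v = \<bar>\<alpha> u\<bar> * real_of_int (\<tau> v)" if "v \<in> V" for v
    using abs_eq[OF that] by (auto simp: \<tau>_def)
  \<comment> \<open>Once every star is scaled by the sign \<tau> of its coefficient, the rows add up
    to 0, so the two entries at an edge are opposite; \<sigma> is the one at the smaller
    end.\<close>
  define \<sigma> where "\<sigma> = (\<lambda>e. \<tau> (Min e) * row (Z (Min e)) e)"
  have pm: "\<sigma> e = 1 \<or> \<sigma> e = -1" if "e \<in> E" for e
    using ends_pm[OF that] by (auto simp: \<sigma>_def \<tau>_def)
  have Max_row: "\<tau> (Max e) * row (Z (Max e)) e = - \<sigma> e" if e: "e \<in> E" for e
  proof -
    have "\<bar>\<alpha> u\<bar> * real_of_int (\<sigma> e + \<tau> (Max e) * row (Z (Max e)) e) = 0"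
      using balance[OF e] \<alpha>\<tau>[OF edge_ends(1)[OF e]] \<alpha>\<tau>[OF edge_ends(2)[OF e]]
      by (simp add: \<sigma>_def algebra_simps)
    then have "\<sigma> e + \<tau> (Max e) * row (Z (Max e)) e = 0" using a(2) by (simp only: mult_eq_0_iff of_int_eq_0_iff) simp
    then show ?thesis by simp
  qed
  have star: "\<tau> v * row (Z v) e = \<sigma> e * coboundary (\<lambda>x. if x = v then 1 else 0) e"
    if v: "v \<in> V" and e: "e \<in> E" for v e
  proof (cases "v \<in> e")
    case True
    then have "v = Min e \<or> v = Max e" using edge_ends(4)[OF e] by blast
    then show ?thesis
      using Max_row[OF e] edge_ends(3)[OF e] by (auto simp: coboundary_indicator \<sigma>_def)
  next
    case False
    then have "v \<noteq> Min e" "v \<noteq> Max e" using edge_ends(4)[OF e] by blast+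
    then show ?thesis using Z[OF v e] False by (simp add: coboundary_indicator)
  qed
  have "\<exists>z. \<forall>e\<in>E. row z e = \<sigma> e * coboundary (\<lambda>x. if x = v then 1 else 0) e" if v: "v \<in> V" for v
  proof (intro exI ballI)
    fix e assume "e \<in> E"
    have "row (\<lambda>i. \<tau> v * Z v i) e = \<tau> v * row (Z v) e"
      by (simp add: row_def sum_distrib_left mult.assoc)
    then show "row (\<lambda>i. \<tau> v * Z v i) e = \<sigma> e * coboundary (\<lambda>x. if x = v then 1 else 0) e"
      using star[OF v \<open>e \<in> E\<close>] by simp
  qed
  moreover have "\<exists>\<phi>. \<forall>e\<in>E. row z e = \<sigma> e * coboundary \<phi> e" for z
  proof -
    \<comment> \<open>The star of \<open>r\<close> is exchanged for the given row, which again makes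
      \<open>card V\<close> rows in rank \<open>card V - 1\<close>.\<close>
    obtain \<beta> w where b: "w \<in> V" "\<beta> w \<noteq> 0"
      "\<And>e. (\<Sum>v\<in>V. \<beta> v * real_of_int (row ((Z(r := z)) v) e)) = 0"
      using relation[of "Z(r := z)"] by blast
    define \<psi> where "\<psi> = (\<lambda>v. if v = r then 0 else \<beta> v * real_of_int (\<tau> v))"
    have eq: "\<beta> r * real_of_int (row z e) = - (real_of_int (\<sigma> e) * coboundary \<psi> e)" if e: "e \<in> E" for e
    proof -
      have "(\<Sum>v\<in>V. \<beta> v * real_of_int (row ((Z(r := z)) v) e)) =
          \<beta> r * real_of_int (row z e) + (\<Sum>v\<in>V - {r}. \<beta> v * real_of_int (row ((Z(r := z)) v) e))"
        using finite_V r by (subst sum.remove[of V r]) auto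
      also have "(\<Sum>v\<in>V - {r}. \<beta> v * real_of_int (row ((Z(r := z)) v) e)) =
          (\<Sum>v\<in>V - {r}. real_of_int (\<sigma> e) * (\<psi> v * coboundary (\<lambda>x. if x = v then 1 else 0) e))"
      proof (rule sum.cong)
        fix v assume v: "v \<in> V - {r}"
        have "real_of_int (row (Z v) e) = real_of_int (\<tau> v * (\<tau> v * row (Z v) e))"
          using \<tau>[of v] by (simp flip: mult.assoc)
        also have "\<tau> v * row (Z v) e = \<sigma> e * coboundary (\<lambda>x. if x = v then 1 else 0) e"
          using star[of v e] v e by simp
        finally have "real_of_int (row (Z v) e) =
            real_of_int (\<tau> v) * (real_of_int (\<sigma> e) * coboundary (\<lambda>x. if x = v then 1 else 0) e)"
          by (simp add: coboundary_indicator)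
        then show "\<beta> v * real_of_int (row ((Z(r := z)) v) e) =
            real_of_int (\<sigma> e) * (\<psi> v * coboundary (\<lambda>x. if x = v then 1 else 0) e)"
          using v by (simp add: \<psi>_def)
      qed simp
      also have "\<dots> = real_of_int (\<sigma> e) * (\<Sum>v\<in>V. \<psi> v * coboundary (\<lambda>x. if x = v then 1 else 0) e)"
      proof -
        have "(\<Sum>v\<in>V. \<psi> v * coboundary (\<lambda>x. if x = v then 1 else 0) e) =
            \<psi> r * coboundary (\<lambda>x. if x = r then 1 else 0) e +
            (\<Sum>v\<in>V - {r}. \<psi> v * coboundary (\<lambda>x. if x = v then 1 else 0) e)"
          by (rule sum.remove[OF finite_V r])
        moreover have "\<psi> r = 0" by (simp add: \<psi>_def)
        ultimately show ?thesis by (simp add: sum_distrib_left)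
      qed
      also have "\<dots> = real_of_int (\<sigma> e) * coboundary \<psi> e" by (simp add: coboundary_indicator_sum[OF e])
      finally show ?thesis using b(3)[of e] by simp
    qed
    \<comment> \<open>Otherwise the relation would give a potential that vanishes at
      \<open>r\<close>, not at \<open>w\<close>, and has zero coboundary.\<close>
    have "\<beta> r \<noteq> 0"
    proof
      assume 0: "\<beta> r = 0"
      have "coboundary \<psi> e = 0" if "e \<in> E" for e using eq[OF that] pm[OF that] 0 by auto
      then have "\<psi> w = \<psi> r" by (rule coboundary_zero_imp_constant) (use b r in auto)
      then show False using 0 b(2) by (auto simp: \<psi>_def \<tau>_def split: if_splits)
    qed
    define \<phi> where "\<phi> = (\<lambda>v. - \<psi> v / \<beta> r)"
    have \<phi>: "real_of_int (row z e) = real_of_int (\<sigma> e) * coboundary \<phi> e" if "e \<in> E" for e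
      using eq[OF that] \<open>\<beta> r \<noteq> 0\<close> by (simp add: \<phi>_def coboundary_def field_simps)
    \<comment> \<open>\<phi> vanishes at \<open>r\<close> and has integral differences along all
      edges, so connectedness makes it integral on \<open>V\<close>.\<close>
    have int: "\<phi> v \<in> \<int>" if v: "v \<in> V" for v
    proof -
      have "v \<in> {x. \<phi> x \<in> \<int>}"
      proof (rule connected[of _ r])
        fix e assume e: "e \<in> E"
        have "coboundary \<phi> e = real_of_int (\<sigma> e * row z e)" using \<phi>[OF e] pm[OF e] by auto
        then have "\<phi> (Min e) = real_of_int (\<sigma> e * row z e) + \<phi> (Max e)" by (simp add: coboundary_def)
        then show "Min e \<in> {x. \<phi> x \<in> \<int>} \<longleftrightarrow> Max e \<in> {x. \<phi> x \<in> \<int>}"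
          using Ints_add[of "real_of_int (\<sigma> e * row z e)" "\<phi> (Max e)"]
            Ints_diff[of "\<phi> (Min e)" "real_of_int (\<sigma> e * row z e)"] by auto
      qed (use r v in \<open>auto simp: \<phi>_def \<psi>_def\<close>)
      then show ?thesis by simp
    qed
    have "row z e = \<sigma> e * coboundary (\<lambda>v. \<lfloor>\<phi> v\<rfloor>) e" if e: "e \<in> E" for e
    proof -
      have fl: "real_of_int \<lfloor>\<phi> v\<rfloor> = \<phi> v" if "v \<in> V" for v
        using int[OF that] by (auto elim: Ints_cases)
      have "real_of_int (row z e) = real_of_int (\<sigma> e * coboundary (\<lambda>v. \<lfloor>\<phi> v\<rfloor>) e)"
        using \<phi>[OF e] by (simp add: coboundary_def fl[OF edge_ends(1)[OF e]] fl[OF edge_ends(2)[OF e]])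
      then show ?thesis by (simp only: of_int_eq_iff)
    qed
    then show ?thesis by blast
  qed
  ultimately show ?thesis using that[of \<sigma>] pm by blast
qed

end

end

section \<open>Finite certificates for and against solutions\<close>

section \<open>Certificates for solutions\<close>

text \<open>The integers modulo 3 as a free datatype, in which sums and comparisons reduce to
  equations between constructors; \<open>of_trit\<close> gives the meaning.\<close>

datatype trit = Z0 | P1 | M1

primrec of_trit :: "trit \<Rightarrow> 3" where
  "of_trit Z0 = 0" | "of_trit P1 = 1" | "of_trit M1 = -1"

fun tadd :: "trit \<Rightarrow> trit \<Rightarrow> trit" where
  "tadd Z0 y = y" | "tadd P1 Z0 = P1" | "tadd P1 P1 = M1" | "tadd P1 M1 = Z0"
| "tadd M1 Z0 = M1" | "tadd M1 P1 = Z0" | "tadd M1 M1 = P1"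

primrec tneg :: "trit \<Rightarrow> trit" where
  "tneg Z0 = Z0" | "tneg P1 = M1" | "tneg M1 = P1"

lemma of_trit_tadd [simp]: "of_trit (tadd x y) = of_trit x + of_trit y"
  by (cases x; cases y) simp_all

lemma of_trit_tneg [simp]: "of_trit (tneg x) = - of_trit x"
  by (cases x) simp_all

text \<open>Lists of unequal lengths are vectors whose trailing zeros are omitted, which is how
  \<open>entry\<close> reads them.\<close>

fun vadd :: "trit list \<Rightarrow> trit list \<Rightarrow> trit list" where
  "vadd [] ys = ys" | "vadd (x # xs) [] = x # xs" | "vadd (x # xs) (y # ys) = tadd x y # vadd xs ys"

fun vneg :: "trit list \<Rightarrow> trit list" where
  "vneg [] = []" | "vneg (x # xs) = tneg x # vneg xs"

text \<open>The leading nonzero entry selects one vector from each pair \<open>x\<close>,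
  \<open>- x\<close>, a normal form for the arguments of odd functions.\<close>

fun lead :: "trit list \<Rightarrow> trit" where
  "lead [] = Z0" | "lead (Z0 # xs) = lead xs" | "lead (P1 # xs) = P1" | "lead (M1 # xs) = M1"

fun is_zero :: "trit list \<Rightarrow> bool" where
  "is_zero [] = True" | "is_zero (x # xs) = (x = Z0 \<and> is_zero xs)"

definition entry :: "trit list \<Rightarrow> nat \<Rightarrow> 3" where
  "entry u k = (if k < length u then of_trit (u ! k) else 0)"

lemma entry_Nil [simp]: "entry [] k = 0"
  by (simp add: entry_def)

lemma entry_Cons: "entry (x # u) k = (case k of 0 \<Rightarrow> of_trit x | Suc j \<Rightarrow> entry u j)"
  by (auto simp: entry_def split: nat.split)

lemma entry_vadd [simp]: "entry (vadd u v) k = entry u k + entry v k"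
  by (induction u v arbitrary: k rule: vadd.induct) (auto simp: entry_Cons split: nat.split)

lemma entry_vneg [simp]: "entry (vneg u) k = - entry u k"
  by (induction u arbitrary: k) (auto simp: entry_Cons split: nat.split)

lemma entry_is_zero: "is_zero u \<Longrightarrow> entry u k = 0"
  by (induction u arbitrary: k) (auto simp: entry_Cons split: nat.split)

lemma vneg_vneg [simp]: "vneg (vneg u) = u"
proof (induction u)
  case (Cons x u) then show ?case by (cases x) simp_all
qed simp

lemma lead_Z0: "lead u = Z0 \<Longrightarrow> vneg u = u"
  by (induction u rule: lead.induct) auto

fun weight :: "'k \<Rightarrow> (trit \<times> 'k) list \<Rightarrow> trit" where
  "weight k [] = Z0"
| "weight k ((c, l) # xs) = (if l = k then tadd c (weight k xs) else weight k xs)"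

fun without :: "'k \<Rightarrow> (trit \<times> 'k) list \<Rightarrow> (trit \<times> 'k) list" where
  "without k [] = []"
| "without k ((c, l) # xs) = (if l = k then without k xs else (c, l) # without k xs)"

lemma length_without [simp]: "length (without k xs) < Suc (length xs)"
  by (induction k xs rule: without.induct) auto

text \<open>A formal sum is accepted if for each key the coefficients cancel. Keys are compared as
  they are written, so acceptance implies that the sum is 0 under every interpretation of the
  keys.\<close>

function vanishes :: "(trit \<times> 'k) list \<Rightarrow> bool" where
  "vanishes [] = True"
| "vanishes ((c, k) # xs) = (tadd c (weight k xs) = Z0 \<and> vanishes (without k xs))"
  by pat_completeness auto
termination by (relation "measure length") auto

lemma weight_without:
  "(\<Sum>(c, l)\<leftarrow>xs. of_trit c * f l) = of_trit (weight k xs) * f k + (\<Sum>(c, l)\<leftarrow>without k xs. of_trit c * f l)"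
  by (induction k xs rule: weight.induct) (auto simp: algebra_simps)

lemma vanishes_sum: "vanishes xs \<Longrightarrow> (\<Sum>(c, l)\<leftarrow>xs. of_trit c * f l) = 0"
proof (induction xs rule: vanishes.induct)
  case (2 c k xs)
  have "(\<Sum>(c, l)\<leftarrow>(c, k) # xs. of_trit c * f l) =
      of_trit (tadd c (weight k xs)) * f k + (\<Sum>(c, l)\<leftarrow>without k xs. of_trit c * f l)"
    using weight_without[of f xs k] by (simp add: algebra_simps)
  moreover have "tadd c (weight k xs) = Z0" using 2(2) by simp
  ultimately show ?case using 2 by (simp del: of_trit_tadd)
qed simp

text \<open>A row \<open>(ab, \<rho>, us)\<close> describes the edge \<open>ab\<close>, its class \<open>\<rho>\<close> in a chosen basis of
  \<open>\<int>\<^sub>3\<^sup>S\<close> modulo the cuts, and half of the base points of the chain of color \<open>ab\<close>: the other half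
  is the image of \<open>us\<close> under the involution \<open>u \<mapsto> - u - \<rho>\<close>. With
  \<open>\<delta> x = h (- x) - h x\<close> the chain pairs with \<open>h\<close> to the sum of the \<open>\<delta> u - \<delta> (u + \<rho>)\<close>.\<close>

type_synonym row = "(nat \<times> nat) \<times> trit list \<times> trit list list"

text \<open>Contraction acts through the vertex map \<pi> only, so the edges keep their names in all
  minors.\<close>

fun incidence :: "(nat \<Rightarrow> nat) \<Rightarrow> nat \<Rightarrow> nat \<times> nat \<Rightarrow> trit" where
  "incidence \<pi> v (a, b) =
     (if \<pi> a = v then (if \<pi> b = v then Z0 else P1) else if \<pi> b = v then M1 else Z0)"

text \<open>If this is zero at all vertices, each coordinate of \<rho> is a flow, orthogonal to the
  cuts, and \<rho> induces coordinates on the quotient by the cuts.\<close>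

fun flow :: "(nat \<Rightarrow> nat) \<Rightarrow> nat \<Rightarrow> row list \<Rightarrow> trit list" where
  "flow \<pi> v [] = []"
| "flow \<pi> v ((e, \<rho>, us) # rs) = (case incidence \<pi> v e of
      Z0 \<Rightarrow> flow \<pi> v rs | P1 \<Rightarrow> vadd \<rho> (flow \<pi> v rs) | M1 \<Rightarrow> vadd (vneg \<rho>) (flow \<pi> v rs))"

text \<open>Since \<delta> is odd, \<delta> x and \<delta> (- x) are written with one symbol, and
  \<delta> 0 disappears.\<close>

definition odd_term :: "trit \<Rightarrow> trit list \<Rightarrow> (trit \<times> trit list) list" where
  "odd_term s x = (case lead x of Z0 \<Rightarrow> [] | P1 \<Rightarrow> [(s, x)] | M1 \<Rightarrow> [(tneg s, vneg x)])"

fun row_terms :: "trit \<Rightarrow> trit list \<Rightarrow> trit list list \<Rightarrow> (trit \<times> trit list) list" where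
  "row_terms s \<rho> [] = []"
| "row_terms s \<rho> (u # us) = odd_term s u @ odd_term (tneg s) (vadd u \<rho>) @ row_terms s \<rho> us"

fun vertex_terms :: "(nat \<Rightarrow> nat) \<Rightarrow> nat \<Rightarrow> row list \<Rightarrow> (trit \<times> trit list) list" where
  "vertex_terms \<pi> v [] = []"
| "vertex_terms \<pi> v ((e, \<rho>, us) # rs) = (case incidence \<pi> v e of
      Z0 \<Rightarrow> vertex_terms \<pi> v rs
    | P1 \<Rightarrow> row_terms P1 \<rho> us @ vertex_terms \<pi> v rs
    | M1 \<Rightarrow> row_terms M1 \<rho> us @ vertex_terms \<pi> v rs)"

text \<open>Each edge has an end that occurs in no later edge: the list is a forest, in an order in
  which leaves can be removed.\<close>

fun fresh_order :: "(nat \<times> nat) list \<Rightarrow> bool" where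
  "fresh_order [] = True"
| "fresh_order ((a, b) # es) = (a \<noteq> b \<and> fresh_order es \<and>
     (list_all (\<lambda>(c, d). a \<noteq> c \<and> a \<noteq> d) es \<or> list_all (\<lambda>(c, d). b \<noteq> c \<and> b \<noteq> d) es))"

text \<open>The edges outside the tree have the unit vectors as classes; they are the chosen basis
  of the quotient.\<close>

fun unit_rows :: "trit list \<Rightarrow> ((nat \<times> nat) \<times> trit list list) list \<Rightarrow> row list" where
  "unit_rows z [] = []"
| "unit_rows z ((e, us) # rs) = (e, z @ [P1], us) # unit_rows (z @ [Z0]) rs"

lemma of_trit_incidence:
  "of_trit (incidence \<pi> v (a, b)) = (if \<pi> a = v then 1 else 0) - (if \<pi> b = v then 1 else 0)"
  by simp

lemma entry_flow: "entry (flow \<pi> v rs) k = (\<Sum>r\<leftarrow>rs. of_trit (incidence \<pi> v (fst r)) * entry (fst (snd r)) k)"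
  by (induction \<pi> v rs rule: flow.induct) (auto split: trit.split)

lemma odd_term_sum:
  assumes "\<And>x. \<delta> x = H (vneg x) - H x"
  shows "(\<Sum>(c, l)\<leftarrow>odd_term s x. of_trit c * \<delta> l) = of_trit s * \<delta> x"
  by (auto simp: odd_term_def assms lead_Z0 algebra_simps split: trit.split)

lemma row_terms_sum:
  assumes "\<And>x. \<delta> x = H (vneg x) - H x"
  shows "(\<Sum>(c, l)\<leftarrow>row_terms s \<rho> us. of_trit c * \<delta> l) =
    of_trit s * (\<Sum>u\<leftarrow>us. \<delta> u - \<delta> (vadd u \<rho>))"
  by (induction us) (simp_all add: odd_term_sum[of \<delta> H, OF assms] algebra_simps)

lemma vertex_terms_sum:
  assumes "\<And>x. \<delta> x = H (vneg x) - H x"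
  shows "(\<Sum>(c, l)\<leftarrow>vertex_terms \<pi> v rs. of_trit c * \<delta> l) =
    (\<Sum>r\<leftarrow>rs. of_trit (incidence \<pi> v (fst r)) *
      (\<Sum>u\<leftarrow>snd (snd r). \<delta> u - \<delta> (vadd u (fst (snd r)))))"
  by (induction \<pi> v rs rule: vertex_terms.induct)
    (auto simp: row_terms_sum[of \<delta> H, OF assms] split: trit.split)

text \<open>The fresh end of the front edge occurs in no later edge, so the potential can be
  adjusted there after all later edges are settled.\<close>

lemma fresh_order_potential:
  fixes y :: "'l \<Rightarrow> 3"
  assumes "fresh_order (map (\<lambda>r. (f r, g r)) rs)"
  shows "\<exists>\<phi>. \<forall>r\<in>set rs. \<phi> (f r) - \<phi> (g r) = y r"
  using assms
proof (induction rs)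
  case (Cons r rs)
  then obtain \<phi> where \<phi>: "\<forall>r\<in>set rs. \<phi> (f r) - \<phi> (g r) = y r" by auto
  have ne: "f r \<noteq> g r" using Cons.prems by simp
  consider "\<forall>s\<in>set rs. f r \<noteq> f s \<and> f r \<noteq> g s" | "\<forall>s\<in>set rs. g r \<noteq> f s \<and> g r \<noteq> g s"
    using Cons.prems by (auto simp: list_all_iff)
  then show ?case
  proof cases
    case 1
    define \<psi> where "\<psi> = \<phi>(f r := \<phi> (g r) + y r)"
    have "\<psi> (f s) - \<psi> (g s) = y s" if s: "s \<in> set rs" for s
    proof -
      have "f s \<noteq> f r" "g s \<noteq> f r" using 1[rule_format, OF s] by auto
      then show ?thesis using \<phi> s by (simp add: \<psi>_def)
    qed
    moreover have "\<psi> (f r) - \<psi> (g r) = y r" using ne by (simp add: \<psi>_def)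
    ultimately show ?thesis by (intro exI[of _ \<psi>]) simp
  next
    case 2
    define \<psi> where "\<psi> = \<phi>(g r := \<phi> (f r) - y r)"
    have "\<psi> (f s) - \<psi> (g s) = y s" if s: "s \<in> set rs" for s
    proof -
      have "f s \<noteq> g r" "g s \<noteq> g r" using 2[rule_format, OF s] by auto
      then show ?thesis using \<phi> s by (simp add: \<psi>_def)
    qed
    moreover have "\<psi> (f r) - \<psi> (g r) = y r" using ne by (simp add: \<psi>_def)
    ultimately show ?thesis by (intro exI[of _ \<psi>]) simp
  qed
qed simp

lemma length_unit_rows: "length (unit_rows z cs) = length cs"
  by (induction z cs rule: unit_rows.induct) auto

lemma entry_append_unit: "entry (z @ [P1]) k = (if k = length z then 1 else entry z k)"
  by (auto simp: entry_def nth_append)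

lemma entry_unit_rows:
  assumes "is_zero z" "j < length cs"
  shows "entry (fst (snd (unit_rows z cs ! j))) k = (if k = length z + j then 1 else 0)"
  using assms
proof (induction z cs arbitrary: j rule: unit_rows.induct)
  case (2 z e us rs)
  have "is_zero (z @ [Z0])" using 2(2) by (induction z) auto
  then show ?case using 2 by (cases j) (auto simp: entry_append_unit entry_is_zero)
qed simp

fun edge_set :: "nat \<times> nat \<Rightarrow> nat set" where
  "edge_set (a, b) = {a, b}"

text \<open>A cut is the combination of stars with the values of the potential as coefficients. This
  spreads conditions checked at the vertices to all cuts.\<close>

lemma pairing_vertices:
  fixes f :: "(nat \<times> nat) \<times> 'x \<Rightarrow> 3" and \<phi> :: "nat \<Rightarrow> 3"
  assumes "distinct vs" "\<forall>((a, b), _)\<in>set rs. \<pi> a \<in> set vs \<and> \<pi> b \<in> set vs"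
    and "\<And>v. v \<in> set vs \<Longrightarrow> (\<Sum>r\<leftarrow>rs. of_trit (incidence \<pi> v (fst r)) * f r) = 0"
  shows "(\<Sum>r\<leftarrow>rs. (\<phi> (\<pi> (fst (fst r))) - \<phi> (\<pi> (snd (fst r)))) * f r) = 0"
proof -
  have pt: "(\<Sum>v\<leftarrow>vs. \<phi> v * of_trit (incidence \<pi> v (fst r))) =
      \<phi> (\<pi> (fst (fst r))) - \<phi> (\<pi> (snd (fst r)))" if r: "r \<in> set rs" for r
  proof -
    obtain a b where ab: "fst r = (a, b)" by (cases "fst r")
    have ends: "\<pi> a \<in> set vs" "\<pi> b \<in> set vs" using assms(2) r ab by (cases r; force)+
    have "(\<Sum>v\<leftarrow>vs. \<phi> v * of_trit (incidence \<pi> v (fst r))) =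
        (\<Sum>v\<in>set vs. \<phi> v * of_trit (incidence \<pi> v (a, b)))"
      using assms(1) by (simp add: sum.distinct_set_conv_list ab)
    also have "\<dots> = (\<Sum>v\<in>set vs. (if v = \<pi> a then \<phi> v else 0) - (if v = \<pi> b then \<phi> v else 0))"
      by (rule sum.cong) (auto simp: of_trit_incidence simp del: incidence.simps)
    finally show ?thesis using ends by (simp add: sum_subtractf ab)
  qed
  have "(\<Sum>r\<leftarrow>rs. (\<phi> (\<pi> (fst (fst r))) - \<phi> (\<pi> (snd (fst r)))) * f r) =
      (\<Sum>r\<leftarrow>rs. \<Sum>v\<leftarrow>vs. \<phi> v * (of_trit (incidence \<pi> v (fst r)) * f r))"
    by (rule arg_cong[of _ _ sum_list], rule map_cong)
      (simp_all add: pt[symmetric] sum_list_mult_const[symmetric] mult.assoc)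
  also have "\<dots> = (\<Sum>v\<leftarrow>vs. \<phi> v * (\<Sum>r\<leftarrow>rs. of_trit (incidence \<pi> v (fst r)) * f r))"
    by (induction rs) (simp_all add: sum_list_addf distrib_left sum_list_0)
  also have "\<dots> = (\<Sum>v\<leftarrow>vs. 0)"
    by (rule arg_cong[of _ _ sum_list], rule map_cong) (simp_all add: assms(3))
  finally show ?thesis by simp
qed

text \<open>\<open>W\<close> is the space of cuts after identifying vertices by \<pi>. The flow
  \<rho> gives coordinates modulo \<open>W\<close>, and \<sigma> represents coordinates by vectors
  on the edges outside the tree. In these terms a test function becomes a function of coordinate
  lists, and by \<open>pairing_vertices\<close> the chains have to be tested on stars only, where
  \<open>vanishes\<close> compares symbols \<delta> x.\<close>

lemma certificate_sound:
  fixes W :: "(nat set \<Rightarrow> 3) set"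
  assumes R: "R = ts @ unit_rows [] cs"
    and T: "T = edge_set ` fst ` set R" and dist: "distinct (map (\<lambda>r. edge_set (fst r)) R)"
    and tree: "fresh_order (map (\<lambda>r. (\<pi> (fst (fst r)), \<pi> (snd (fst r)))) ts)"
    and vs: "distinct vs" "\<forall>((a, b), _)\<in>set R. \<pi> a \<in> set vs \<and> \<pi> b \<in> set vs"
    and flows: "\<And>v. v \<in> set vs \<Longrightarrow> is_zero (flow \<pi> v R)"
    and terms: "\<And>v. v \<in> set vs \<Longrightarrow> vanishes (vertex_terms \<pi> v R)"
    and len: "\<And>r. r \<in> set R \<Longrightarrow> length (snd (snd r)) mod 3 = 1"
    and W1: "\<And>c. c \<in> W \<Longrightarrow> \<exists>\<phi>. \<forall>(a, b)\<in>fst ` set R. c {a, b} = \<phi> (\<pi> a) - \<phi> (\<pi> b)"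
    and W2: "\<And>c \<phi>. \<forall>(a, b)\<in>fst ` set R. c {a, b} = \<phi> (\<pi> a) - \<phi> (\<pi> b) \<Longrightarrow> c \<in> vectors T \<Longrightarrow> c \<in> W"
  shows "solvable T W"
proof -
  define n where "n = length cs"
  define C where "C = unit_rows [] cs"
  have lenC: "length C = n" by (simp add: C_def n_def length_unit_rows)
  have RC: "R = ts @ C" by (simp add: R C_def)
  define ed where "ed = (\<lambda>r :: row. edge_set (fst r))"
  have Ted: "T = set (map ed R)" by (simp add: T ed_def image_image)
  have distR: "distinct (map ed R)" using dist by (simp add: ed_def)
  have sumT: "(\<Sum>s\<in>T. g s) = (\<Sum>r\<leftarrow>R. g (ed r))" for g :: "nat set \<Rightarrow> 3"
    unfolding Ted sum.distinct_set_conv_list[OF distR] by (simp add: comp_def)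
  have inj: "r = r'" if "r \<in> set R" "r' \<in> set R" "ed r = ed r'" for r r'
    using distR that by (auto simp: distinct_map inj_on_def)
  have ed_CC: "ed (C ! j) = ed (C ! k) \<longleftrightarrow> j = k" if "j < n" "k < n" for j k
    using distR that lenC nth_eq_iff_index_eq[of "map ed C" j k] by (auto simp: RC)
  have coC: "entry (fst (snd (C ! j))) k = (if k = j then 1 else 0)" if "j < n" for j k
    using entry_unit_rows[of "[]" j cs k] that by (simp add: C_def n_def)
  define \<sigma> :: "trit list \<Rightarrow> nat set \<Rightarrow> 3" where
    "\<sigma> = (\<lambda>u s. \<Sum>k<n. if s = ed (C ! k) then entry u k else 0)"
  have \<sigma>_add: "\<sigma> (vadd u v) = \<sigma> u + \<sigma> v" for u v
    by (rule ext) (auto simp: \<sigma>_def simp flip: sum.distrib intro!: sum.cong)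
  have \<sigma>_neg: "\<sigma> (vneg u) = - \<sigma> u" for u
    by (rule ext) (auto simp: \<sigma>_def simp flip: sum_negf intro!: sum.cong)
  have \<sigma>_C: "\<sigma> u (ed (C ! j)) = entry u j" if j: "j < n" for u j
  proof -
    have "\<sigma> u (ed (C ! j)) = (\<Sum>k<n. if j = k then entry u k else 0)"
      unfolding \<sigma>_def by (rule sum.cong) (use ed_CC j in auto)
    then show ?thesis using j by simp
  qed
  have \<sigma>_ts: "\<sigma> u (ed r) = 0" if "r \<in> set ts" for u r
  proof -
    have "ed r \<noteq> ed (C ! k)" if "k < n" for k
      using distR \<open>r \<in> set ts\<close> that lenC by (auto simp: RC)
    then show ?thesis by (simp add: \<sigma>_def)
  qed
  have edT: "ed r \<in> T" if "r \<in> set R" for r using that by (auto simp: Ted)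
  have \<sigma>T: "\<sigma> u \<in> vectors T" for u
  proof -
    have "s \<noteq> ed (C ! k)" if "s \<notin> T" "k < n" for s k
      using that edT[of "C ! k"] lenC by (auto simp: RC)
    then show ?thesis by (auto simp: vectors_def \<sigma>_def)
  qed
  \<comment> \<open>The coordinates of a vector modulo the cuts, obtained by pairing with the flow
    \<rho>.\<close>
  define q where "q = (\<lambda>(x :: nat set \<Rightarrow> 3) k. \<Sum>r\<leftarrow>R. x (ed r) * entry (fst (snd r)) k)"
  have q_cob: "q x k = 0" if x: "\<forall>r\<in>set R. x (ed r) = \<phi> (\<pi> (fst (fst r))) - \<phi> (\<pi> (snd (fst r)))" for x \<phi> k
  proof -
    have "q x k = (\<Sum>r\<leftarrow>R. (\<phi> (\<pi> (fst (fst r))) - \<phi> (\<pi> (snd (fst r)))) * entry (fst (snd r)) k)"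
      unfolding q_def by (rule arg_cong[of _ _ sum_list], rule map_cong) (use x in auto)
    also have "\<dots> = 0"
    proof (rule pairing_vertices[OF vs])
      fix v assume "v \<in> set vs"
      then have "entry (flow \<pi> v R) k = 0" using flows entry_is_zero by blast
      then show "(\<Sum>r\<leftarrow>R. of_trit (incidence \<pi> v (fst r)) * entry (fst (snd r)) k) = 0"
        unfolding entry_flow .
    qed
    finally show ?thesis .
  qed
  have q_diff: "q (\<lambda>s. x s - y s) k = q x k - q y k" for x y k
    by (simp add: q_def algebra_simps sum_list_subtractf)
  \<comment> \<open>Some cut \<open>c\<close> agrees with \<open>y\<close> on the tree edges. Their
    difference \<open>z\<close> lives on the other edges, where \<open>q\<close> reads off its
    entries; these are 0 because \<open>q\<close> kills both \<open>y\<close> and \<open>c\<close>.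
    Hence \<open>y\<close> is the cut \<open>c\<close>.\<close>
  have edge_class: "basis_vector (ed r) - \<sigma> (fst (snd r)) \<in> W" if r: "r \<in> set R" for r
  proof -
    define y where "y = (\<lambda>s. basis_vector (ed r) s - \<sigma> (fst (snd r)) s)"
    obtain \<phi> where \<phi>: "\<forall>t\<in>set ts. \<phi> (\<pi> (fst (fst t))) - \<phi> (\<pi> (snd (fst t))) = y (ed t)"
      using fresh_order_potential[OF tree, of "\<lambda>t. y (ed t)"] by blast
    have "\<forall>s\<in>T. \<exists>t. t \<in> set R \<and> s = ed t" by (auto simp: Ted)
    then obtain t where t: "\<And>s. s \<in> T \<Longrightarrow> t s \<in> set R" "\<And>s. s \<in> T \<Longrightarrow> s = ed (t s)" by metis
    define c where "c = (\<lambda>s. \<phi> (\<pi> (fst (fst (t s)))) - \<phi> (\<pi> (snd (fst (t s)))))"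
    have c: "c (ed t') = \<phi> (\<pi> (fst (fst t'))) - \<phi> (\<pi> (snd (fst t')))" if "t' \<in> set R" for t'
    proof -
      have "t (ed t') = t'" using inj[OF t(1) that] t(2) edT[OF that] by metis
      then show ?thesis by (simp add: c_def)
    qed
    define z where "z = (\<lambda>s. y s - c s)"
    have z_ts: "z (ed t') = 0" if "t' \<in> set ts" for t'
      using \<phi> that c[of t'] by (simp add: z_def RC)
    have q_basis: "q (basis_vector (ed r)) k = entry (fst (snd r)) k" for k
    proof -
      have "distinct R" using distR by (simp add: distinct_map)
      have "q (basis_vector (ed r)) k = (\<Sum>r'\<in>set R. basis_vector (ed r) (ed r') * entry (fst (snd r')) k)"
        by (simp add: q_def sum.distinct_set_conv_list[OF \<open>distinct R\<close>])
      also have "\<dots> = (\<Sum>r'\<in>set R. if r' = r then entry (fst (snd r')) k else 0)"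
      proof (rule sum.cong)
        fix r' assume "r' \<in> set R"
        then have "ed r' = ed r \<longleftrightarrow> r' = r" using inj r by blast
        then show "basis_vector (ed r) (ed r') * entry (fst (snd r')) k =
            (if r' = r then entry (fst (snd r')) k else 0)" by (simp add: basis_vector_def)
      qed simp
      finally show ?thesis using r by simp
    qed
    have q_C: "q x k = x (ed (C ! k))" if x: "\<forall>t'\<in>set ts. x (ed t') = 0" and k: "k < n" for x k
    proof -
      have "(\<Sum>r\<leftarrow>ts. x (ed r) * entry (fst (snd r)) k) = (\<Sum>r\<leftarrow>ts. 0)"
        by (rule arg_cong[of _ _ sum_list], rule map_cong) (use x in auto)
      then have "q x k = (\<Sum>r\<leftarrow>C. x (ed r) * entry (fst (snd r)) k)" by (simp add: q_def RC)
      also have "\<dots> = (\<Sum>j<n. x (ed (C ! j)) * entry (fst (snd (C ! j))) k)"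
        by (simp add: sum_list_sum_nth lenC atLeast0LessThan)
      also have "\<dots> = (\<Sum>j<n. if j = k then x (ed (C ! j)) else 0)"
        by (rule sum.cong) (use coC in auto)
      finally show ?thesis using k by simp
    qed
    have "z (ed (C ! k)) = 0" if k: "k < n" for k
    proof -
      have "z (ed (C ! k)) = q z k" using q_C[of z k] z_ts k by simp
      also have "\<dots> = entry (fst (snd r)) k - q (\<sigma> (fst (snd r))) k - q c k"
        by (simp add: z_def y_def q_diff q_basis)
      also have "q (\<sigma> (fst (snd r))) k = entry (fst (snd r)) k"
        using q_C[of "\<sigma> (fst (snd r))" k] \<sigma>_ts \<sigma>_C k by simp
      also have "q c k = 0" using q_cob[of c \<phi>] c by blast
      finally show ?thesis by simp
    qed
    then have "z (ed t') = 0" if "t' \<in> set R" for t'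
    proof (cases "t' \<in> set ts")
      case False
      then have "t' \<in> set C" using that by (simp add: RC)
      then obtain k where "k < n" "t' = C ! k" using lenC by (metis in_set_conv_nth)
      then show ?thesis using \<open>\<And>k. k < n \<Longrightarrow> z (ed (C ! k)) = 0\<close> by simp
    qed (rule z_ts)
    then have "y (ed t') = \<phi> (\<pi> (fst (fst t'))) - \<phi> (\<pi> (snd (fst t')))" if "t' \<in> set R" for t'
      using c[OF that] that by (simp add: z_def)
    then have "\<forall>(a, b)\<in>fst ` set R. y {a, b} = \<phi> (\<pi> a) - \<phi> (\<pi> b)"
      by (force simp: ed_def)
    moreover have "y \<in> vectors T"
      using \<sigma>T[of "fst (snd r)"] edT[OF r] by (auto simp: y_def vectors_def basis_vector_def)
    ultimately have "y \<in> W" by (rule W2)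
    moreover have "y = basis_vector (ed r) - \<sigma> (fst (snd r))" by (rule ext) (simp add: y_def)
    ultimately show ?thesis by simp
  qed
  define row where "row = (\<lambda>s. SOME r. r \<in> set R \<and> ed r = s)"
  have row: "row (ed r) = r" if "r \<in> set R" for r
  proof -
    have "row (ed r) \<in> set R \<and> ed (row (ed r)) = ed r"
      unfolding row_def by (rule someI[of _ r]) (use that in simp)
    then show ?thesis using inj that by blast
  qed
  \<comment> \<open>Every listed \<open>u\<close> is accompanied by its mirror image, the tail of
    the reversed edge under x -> - x.\<close>
  define L where "L = (\<lambda>s. concat (map (\<lambda>u. [\<sigma> u, - \<sigma> u - basis_vector s]) (snd (snd (row s)))))"
  show ?thesis
    unfolding solvable_def
  proof (intro exI[of _ L] conjI ballI allI impI)
    fix s assume "s \<in> T"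
    then obtain r where r: "r \<in> set R" "s = ed r" by (auto simp: Ted)
    have "- \<sigma> u - basis_vector s \<in> vectors T" for u
      using \<sigma>T[of u] \<open>s \<in> T\<close> by (auto simp: vectors_def basis_vector_def)
    then show "set (L s) \<subseteq> vectors T" using \<sigma>T by (auto simp: L_def)
    have "length (L s) = 2 * length (snd (snd r))"
      by (simp add: L_def r row length_concat comp_def sum_list_triv)
    moreover have "length (snd (snd r)) = 3 * (length (snd (snd r)) div 3) + 1"
      using len[OF r(1)] by (metis mult_div_mod_eq)
    \<comment> \<open>A list of length 3 m + 1 yields 6 m + 2 base points, and 6 = 0 modulo
      3.\<close>
    moreover have "(of_nat (2 * (3 * m + 1)) :: 3) = 2" for m
    proof -
      have "(6 :: 3) = 0" by simp
      then have "(6 :: 3) * of_nat m = 0" by (metis mult_zero_left)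
      then show ?thesis by simp
    qed
    ultimately show "of_nat (length (L s)) = (2 :: 3)" by metis
  next
    fix c and h :: "(nat set \<Rightarrow> 3) \<Rightarrow> 3"
    assume c: "c \<in> W" and h: "\<forall>x. \<forall>w\<in>W. h (x + w) = h x"
    obtain \<phi> where \<phi>: "\<forall>(a, b)\<in>fst ` set R. c {a, b} = \<phi> (\<pi> a) - \<phi> (\<pi> b)" using W1[OF c] by blast
    define H where "H = (\<lambda>u. h (\<sigma> u))"
    define \<delta> where "\<delta> = (\<lambda>u. H (vneg u) - H u)"
    have chain: "(\<Sum>x\<leftarrow>L (ed r). h (x + basis_vector (ed r)) - h x) =
        (\<Sum>u\<leftarrow>snd (snd r). \<delta> u - \<delta> (vadd u (fst (snd r))))" if r: "r \<in> set R" for r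
    proof -
      define \<rho> where "\<rho> = fst (snd r)"
      define w where "w = basis_vector (ed r) - \<sigma> \<rho>"
      have w: "w \<in> W" using edge_class[OF r] by (simp add: w_def \<rho>_def)
      have b: "basis_vector (ed r) = \<sigma> \<rho> + w" by (simp add: w_def)
      have 1: "h (\<sigma> u + basis_vector (ed r)) = H (vadd u \<rho>)" for u
      proof -
        have "\<sigma> u + basis_vector (ed r) = \<sigma> (vadd u \<rho>) + w" by (simp add: b \<sigma>_add add.assoc)
        then show ?thesis using h w by (simp add: H_def)
      qed
      have 2: "h (- \<sigma> u - basis_vector (ed r)) = H (vneg (vadd u \<rho>))" for u
      proof -
        have "- \<sigma> u - basis_vector (ed r) + w = \<sigma> (vneg (vadd u \<rho>))"
          unfolding b \<sigma>_neg \<sigma>_add by (rule ext) simp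
        then show ?thesis using h[rule_format, OF w, of "- \<sigma> u - basis_vector (ed r)"]
          unfolding H_def by simp
      qed
      have 3: "h (- \<sigma> u - basis_vector (ed r) + basis_vector (ed r)) = H (vneg u)" for u
        by (simp add: H_def \<sigma>_neg)
      define g where "g = (\<lambda>x. h (x + basis_vector (ed r)) - h x)"
      define m where "m = (\<lambda>u. - \<sigma> u - basis_vector (ed r))"
      have g: "g (\<sigma> u) = H (vadd u \<rho>) - H u" "g (m u) = H (vneg u) - H (vneg (vadd u \<rho>))" for u
        by (simp_all only: g_def m_def 1 2 3) (simp only: H_def)
      have "(\<Sum>x\<leftarrow>concat (map (\<lambda>u. [\<sigma> u, m u]) us). g x) =
          (\<Sum>u\<leftarrow>us. \<delta> u - \<delta> (vadd u \<rho>))" for us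
        by (induction us) (simp_all add: g \<delta>_def)
      then have "(\<Sum>x\<leftarrow>concat (map (\<lambda>u. [\<sigma> u, - \<sigma> u - basis_vector (ed r)]) us).
          h (x + basis_vector (ed r)) - h x) = (\<Sum>u\<leftarrow>us. \<delta> u - \<delta> (vadd u \<rho>))" for us
        unfolding g_def m_def .
      then show ?thesis unfolding L_def row[OF r] \<rho>_def .
    qed
    have "(\<Sum>s\<in>T. c s * (\<Sum>x\<leftarrow>L s. h (x + basis_vector s) - h x)) =
        (\<Sum>r\<leftarrow>R. (\<phi> (\<pi> (fst (fst r))) - \<phi> (\<pi> (snd (fst r)))) *
          (\<Sum>u\<leftarrow>snd (snd r). \<delta> u - \<delta> (vadd u (fst (snd r)))))"
      unfolding sumT
    proof (rule arg_cong[of _ _ sum_list], rule map_cong)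
      fix r assume r: "r \<in> set R"
      obtain a b where ab: "fst r = (a, b)" by (cases "fst r")
      then have "(a, b) \<in> fst ` set R" using r by force
      then have "c (ed r) = \<phi> (\<pi> (fst (fst r))) - \<phi> (\<pi> (snd (fst r)))"
        using \<phi> ab by (auto simp: ed_def)
      then show "c (ed r) * (\<Sum>x\<leftarrow>L (ed r). h (x + basis_vector (ed r)) - h x) =
          (\<phi> (\<pi> (fst (fst r))) - \<phi> (\<pi> (snd (fst r)))) *
          (\<Sum>u\<leftarrow>snd (snd r). \<delta> u - \<delta> (vadd u (fst (snd r))))"
        using chain[OF r] by simp
    qed simp
    also have "\<dots> = 0"
    proof (rule pairing_vertices[OF vs])
      fix v assume "v \<in> set vs"
      then have "(\<Sum>(c, l)\<leftarrow>vertex_terms \<pi> v R. of_trit c * \<delta> l) = 0"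
        using terms vanishes_sum by blast
      then show "(\<Sum>r\<leftarrow>R. of_trit (incidence \<pi> v (fst r)) *
          (\<Sum>u\<leftarrow>snd (snd r). \<delta> u - \<delta> (vadd u (fst (snd r))))) = 0"
        using vertex_terms_sum[of \<delta> H \<pi> v R] by (simp only: \<delta>_def)
    qed
    finally show "(\<Sum>s\<in>T. c s * (\<Sum>x\<leftarrow>L s. h (x + basis_vector s) - h x)) = 0" .
  qed
qed

section \<open>Certified minors of graphs\<close>

text \<open>A numeral is consumed two bits at a time, and the final \<open>One\<close> is the
  leading digit, which protects trailing zeros of the vector. The digit 3 and other leading digits
  encode no vector; their equations only make the function total.\<close>

fun trits :: "num \<Rightarrow> trit list" where
  "trits num.One = []"
| "trits (num.Bit0 num.One) = []"
| "trits (num.Bit1 num.One) = []"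
| "trits (num.Bit0 (num.Bit0 n)) = Z0 # trits n"
| "trits (num.Bit1 (num.Bit0 n)) = P1 # trits n"
| "trits (num.Bit0 (num.Bit1 n)) = M1 # trits n"
| "trits (num.Bit1 (num.Bit1 n)) = M1 # trits n"

text \<open>The vector \<open>x\<^sub>0, \<dots>, x\<^sub>m\<^sub>-\<^sub>1\<close> modulo 3 is written as the number with base 4 digits
  \<open>x\<^sub>0, \<dots>, x\<^sub>m\<^sub>-\<^sub>1\<close>, least significant first, and leading digit 1.\<close>

definition vec_of :: "nat \<Rightarrow> trit list" where
  "vec_of k = trits (num_of_nat k)"

lemma vec_of_numeral: "vec_of (numeral n) = trits n"
  by (simp add: vec_of_def num_of_nat_numeral_eq)

type_synonym certificate =
  "((nat \<times> nat) \<times> nat \<times> nat list) list \<times> ((nat \<times> nat) \<times> nat list) list"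

fun decode :: "certificate \<Rightarrow> row list" where
  "decode (ts, cs) = map (\<lambda>(e, \<rho>, us). (e, vec_of \<rho>, map vec_of us)) ts @
     unit_rows [] (map (\<lambda>(e, us). (e, map vec_of us)) cs)"

fun one_mod_three :: "'b list \<Rightarrow> bool" where
  "one_mod_three [] = False"
| "one_mod_three [x] = True"
| "one_mod_three [x, y] = False"
| "one_mod_three (x # y # z # xs) = one_mod_three xs"

lemma one_mod_three: "one_mod_three xs \<Longrightarrow> length xs mod 3 = 1"
proof (induction xs rule: one_mod_three.induct)
  case (4 x y z xs)
  have "length (x # y # z # xs) mod 3 = (length xs + 3) mod 3" by simp
  also have "\<dots> = length xs mod 3" by (rule mod_add_self2)
  finally show ?case using 4 by simp
qed simp_all

definition certifies_rows ::
  "(nat \<times> nat) list \<Rightarrow> nat list \<Rightarrow> nat \<times> nat \<Rightarrow> (nat \<Rightarrow> nat) \<Rightarrow> (nat \<times> nat) list \<Rightarrow> row list \<Rightarrow> bool"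
where
  "certifies_rows es vs e \<pi> ts R \<longleftrightarrow>
     distinct (map fst R) \<and> list_all (\<lambda>x. x = e \<or> x \<in> set (map fst R)) es \<and>
     list_all (\<lambda>x. x \<in> set es \<and> x \<noteq> e) (map fst R) \<and>
     fresh_order (map (\<lambda>(a, b). (\<pi> a, \<pi> b)) ts) \<and>
     list_all (\<lambda>v. is_zero (flow \<pi> v R) \<and> vanishes (vertex_terms \<pi> v R)) vs \<and>
     list_all (\<lambda>(e, \<rho>, us). one_mod_three us) R"

definition certifies ::
  "(nat \<times> nat) list \<Rightarrow> nat list \<Rightarrow> nat \<times> nat \<Rightarrow> (nat \<Rightarrow> nat) \<Rightarrow> certificate \<Rightarrow> bool" where
  "certifies es vs e \<pi> C \<longleftrightarrow> certifies_rows es vs e \<pi> (map fst (fst C)) (decode C)"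

text \<open>Contraction moves the second end of \<open>e\<close> onto the first. The abandoned
  vertex may stay in the vertex list, where its star is empty.\<close>

definition merge :: "nat \<times> nat \<Rightarrow> nat \<Rightarrow> nat" where
  "merge e x = (if x = snd e then fst e else x)"

lemmas certifies_simps = merge_def certifies_def certifies_rows_def decode.simps vec_of_numeral trits.simps
  unit_rows.simps append.simps list.map prod.case fst_conv snd_conv distinct.simps
  list.set insert_iff empty_iff list.pred_inject fresh_order.simps flow.simps
  incidence.simps trit.case vadd.simps vneg.simps tadd.simps tneg.simps is_zero.simps
  vanishes.simps weight.simps without.simps odd_term_def lead.simps row_terms.simps
  vertex_terms.simps one_mod_three.simps if_True if_False trit.distinct list.inject list.distinct
  prod.inject numeral_eq_iff one_eq_numeral_iff numeral_eq_one_iff zero_neq_numeral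
  numeral_neq_zero zero_neq_one one_neq_zero num.distinct num.inject simp_thms

lemma edges_of_eq: "edges_of es = edge_set ` set es"
  unfolding edges_of_def by (rule image_cong) auto

lemma edge_set_inj:
  assumes "fst x < snd x" "fst y < snd y" "edge_set x = edge_set y"
  shows "x = y"
  using assms by (cases x; cases y) (auto simp: doubleton_eq_iff)

lemma of_int_surj_3: "\<exists>z :: int. of_int z = (x :: 3)"
proof -
  have "x \<in> {0, 1, 2}" using UNIV_3 by blast
  then have "x = of_int 0 \<or> x = of_int 1 \<or> x = of_int 2" by simp
  then show ?thesis by blast
qed

text \<open>The common part of deletion and contraction: the hypotheses on \<pi> say that the
  potentials with zero coboundary on \<open>X\<close> are exactly those that factor through
  \<pi>.\<close>

lemma certified_solvable:
  assumes lt: "\<forall>e\<in>set es. fst e < snd e" and "distinct vs"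
    and ends: "\<forall>e\<in>set es. \<pi> (fst e) \<in> set vs \<and> \<pi> (snd e) \<in> set vs"
    and cert: "certifies es vs e \<pi> C"
    and \<pi>1: "\<And>(\<phi> :: nat \<Rightarrow> int) x. \<forall>t\<in>X. coboundary \<phi> t = 0 \<Longrightarrow> \<phi> (\<pi> x) = \<phi> x"
    and \<pi>2: "\<And>(\<phi> :: nat \<Rightarrow> int). \<forall>t\<in>X. coboundary (\<lambda>x. \<phi> (\<pi> x)) t = 0"
    and e: "e \<in> set es"
  shows "solvable (edges_of es - {edge_set e})
    (residue_space (range coboundary) X (edges_of es - {edge_set e}))"
proof -
  obtain ts cs where C: "C = (ts, cs)" by (cases C)
  define R where "R = decode C"
  define ts' where "ts' = map (\<lambda>(e, \<rho>, us). (e, vec_of \<rho>, map vec_of us)) ts"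
  define cs' where "cs' = map (\<lambda>(e, us). (e, map vec_of us)) cs"
  have R: "R = ts' @ unit_rows [] cs'" by (simp add: R_def C ts'_def cs'_def)
  have ch: "distinct (map fst R)" "list_all (\<lambda>x. x = e \<or> x \<in> set (map fst R)) es"
    "list_all (\<lambda>x. x \<in> set es \<and> x \<noteq> e) (map fst R)"
    "fresh_order (map (\<lambda>(a, b). (\<pi> a, \<pi> b)) (map fst ts))"
    "list_all (\<lambda>v. is_zero (flow \<pi> v R) \<and> vanishes (vertex_terms \<pi> v R)) vs"
    "list_all (\<lambda>(e, \<rho>, us). one_mod_three us) R"
    using cert unfolding certifies_def certifies_rows_def R_def C by simp_all
  have fstR: "fst ` set R = set es - {e}"
    using ch(2,3) by (auto simp: list_all_iff)
  have inR: "fst x < snd x" "x \<in> set es" "x \<noteq> e" if "x \<in> fst ` set R" for x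
    using that lt unfolding fstR by auto
  let ?T = "edges_of es - {edge_set e}"
  have T: "?T = edge_set ` fst ` set R"
    unfolding fstR edges_of_eq using edge_set_inj lt e by blast
  have cob: "coboundary \<phi> {a, b} = \<phi> a - \<phi> b" if "(a, b) \<in> fst ` set R" for a b and \<phi> :: "nat \<Rightarrow> int"
    using inR(1)[OF that] by (simp add: coboundary_doubleton)
  have inT: "{a, b} \<in> ?T" if "(a, b) \<in> fst ` set R" for a b
    unfolding T using that by (intro image_eqI[of _ _ "(a, b)"]) simp
  show ?thesis
  proof (rule certificate_sound[OF R T])
    show "distinct (map (\<lambda>r. edge_set (fst r)) R)"
    proof -
      have "inj_on edge_set (set (map fst R))"
        using inR(1) edge_set_inj by (intro inj_onI) (metis set_map)
      then have "distinct (map edge_set (map fst R))"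
        unfolding distinct_map[of edge_set] using ch(1) by blast
      then show ?thesis by (simp add: comp_def)
    qed
    have "map (\<lambda>r. (\<pi> (fst (fst r)), \<pi> (snd (fst r)))) ts' = map (\<lambda>(a, b). (\<pi> a, \<pi> b)) (map fst ts)"
      by (auto simp: ts'_def)
    then show "fresh_order (map (\<lambda>r. (\<pi> (fst (fst r)), \<pi> (snd (fst r)))) ts')" using ch(4) by simp
    show "distinct vs" by fact
    have "\<pi> (fst (fst r)) \<in> set vs \<and> \<pi> (snd (fst r)) \<in> set vs" if "r \<in> set R" for r
      using ends inR(2)[of "fst r"] that by simp
    then show "\<forall>((a, b), _)\<in>set R. \<pi> a \<in> set vs \<and> \<pi> b \<in> set vs"
      by (simp add: case_prod_beta)
    show "is_zero (flow \<pi> v R)" "vanishes (vertex_terms \<pi> v R)" if "v \<in> set vs" for v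
      using ch(5) that by (auto simp: list_all_iff)
    show "length (snd (snd r)) mod 3 = 1" if "r \<in> set R" for r
      using ch(6) that by (intro one_mod_three) (auto simp: list_all_iff)
  next
    fix c assume "c \<in> residue_space (range coboundary) X ?T"
    then obtain \<phi> :: "nat \<Rightarrow> int" where \<phi>: "\<forall>t\<in>X. coboundary \<phi> t = 0"
      "c = (\<lambda>s. if s \<in> ?T then of_int (coboundary \<phi> s) else 0)"
      unfolding residue_space_def by blast
    have "c {a, b} = of_int (\<phi> (\<pi> a)) - of_int (\<phi> (\<pi> b))" if "(a, b) \<in> fst ` set R" for a b
      using inT[OF that] cob[OF that, of \<phi>] \<pi>1[OF \<phi>(1)] by (simp add: \<phi>(2))
    then show "\<exists>\<phi>. \<forall>(a, b)\<in>fst ` set R. c {a, b} = \<phi> (\<pi> a) - \<phi> (\<pi> b)"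
      by (intro exI[of _ "\<lambda>x. of_int (\<phi> x)"]) blast
  next
    fix c and \<phi> :: "nat \<Rightarrow> 3"
    assume c: "\<forall>(a, b)\<in>fst ` set R. c {a, b} = \<phi> (\<pi> a) - \<phi> (\<pi> b)" "c \<in> vectors ?T"
    \<comment> \<open>The potential modulo 3 is lifted to the integers, since
      \<open>residue_space\<close> consists of reductions of integral coboundaries.\<close>
    have "\<forall>x. \<exists>z :: int. of_int z = \<phi> x" using of_int_surj_3 by blast
    from choice[OF this] obtain \<psi> :: "nat \<Rightarrow> int" where \<psi>: "\<And>x. of_int (\<psi> x) = \<phi> x" by blast
    define p where "p = coboundary (\<lambda>x. \<psi> (\<pi> x))"
    have "c s = (if s \<in> ?T then of_int (p s) else 0)" for s
    proof (cases "s \<in> ?T")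
      case True
      then obtain x where "x \<in> fst ` set R" "s = edge_set x" unfolding T by blast
      then obtain a b where ab: "(a, b) \<in> fst ` set R" "s = {a, b}" by (cases x) auto
      then have "c s = \<phi> (\<pi> a) - \<phi> (\<pi> b)" using c(1) by blast
      then show ?thesis using True cob[OF ab(1)] ab(2) \<psi> by (simp add: p_def)
    next
      case False
      then have "c s = 0" using c(2) unfolding vectors_def by blast
      then show ?thesis using False by (simp only: if_False)
    qed
    then have "c = (\<lambda>s. if s \<in> ?T then of_int (p s) else 0)" by (rule ext)
    moreover have "p \<in> {q \<in> range coboundary. \<forall>t\<in>X. q t = 0}" using \<pi>2 by (simp add: p_def)
    ultimately show "c \<in> residue_space (range coboundary) X ?T"
      unfolding residue_space_def by (rule image_eqI)
  qed
qed

lemma certified_deletion: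
  assumes "\<forall>e\<in>set es. fst e < snd e" "distinct vs"
    "\<forall>e\<in>set es. fst e \<in> set vs \<and> snd e \<in> set vs" "certifies es vs e (\<lambda>x. x) C" "e \<in> set es"
  shows "solvable (edges_of es - {edge_set e})
    (residue_space (range coboundary) {} (edges_of es - {edge_set e}))"
  by (rule certified_solvable[OF assms(1-4)]) (use assms(5) in auto)

lemma certified_contraction:
  assumes lt: "\<forall>e\<in>set es. fst e < snd e" "distinct vs"
    and ends: "\<forall>e\<in>set es. fst e \<in> set vs \<and> snd e \<in> set vs"
    and cert: "certifies es vs e (merge e) C" and e: "e \<in> set es"
  shows "solvable (edges_of es - {edge_set e})
    (residue_space (range coboundary) {edge_set e} (edges_of es - {edge_set e}))"
proof -
  obtain p q where pq: "e = (p, q)" by (cases e)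
  have "p < q" using lt e pq by auto
  show ?thesis
  proof (rule certified_solvable[OF lt _ cert _ _ e])
    show "\<forall>x\<in>set es. merge e (fst x) \<in> set vs \<and> merge e (snd x) \<in> set vs"
      using ends e by (auto simp: merge_def)
    show "\<phi> (merge e x) = \<phi> x" if "\<forall>t\<in>{edge_set e}. coboundary \<phi> t = 0" for \<phi> :: "nat \<Rightarrow> int" and x
      using that coboundary_eq_0_iff[of \<phi> p q] by (auto simp: merge_def pq)
    show "\<forall>t\<in>{edge_set e}. coboundary (\<lambda>x. \<phi> (merge e x)) t = 0" for \<phi> :: "nat \<Rightarrow> int"
      using coboundary_eq_0_iff[of "\<lambda>x. \<phi> (merge e x)" p q] by (simp add: merge_def pq)
  qed
qed

section \<open>Certificates against solutions\<close>

text \<open>A monomial is the list of its variables with repetition. Monomials are compared as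
  lists, so the certificates write them in increasing order, which is preserved by passing to
  subwords as \<open>shift\<close> and \<open>difference\<close> do.\<close>

type_synonym poly3 = "(trit \<times> nat list) list"

definition eval_poly :: "poly3 \<Rightarrow> (nat \<Rightarrow> 3) \<Rightarrow> 3" where
  "eval_poly p y = (\<Sum>(c, m)\<leftarrow>p. of_trit c * prod_list (map y m))"

fun lookup :: "'b \<Rightarrow> (nat \<times> 'b) list \<Rightarrow> nat \<Rightarrow> 'b" where
  "lookup d [] i = d"
| "lookup d ((j, t) # xs) i = (if i = j then t else lookup d xs i)"

fun scale :: "trit \<Rightarrow> (trit \<times> 'k) list \<Rightarrow> (trit \<times> 'k) list" where
  "scale Z0 p = []"
| "scale P1 p = p"
| "scale M1 [] = []"
| "scale M1 ((c, m) # p) = (tneg c, m) # scale M1 p"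

fun times_var :: "nat \<Rightarrow> poly3 \<Rightarrow> poly3" where
  "times_var i [] = []"
| "times_var i ((c, m) # p) = (c, i # m) # times_var i p"

fun shift :: "(nat \<times> trit) list \<Rightarrow> nat list \<Rightarrow> poly3" where
  "shift \<rho> [] = [(P1, [])]"
| "shift \<rho> (i # m) = times_var i (shift \<rho> m) @ scale (lookup Z0 \<rho> i) (shift \<rho> m)"

text \<open>With \<open>S\<close> the shifted and \<open>m\<close> the original product of the
  remaining variables, (y + r) S - y m = y (S - m) + r S, so the leading monomial is never
  produced.\<close>

fun difference :: "(nat \<times> trit) list \<Rightarrow> nat list \<Rightarrow> poly3" where
  "difference \<rho> [] = []"
| "difference \<rho> (i # m) = times_var i (difference \<rho> m) @ scale (lookup Z0 \<rho> i) (shift \<rho> m)"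

fun poly_difference :: "(nat \<times> trit) list \<Rightarrow> poly3 \<Rightarrow> poly3" where
  "poly_difference \<rho> [] = []"
| "poly_difference \<rho> ((c, m) # p) = scale c (difference \<rho> m) @ poly_difference \<rho> p"

lemma scale_sum: "(\<Sum>(c, m)\<leftarrow>scale t p. of_trit c * f m) = of_trit t * (\<Sum>(c, m)\<leftarrow>p. of_trit c * f m)"
  by (induction t p rule: scale.induct) (auto simp: algebra_simps)

lemma eval_scale: "eval_poly (scale t p) y = of_trit t * eval_poly p y"
  unfolding eval_poly_def by (rule scale_sum)

lemma eval_append: "eval_poly (p @ q) y = eval_poly p y + eval_poly q y"
  by (simp add: eval_poly_def)

lemma eval_times_var: "eval_poly (times_var i p) y = y i * eval_poly p y"
  by (induction i p rule: times_var.induct) (auto simp: eval_poly_def algebra_simps)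

lemma eval_shift: "eval_poly (shift \<rho> m) y = prod_list (map (\<lambda>i. y i + of_trit (lookup Z0 \<rho> i)) m)"
  by (induction m) (simp_all add: eval_append eval_scale eval_times_var algebra_simps,
      simp add: eval_poly_def)

lemma eval_difference:
  "eval_poly (difference \<rho> m) y =
    prod_list (map (\<lambda>i. y i + of_trit (lookup Z0 \<rho> i)) m) - prod_list (map y m)"
proof (induction m)
  case Nil then show ?case by (simp add: eval_poly_def)
next
  case (Cons i m)
  have "eval_poly (difference \<rho> (i # m)) y = y i * eval_poly (difference \<rho> m) y +
      of_trit (lookup Z0 \<rho> i) * eval_poly (shift \<rho> m) y"
    by (simp add: eval_append eval_scale eval_times_var)
  then show ?case unfolding Cons.IH eval_shift by (simp add: algebra_simps)
qed

lemma eval_poly_difference: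
  "eval_poly (poly_difference \<rho> p) y = eval_poly p (\<lambda>i. y i + of_trit (lookup Z0 \<rho> i)) - eval_poly p y"
proof (induction p)
  case Nil then show ?case by (simp add: eval_poly_def)
next
  case (Cons x p)
  obtain c m where x: "x = (c, m)" by (cases x)
  have "eval_poly (poly_difference \<rho> (x # p)) y =
      of_trit c * (prod_list (map (\<lambda>i. y i + of_trit (lookup Z0 \<rho> i)) m) - prod_list (map y m)) +
      eval_poly (poly_difference \<rho> p) y"
    by (simp add: x eval_append eval_scale eval_difference)
  moreover have "eval_poly (x # p) z = of_trit c * prod_list (map z m) + eval_poly p z" for z
    by (simp add: x eval_poly_def)
  ultimately show ?case by (simp add: Cons.IH right_diff_distrib)
qed

type_synonym obstruction_row = "(nat \<times> nat) \<times> (nat \<times> trit) list \<times> trit"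

text \<open>A sparse counterpart of \<open>flow\<close>: the coordinates serve as keys of a formal
  sum, to be tested by \<open>vanishes\<close>.\<close>

fun edge_flow :: "nat \<Rightarrow> obstruction_row list \<Rightarrow> (trit \<times> nat) list" where
  "edge_flow v [] = []"
| "edge_flow v ((e, \<rho>, \<kappa>) # rs) = (case incidence (\<lambda>x. x) v e of
      Z0 \<Rightarrow> edge_flow v rs
    | P1 \<Rightarrow> map (\<lambda>(k, t). (t, k)) \<rho> @ edge_flow v rs
    | M1 \<Rightarrow> map (\<lambda>(k, t). (tneg t, k)) \<rho> @ edge_flow v rs)"

fun sum_trits :: "obstruction_row list \<Rightarrow> trit" where
  "sum_trits [] = Z0"
| "sum_trits ((e, \<rho>, \<kappa>) # rs) = tadd \<kappa> (sum_trits rs)"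

text \<open>To every vertex \<open>v\<close> belongs a polynomial function \<open>\<Phi> v\<close> on \<open>\<int>\<^sub>3\<^sup>S\<close> modulo the cuts, in
  coordinates in which the edge \<open>ab\<close> has class \<open>\<rho>\<close>, such that a step along \<open>ab\<close> changes
  \<open>\<Phi> a - \<Phi> b\<close> by the constant \<open>\<kappa>\<close>. Testing the chain of the star of every \<open>v\<close> against \<open>\<Phi> v\<close>
  shows that the sum of the \<open>\<kappa>\<close> annihilates the common color profile.\<close>

definition obstructs ::
  "(nat \<times> nat) list \<Rightarrow> nat list \<Rightarrow> obstruction_row list \<Rightarrow> (nat \<times> poly3) list \<Rightarrow> bool"
where
  "obstructs es vs R \<Phi> \<longleftrightarrow> map fst R = es \<and>
     list_all (\<lambda>(e, \<rho>, \<kappa>). distinct (map fst \<rho>)) R \<and>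
     list_all (\<lambda>v. vanishes (edge_flow v R)) vs \<and>
     list_all (\<lambda>((a, b), \<rho>, \<kappa>). vanishes ((tneg \<kappa>, []) #
       poly_difference \<rho> (lookup [] \<Phi> a) @ scale M1 (poly_difference \<rho> (lookup [] \<Phi> b)))) R \<and>
     sum_trits R = P1"

lemma lookup_sum:
  assumes "distinct (map fst \<rho>)"
  shows "(\<Sum>(k, t)\<leftarrow>\<rho>. of_trit t * (if k = j then 1 else 0)) = of_trit (lookup Z0 \<rho> j)"
  using assms
proof (induction \<rho>)
  case (Cons x \<rho>)
  obtain k t where x: "x = (k, t)" by (cases x)
  have "lookup Z0 \<rho> j = Z0" if "j \<notin> fst ` set \<rho>"
    using that by (induction \<rho>) (auto split: if_splits)
  then show ?case using Cons by (auto simp: x)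
qed simp

lemma edge_flow_sum:
  assumes "list_all (\<lambda>(e, \<rho>, \<kappa>). distinct (map fst \<rho>)) R"
  shows "(\<Sum>(t, k)\<leftarrow>edge_flow v R. of_trit t * (if k = j then 1 else 0)) =
    (\<Sum>r\<leftarrow>R. of_trit (incidence (\<lambda>x. x) v (fst r)) * of_trit (lookup Z0 (fst (snd r)) j))"
  using assms
proof (induction v R rule: edge_flow.induct)
  case (2 v e \<rho> \<kappa> rs)
  have pos: "(\<Sum>(t, k)\<leftarrow>map (\<lambda>(k, t). (t, k)) \<rho>. of_trit t * (if k = j then 1 else 0)) =
      of_trit (lookup Z0 \<rho> j)"
  proof -
    have "(\<Sum>(t, k)\<leftarrow>map (\<lambda>(k, t). (t, k)) \<rho>. of_trit t * (if k = j then 1 else 0)) =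
        (\<Sum>(k, t)\<leftarrow>\<rho>. of_trit t * (if k = j then 1 else 0))"
      by (induction \<rho>) auto
    then show ?thesis using lookup_sum[of \<rho> j] 2(4) by simp
  qed
  have "(\<Sum>(t, k)\<leftarrow>map (\<lambda>(k, t). (tneg t, k)) \<rho>. of_trit t * (if k = j then 1 else 0)) =
      - (\<Sum>(k, t)\<leftarrow>\<rho>. of_trit t * (if k = j then 1 else 0))"
    by (induction \<rho>) auto
  then have neg: "(\<Sum>(t, k)\<leftarrow>map (\<lambda>(k, t). (tneg t, k)) \<rho>. of_trit t * (if k = j then 1 else 0)) =
      - of_trit (lookup Z0 \<rho> j)"
    using lookup_sum[of \<rho> j] 2(4) by simp
  show ?case
    using 2 pos neg by (cases "incidence (\<lambda>x. x) v e") (simp_all del: incidence.simps)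
qed simp

lemma sum_trits_sum: "of_trit (sum_trits R) = (\<Sum>r\<leftarrow>R. of_trit (snd (snd r)))"
  by (induction R rule: sum_trits.induct) simp_all

context two_connected_graph begin

text \<open>Membership in \<open>M_class\<close> supplies an unknown realization, so everything
  carries the signs from \<open>realization_signs\<close>. They cancel in the end because each
  enters twice, through the star relation and through the step along an edge of that color.\<close>

lemma obstruction:
  assumes vs: "V = set vs" "distinct vs" and es: "E = edges_of es" "distinct es"
    "\<forall>e\<in>set es. fst e < snd e" and ob: "obstructs es vs R \<Phi>"
  shows "M \<notin> M_class TYPE(3)"
proof
  assume "M \<in> M_class TYPE(3)"
  then obtain A b W c where A: "tu_realization M A"
    and W: "W = (reduction (row_lattice (rank M) (ground M) A) :: (nat set \<Rightarrow> 3) set)"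
    and sol: "is_solution (ground M) W b" and c: "c dvd 1"
    and prof: "\<forall>s\<in>ground M. color_profile (albanese (ground M) W) (b s) s = c"
    unfolding M_class_def by blast
  have ground: "ground M = E" by (simp add: coordinate_matroid_def)
  note W = W[unfolded ground] and sol = sol[unfolded ground] and prof = prof[unfolded ground]
  have ob1: "map fst R = es" and ob2: "list_all (\<lambda>(e, \<rho>, \<kappa>). distinct (map fst \<rho>)) R"
    and ob3: "\<And>v. v \<in> V \<Longrightarrow> vanishes (edge_flow v R)"
    and ob4: "list_all (\<lambda>((a, b), \<rho>, \<kappa>). vanishes ((tneg \<kappa>, []) #
       poly_difference \<rho> (lookup [] \<Phi> a) @ scale M1 (poly_difference \<rho> (lookup [] \<Phi> b)))) R"
    and ob5: "sum_trits R = P1"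
    using ob vs(1) unfolding obstructs_def by (auto simp: list_all_iff)
  obtain \<sigma> :: "nat set \<Rightarrow> int" where pm: "\<forall>e\<in>E. \<sigma> e = 1 \<or> \<sigma> e = -1"
    and stars: "\<forall>v\<in>V. \<exists>z. \<forall>e\<in>E. row A z e = \<sigma> e * coboundary (\<lambda>x. if x = v then 1 else 0) e"
    and rows: "\<forall>z. \<exists>\<phi>. \<forall>e\<in>E. row A z e = \<sigma> e * coboundary \<phi> e"
    by (rule realization_signs[OF A])
  define sg :: "nat set \<Rightarrow> 3" where "sg = (\<lambda>e. of_int (\<sigma> e))"
  have sg2: "sg e * sg e = 1" if "e \<in> E" for e using pm that by (auto simp: sg_def)
  have W_row: "w \<in> W \<longleftrightarrow> (\<exists>z. w = (\<lambda>s. if s \<in> E then of_int (row A z s) else 0))" for w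
  proof -
    have "w \<in> W \<longleftrightarrow> (\<exists>z. w = (\<lambda>s. of_int (if s \<in> E then row A z s else 0)))"
    proof
      assume "w \<in> W"
      then obtain u where u: "w = (\<lambda>s. of_int (u s))" "u \<in> row_lattice (rank M) E A"
        unfolding W reduction_def by (rule imageE)
      from u(2) obtain z where "u = (\<lambda>s. if s \<in> E then \<Sum>i<rank M. z i * A i s else 0)"
        unfolding row_lattice_def by (elim CollectE exE conjE)
      then have "w = (\<lambda>s. of_int (if s \<in> E then row A z s else 0))"
        unfolding u(1) row_def[OF A] by simp
      then show "\<exists>z. w = (\<lambda>s. of_int (if s \<in> E then row A z s else 0))"
        by (rule exI[of _ z])
    next
      assume "\<exists>z. w = (\<lambda>s. of_int (if s \<in> E then row A z s else 0))"
      then obtain z where z: "w = (\<lambda>s. of_int (if s \<in> E then row A z s else 0))" by (rule exE)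
      have "(\<lambda>s. if s \<in> E then row A z s else 0) \<in> row_lattice (rank M) E A"
        unfolding row_lattice_def row_def[OF A] by (intro CollectI exI[of _ z]) simp
      then show "w \<in> W" unfolding W reduction_def z by (rule image_eqI[OF refl])
    qed
    moreover have "(\<lambda>s. of_int (if s \<in> E then row A z s else 0)) =
        (\<lambda>s. if s \<in> E then of_int (row A z s) else (0 :: 3))" for z by (rule ext) simp
    ultimately show ?thesis by simp
  qed
  define ed where "ed = (\<lambda>r :: obstruction_row. edge_set (fst r))"
  have E_R: "E = set (map ed R)" unfolding es(1) edges_of_eq ob1[symmetric] by (simp add: ed_def image_image)
  have R_lt: "fst (fst r) < snd (fst r)" if "r \<in> set R" for r
    using es(3) that unfolding ob1[symmetric] by simp
  have distR: "distinct (map ed R)"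
  proof -
    have "inj_on edge_set (set (map fst R))"
      using edge_set_inj es(3) unfolding ob1 by (intro inj_onI) blast
    then have "distinct (map edge_set (map fst R))"
      unfolding distinct_map[of edge_set] using es(2) ob1 by simp
    then show ?thesis by (simp add: ed_def comp_def)
  qed
  have ed_ends: "Min (ed r) = fst (fst r)" "Max (ed r) = snd (fst r)" if "r \<in> set R" for r
    using R_lt[OF that] by (cases "fst r"; simp add: ed_def)+
  have ends_V: "fst (fst r) \<in> V" "snd (fst r) \<in> V" if "r \<in> set R" for r
    using edge_ends(1,2)[of "ed r"] ed_ends[OF that] that by (simp_all add: E_R)
  have ends_vs: "\<forall>((a, b), _)\<in>set R. a \<in> set vs \<and> b \<in> set vs"
    using ends_V vs(1) by (simp add: case_prod_beta)
  have sumE: "(\<Sum>s\<in>E. g s) = (\<Sum>r\<leftarrow>R. g (ed r))" for g :: "nat set \<Rightarrow> 3"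
    unfolding E_R sum.distinct_set_conv_list[OF distR] by (simp add: comp_def)
  \<comment> \<open>Twisting the flow by the signs makes it vanish on the rows of \<open>A\<close>
    modulo 3 instead of on the cuts.\<close>
  define q where "q = (\<lambda>(x :: nat set \<Rightarrow> 3) k. \<Sum>r\<leftarrow>R. sg (ed r) * x (ed r) * of_trit (lookup Z0 (fst (snd r)) k))"
  have q_add: "q (x + y) k = q x k + q y k" for x y k
    by (simp add: q_def algebra_simps sum_list_addf)
  have q_W: "q w k = 0" if w: "w \<in> W" for w k
  proof -
    obtain z where z: "w = (\<lambda>s. if s \<in> E then of_int (row A z s) else 0)" using w W_row by blast
    obtain \<phi> where \<phi>: "\<forall>e\<in>E. row A z e = \<sigma> e * coboundary \<phi> e" using rows by blast
    have "q w k = (\<Sum>r\<leftarrow>R. (of_int (\<phi> (fst (fst r))) - of_int (\<phi> (snd (fst r)))) * of_trit (lookup Z0 (fst (snd r)) k))"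
      unfolding q_def
    proof (rule arg_cong[of _ _ sum_list], rule map_cong)
      fix r assume r: "r \<in> set R"
      then have eE: "ed r \<in> E" by (simp add: E_R)
      have "w (ed r) = sg (ed r) * (of_int (\<phi> (fst (fst r))) - of_int (\<phi> (snd (fst r))))"
        using eE \<phi> ed_ends[OF r] by (simp add: z sg_def coboundary_def)
      then show "sg (ed r) * w (ed r) * of_trit (lookup Z0 (fst (snd r)) k) =
          (of_int (\<phi> (fst (fst r))) - of_int (\<phi> (snd (fst r)))) * of_trit (lookup Z0 (fst (snd r)) k)"
        using sg2[OF eE] by (simp add: mult.assoc[symmetric])
    qed simp
    also have "\<dots> = 0"
    proof (rule pairing_vertices[OF vs(2), where \<pi> = "\<lambda>x. x" and \<phi> = "\<lambda>x. of_int (\<phi> x)"])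
      show "\<forall>((a, b), _)\<in>set R. a \<in> set vs \<and> b \<in> set vs" by (rule ends_vs)
      fix v assume "v \<in> set vs"
      then have "v \<in> V" by (simp add: vs(1))
      from vanishes_sum[OF ob3[OF this]]
      have "(\<Sum>(t, l)\<leftarrow>edge_flow v R. of_trit t * (if l = k then 1 else 0)) = 0" .
      then show "(\<Sum>r\<leftarrow>R. of_trit (incidence (\<lambda>x. x) v (fst r)) * of_trit (lookup Z0 (fst (snd r)) k)) = 0"
        unfolding edge_flow_sum[OF ob2] .
    qed
    finally show ?thesis .
  qed
  have q_basis: "q (basis_vector (ed r)) k = sg (ed r) * of_trit (lookup Z0 (fst (snd r)) k)"
    if r: "r \<in> set R" for r k
  proof -
    have "distinct R" using distR by (simp add: distinct_map)
    have inj: "inj_on ed (set R)" using distR by (simp add: distinct_map)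
    have "q (basis_vector (ed r)) k =
        (\<Sum>r'\<in>set R. sg (ed r') * basis_vector (ed r) (ed r') * of_trit (lookup Z0 (fst (snd r')) k))"
      by (simp add: q_def sum.distinct_set_conv_list[OF \<open>distinct R\<close>])
    also have "\<dots> = (\<Sum>r'\<in>set R. if r' = r then sg (ed r') * of_trit (lookup Z0 (fst (snd r')) k) else 0)"
    proof (rule sum.cong)
      fix r' assume "r' \<in> set R"
      then have "ed r' = ed r \<longleftrightarrow> r' = r" by (rule inj_on_eq_iff[OF inj _ r])
      then show "sg (ed r') * basis_vector (ed r) (ed r') * of_trit (lookup Z0 (fst (snd r')) k) =
          (if r' = r then sg (ed r') * of_trit (lookup Z0 (fst (snd r')) k) else 0)"
        by (simp add: basis_vector_def)
    qed simp
    finally show ?thesis using r by simp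
  qed
  define P where "P = (\<lambda>v. eval_poly (lookup [] \<Phi> v))"
  have step: "(P (fst (fst r)) (\<lambda>k. y k + sg (ed r) * of_trit (lookup Z0 (fst (snd r)) k)) - P (fst (fst r)) y) -
      (P (snd (fst r)) (\<lambda>k. y k + sg (ed r) * of_trit (lookup Z0 (fst (snd r)) k)) - P (snd (fst r)) y) =
      sg (ed r) * of_trit (snd (snd r))" if r: "r \<in> set R" for r y
  proof -
    obtain a b \<rho> \<kappa> where abr: "r = ((a, b), \<rho>, \<kappa>)"
      by (cases r; cases "fst r") auto
    have "vanishes ((tneg \<kappa>, []) #
       poly_difference \<rho> (lookup [] \<Phi> a) @ scale M1 (poly_difference \<rho> (lookup [] \<Phi> b)))"
      using ob4 r abr by (auto simp: list_all_iff)
    note van = this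
    have "- of_trit \<kappa> + (eval_poly (poly_difference \<rho> (lookup [] \<Phi> a)) y -
        eval_poly (poly_difference \<rho> (lookup [] \<Phi> b)) y) = 0" for y
      using vanishes_sum[OF van, of "\<lambda>m. prod_list (map y m)"] by (simp add: eval_poly_def scale_sum)
    then have "eval_poly (poly_difference \<rho> (lookup [] \<Phi> a)) y -
        eval_poly (poly_difference \<rho> (lookup [] \<Phi> b)) y = of_trit \<kappa>" for y
      using neg_eq_iff_add_eq_0[of "- of_trit \<kappa>"] by simp
    then have *: "(P a (\<lambda>k. y k + of_trit (lookup Z0 \<rho> k)) - P a y) -
        (P b (\<lambda>k. y k + of_trit (lookup Z0 \<rho> k)) - P b y) = of_trit \<kappa>" for y
      unfolding eval_poly_difference P_def .
    have "\<sigma> (ed r) = 1 \<or> \<sigma> (ed r) = -1" using pm r by (simp add: E_R)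
    then consider "sg (ed r) = 1" | "sg (ed r) = -1" by (auto simp: sg_def)
    then show ?thesis
    proof cases
      case 1 then show ?thesis using *[of y] by (simp add: abr)
    next
      \<comment> \<open>With sign -1 the step runs backwards, so the polynomial identity is applied
        at the point shifted by - \<rho>.\<close>
      case 2 then show ?thesis using *[of "\<lambda>k. y k - of_trit (lookup Z0 \<rho> k)"] by (simp add: abr algebra_simps)
    qed
  qed
  let ?G = "albanese E W"
  have fin: "finite (arcs ?G)" by (rule finite_arcs_albanese[OF finite_E])
  \<comment> \<open>\<open>P v\<close> descends to cosets through a chosen representative; the
    choice is harmless because \<open>q\<close> is constant on cosets.\<close>
  define h where "h = (\<lambda>v X. P v (q (SOME x. x \<in> X)))"
  have W0: "0 \<in> W" unfolding W_row by (intro exI[of _ "\<lambda>_. 0"]) (auto simp: row_def[OF A])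
  have h: "h v (x +o W) = P v (q x)" for v x
  proof -
    have "x \<in> x +o W" using W0 by (auto simp: elt_set_plus_def)
    then have "(SOME y. y \<in> x +o W) \<in> x +o W"
      by (rule someI[of "\<lambda>y. y \<in> x +o W"])
    then obtain w where "w \<in> W" "(SOME y. y \<in> x +o W) = x + w" by (auto simp: elt_set_plus_def)
    then have "q (SOME y. y \<in> x +o W) = q x" using q_add q_W by (intro ext) simp
    then show ?thesis by (simp add: h_def)
  qed
  define st where "st = (\<lambda>v s. if s \<in> E then sg s * coboundary (\<lambda>x. if x = v then 1 else 0) s else (0 :: 3))"
  have st_W: "st v \<in> W" if v: "v \<in> V" for v
  proof -
    obtain z where z: "\<forall>e\<in>E. row A z e = \<sigma> e * coboundary (\<lambda>x. if x = v then 1 else 0) e"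
      using bspec[OF stars v] by (rule exE)
    have "st v s = (if s \<in> E then of_int (row A z s) else 0)" for s
    proof (cases "s \<in> E")
      case True
      then have "row A z s = \<sigma> s * coboundary (\<lambda>x. if x = v then 1 else 0) s" using z by (rule bspec[rotated])
      then show ?thesis using True by (simp add: st_def sg_def coboundary_indicator)
    qed (simp add: st_def)
    then have "st v = (\<lambda>s. if s \<in> E then of_int (row A z s) else 0)" by (rule ext)
    then show ?thesis unfolding W_row by (rule exI[of _ z])
  qed
  have supp: "snd e = s" if "s \<in> E" "b s e \<noteq> 0" for s e
    using sol[unfolded is_solution_def, THEN conjunct1, THEN bspec, OF that(1), THEN conjunct2,
        THEN spec, THEN mp, OF that(2)] .
  \<comment> \<open>Only the stars of the two ends contain the color of a given edge. Their
    contributions combine to the growth of the difference of the two functions, a constant that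
    depends on the color and not on the position of the edge.\<close>
  have local: "b s e * (\<Sum>v\<in>V. st v s * (h v (head ?G e) - h v (tail ?G e))) =
      b s e * of_trit (snd (snd r))" if r: "r \<in> set R" "s = ed r" and e: "e \<in> arcs ?G" for s e r
  proof (cases "b s e = 0")
    case False
    have sE: "s \<in> E" using r by (simp add: E_R)
    have "snd e = s" by (rule supp[OF sE False])
    then obtain x where x: "e = (x +o W, s)" using e by (cases e) (auto simp: albanese_def)
    have tail: "h v (tail ?G e) = P v (q x)" for v by (simp add: x albanese_def h)
    have head: "h v (head ?G e) = P v (\<lambda>k. q x k + sg (ed r) * of_trit (lookup Z0 (fst (snd r)) k))" for v
    proof -
      have "head ?G e = (basis_vector s + x) +o W" by (simp add: x albanese_def set_plus_rearrange2)
      moreover have "q (basis_vector s + x) = (\<lambda>k. q x k + sg (ed r) * of_trit (lookup Z0 (fst (snd r)) k))"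
        using q_basis[OF r(1)] r(2) by (intro ext) (simp add: q_add)
      ultimately show ?thesis by (simp add: h)
    qed
    define D where "D = (\<lambda>v. h v (head ?G e) - h v (tail ?G e))"
    have "(\<Sum>v\<in>V. st v s * D v) = sg s * (\<Sum>v\<in>V. D v * coboundary (\<lambda>x. if x = v then 1 else 0) s)"
      using sE by (simp add: st_def sum_distrib_left algebra_simps)
    also have "\<dots> = sg s * coboundary D s" by (simp add: coboundary_indicator_sum[OF sE])
    also have "coboundary D s = sg s * of_trit (snd (snd r))"
      using step[OF r(1), of "q x"] ed_ends[OF r(1)] r(2)
      by (simp add: coboundary_def D_def head tail)
    also have "sg s * \<dots> = of_trit (snd (snd r))" using sg2[OF sE] by (simp add: mult.assoc[symmetric])
    finally show ?thesis by (simp add: D_def)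
  qed simp
  have profile: "(\<Sum>e\<in>arcs ?G. b s e) = c" if s: "s \<in> E" for s
  proof -
    have "(\<Sum>e\<in>arcs ?G. b s e) = (\<Sum>e\<in>arcs ?G. b s e * basis_vector (snd e) s)"
    proof (rule sum.cong)
      fix e show "b s e = b s e * basis_vector (snd e) s"
        using supp[OF s, of e] by (cases "b s e = 0") (simp_all add: basis_vector_def)
    qed simp
    then show ?thesis using prof s by (simp add: color_profile_def)
  qed
  \<comment> \<open>The closed chain of each star is paired with the function of its center. The
    total is 0 vertex by vertex; regrouped by colors it is \<open>c\<close> times the sum of the
    \<kappa>.\<close>
  have "0 = (\<Sum>v\<in>V. \<Sum>e\<in>arcs ?G. (\<Sum>s\<in>E. st v s * b s e) * (h v (head ?G e) - h v (tail ?G e)))"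
  proof -
    have "closed_chain ?G (\<lambda>e. \<Sum>s\<in>E. st v s * b s e)" if "v \<in> V" for v
      using sol[unfolded is_solution_def, THEN conjunct2, THEN bspec, OF st_W[OF that]] .
    from closed_chain_pairing[OF finite_E this] show ?thesis by simp
  qed
  also have "\<dots> = (\<Sum>v\<in>V. \<Sum>e\<in>arcs ?G. \<Sum>s\<in>E. b s e * (st v s * (h v (head ?G e) - h v (tail ?G e))))"
    by (simp only: sum_distrib_right ac_simps)
  also have "\<dots> = (\<Sum>s\<in>E. \<Sum>e\<in>arcs ?G. b s e * (\<Sum>v\<in>V. st v s * (h v (head ?G e) - h v (tail ?G e))))"
  proof -
    have "(\<Sum>v\<in>V. \<Sum>e\<in>X. \<Sum>s\<in>E. f v e s) = (\<Sum>s\<in>E. \<Sum>e\<in>X. \<Sum>v\<in>V. f v e s)"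
      for f :: "_ \<Rightarrow> _ \<Rightarrow> _ \<Rightarrow> 3" and X :: "((nat set \<Rightarrow> 3) set \<times> nat set) set"
    proof -
      have "(\<Sum>v\<in>V. \<Sum>e\<in>X. \<Sum>s\<in>E. f v e s) = (\<Sum>e\<in>X. \<Sum>v\<in>V. \<Sum>s\<in>E. f v e s)"
        by (rule sum.swap)
      also have "\<dots> = (\<Sum>e\<in>X. \<Sum>s\<in>E. \<Sum>v\<in>V. f v e s)"
        by (intro sum.cong refl sum.swap)
      also have "\<dots> = (\<Sum>s\<in>E. \<Sum>e\<in>X. \<Sum>v\<in>V. f v e s)" by (rule sum.swap)
      finally show ?thesis .
    qed
    then show ?thesis by (simp add: sum_distrib_left)
  qed
  also have "\<dots> = (\<Sum>r\<leftarrow>R. \<Sum>e\<in>arcs ?G. b (ed r) e * (\<Sum>v\<in>V. st v (ed r) * (h v (head ?G e) - h v (tail ?G e))))"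
    by (rule sumE)
  also have "\<dots> = (\<Sum>r\<leftarrow>R. c * of_trit (snd (snd r)))"
  proof (rule arg_cong[of _ _ sum_list], rule map_cong)
    fix r assume r: "r \<in> set R"
    have "(\<Sum>e\<in>arcs ?G. b (ed r) e * (\<Sum>v\<in>V. st v (ed r) * (h v (head ?G e) - h v (tail ?G e)))) =
        (\<Sum>e\<in>arcs ?G. b (ed r) e * of_trit (snd (snd r)))"
      by (rule sum.cong) (simp_all add: local[OF r])
    also have "\<dots> = c * of_trit (snd (snd r))"
      using profile[of "ed r"] r by (simp add: E_R flip: sum_distrib_right)
    finally show "(\<Sum>e\<in>arcs ?G. b (ed r) e * (\<Sum>v\<in>V. st v (ed r) * (h v (head ?G e) - h v (tail ?G e)))) =
        c * of_trit (snd (snd r))" .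
  qed simp
  also have "\<dots> = c * of_trit (sum_trits R)" by (simp add: sum_trits_sum sum_list_const_mult)
  also have "\<dots> = c" by (simp add: ob5)
  finally have "(0 :: 3) dvd 1" using c by simp
  then show False by simp
qed

end

section \<open>Checking 2-connectedness\<close>

fun spread :: "(nat \<times> nat) list \<Rightarrow> nat list \<Rightarrow> nat list" where
  "spread [] Z = Z"
| "spread ((a, b) # es) Z = spread es (if a \<in> set Z then (if b \<in> set Z then Z else b # Z)
     else if b \<in> set Z then a # Z else Z)"

text \<open>Three passes over the edge list suffice for the six graphs and for their subgraphs
  without one vertex.\<close>

fun reaches :: "(nat \<times> nat) list \<Rightarrow> nat list \<Rightarrow> bool" where
  "reaches es [] = False"
| "reaches es (x # xs) = list_all (\<lambda>y. y \<in> set (spread (es @ es @ es) [x])) (x # xs)"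

definition graph_check :: "(nat \<times> nat) list \<Rightarrow> nat list \<Rightarrow> bool" where
  "graph_check es vs \<longleftrightarrow> distinct es \<and> distinct vs \<and>
     list_all (\<lambda>(a, b). a < b \<and> a \<in> set vs \<and> b \<in> set vs) es \<and> reaches es vs \<and>
     list_all (\<lambda>v. reaches (filter (\<lambda>(a, b). a \<noteq> v \<and> b \<noteq> v) es) (filter (\<lambda>u. u \<noteq> v) vs) \<and>
       list_ex (\<lambda>(a, b). a = v \<or> b = v) es) vs"

text \<open>Spreading cannot leave a set that no edge leaves. Only this bound matters for soundness:
  too few passes could make a check fail, but not succeed wrongly.\<close>

lemma spread_subset:
  "\<forall>(a, b)\<in>set es. a \<in> S \<longleftrightarrow> b \<in> S \<Longrightarrow> set Z \<subseteq> S \<Longrightarrow> set (spread es Z) \<subseteq> S"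
proof (induction es Z rule: spread.induct)
  case (2 a b es Z)
  have "set (if a \<in> set Z then (if b \<in> set Z then Z else b # Z)
      else if b \<in> set Z then a # Z else Z) \<subseteq> S" using 2(2,3) by auto
  then show ?case using 2(1,2) by simp
qed simp

text \<open>A closed set that contains the starting vertex contains all vertices; applied to the
  complement, this shows that a closed set with some vertex contains the starting vertex.\<close>

lemma reaches_closed:
  assumes "reaches es vs" "\<forall>(a, b)\<in>set es. a \<in> S \<longleftrightarrow> b \<in> S" "x \<in> set vs" "x \<in> S" "y \<in> set vs"
  shows "y \<in> S"
proof -
  obtain r rs where vs: "vs = r # rs" using assms(3) by (cases vs) auto
  have all: "z \<in> C" if "z \<in> set vs" "r \<in> C" "\<forall>(a, b)\<in>set es. a \<in> C \<longleftrightarrow> b \<in> C" for C z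
  proof -
    have "z \<in> set (spread (es @ es @ es) [r])"
      using assms(1) that(1) unfolding vs reaches.simps list_all_iff by blast
    moreover have "set (spread (es @ es @ es) [r]) \<subseteq> C"
      by (rule spread_subset) (use that(2,3) in auto)
    ultimately show ?thesis by blast
  qed
  have "r \<in> S"
  proof (rule ccontr)
    assume "r \<notin> S"
    moreover have "\<forall>(a, b)\<in>set es. a \<in> - S \<longleftrightarrow> b \<in> - S" using assms(2) by auto
    ultimately have "x \<in> - S" using all[OF assms(3), of "- S"] by simp
    then show False using assms(4) by simp
  qed
  then show ?thesis by (rule all[OF assms(5) _ assms(2)])
qed

lemma graph_check_imp_graph:
  assumes "graph_check es vs"
  shows "two_connected_graph (set vs) (edges_of es)"
proof -
  have es: "\<And>a b. (a, b) \<in> set es \<Longrightarrow> a < b \<and> a \<in> set vs \<and> b \<in> set vs"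
    and r1: "reaches es vs"
    and r2: "\<And>v. v \<in> set vs \<Longrightarrow> reaches (filter (\<lambda>(a, b). a \<noteq> v \<and> b \<noteq> v) es) (filter (\<lambda>u. u \<noteq> v) vs)"
    and r3: "\<And>v. v \<in> set vs \<Longrightarrow> \<exists>(a, b)\<in>set es. a = v \<or> b = v"
    using assms unfolding graph_check_def list_all_iff list_ex_iff by (blast, blast, blast, blast)
  have closed: "a \<in> Z \<longleftrightarrow> b \<in> Z" if "Min {a, b} \<in> Z \<longleftrightarrow> Max {a, b} \<in> Z" "(a, b) \<in> set es" for a b Z
    using that(1) es[OF that(2)] by (simp add: min_def max_def)
  show ?thesis
  proof
    show "finite (set vs)" by simp
    show "set vs \<noteq> {}" using r1 by (cases vs) simp_all
  next
    fix e assume "e \<in> edges_of es"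
    then show "\<exists>a\<in>set vs. \<exists>b\<in>set vs. a < b \<and> e = {a, b}"
      unfolding edges_of_def using es by auto
  next
    fix Z x y assume cl: "\<And>e. e \<in> edges_of es \<Longrightarrow> Min e \<in> Z \<longleftrightarrow> Max e \<in> Z"
      and x: "x \<in> set vs \<inter> Z" and y: "y \<in> set vs"
    have "a \<in> Z \<longleftrightarrow> b \<in> Z" if "(a, b) \<in> set es" for a b
      by (rule closed[OF cl that]) (use that in \<open>auto simp: edges_of_def\<close>)
    then have "\<forall>(a, b)\<in>set es. a \<in> Z \<longleftrightarrow> b \<in> Z" by blast
    then show "y \<in> Z" using reaches_closed[OF r1, of Z x y] x y by blast
  next
    fix v Z x y assume v: "v \<in> set vs"
      and cl: "\<And>e. e \<in> edges_of es \<Longrightarrow> v \<notin> e \<Longrightarrow> Min e \<in> Z \<longleftrightarrow> Max e \<in> Z"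
      and x: "x \<in> set vs \<inter> Z - {v}" and y: "y \<in> set vs - {v}"
    have "a \<in> Z \<longleftrightarrow> b \<in> Z" if "(a, b) \<in> set es" "a \<noteq> v" "b \<noteq> v" for a b
      by (rule closed[OF cl that(1)]) (use that in \<open>auto simp: edges_of_def\<close>)
    then have "\<forall>(a, b)\<in>set (filter (\<lambda>(a, b). a \<noteq> v \<and> b \<noteq> v) es). a \<in> Z \<longleftrightarrow> b \<in> Z" by auto
    then show "y \<in> Z" using reaches_closed[OF r2[OF v], of Z x y] x y by simp
  next
    fix v assume "v \<in> set vs"
    then show "\<exists>e\<in>edges_of es. v \<in> e" using r3[of v] unfolding edges_of_def by auto
  qed
qed

text \<open>Reduces a graph to four finite checks: 2-connectedness, an obstruction, and for each
  edge a certificate for its deletion and one for its contraction.\<close>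

lemma excluded_minor_certified:
  assumes gc: "graph_check es vs" and ob: "obstructs es vs R \<Phi>"
    and del: "list_all2 (\<lambda>e. certifies es vs e (\<lambda>x. x)) es Ds"
    and con: "list_all2 (\<lambda>e. certifies es vs e (merge e)) es Cs"
  shows "excluded_minor TYPE(3) (cycle_matroid (V, edges_of es))"
    and "rank (cycle_matroid (V, edges_of es)) = length vs - 1"
proof -
  interpret G: two_connected_graph "set vs" "edges_of es" by (rule graph_check_imp_graph[OF gc])
  have dist: "distinct es" "distinct vs" and lt: "\<forall>e\<in>set es. fst e < snd e"
    and ends: "\<forall>e\<in>set es. fst e \<in> set vs \<and> snd e \<in> set vs"
    using gc by (auto simp: graph_check_def list_all_iff)
  have "\<exists>a b. a \<noteq> b \<and> e = {a, b}" if "e \<in> edges_of es" for e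
    using G.edge[OF that] by (metis less_irrefl)
  then have M: "cycle_matroid (V, edges_of es) = coordinate_matroid (edges_of es) (range coboundary)"
    by (rule cycle_matroid_eq)
  show "rank (cycle_matroid (V, edges_of es)) = length vs - 1"
    unfolding M G.rank_M using dist(2) by (simp add: distinct_card)
  show "excluded_minor TYPE(3) (cycle_matroid (V, edges_of es))"
    unfolding M excluded_minor_def
  proof (intro conjI allI impI)
    show "regular (coordinate_matroid (edges_of es) (range coboundary))" by (rule G.regular_M)
    show "coordinate_matroid (edges_of es) (range coboundary) \<notin> M_class TYPE(3)"
      by (rule G.obstruction[OF refl dist(2) refl dist(1) lt ob])
  next
    fix N assume "proper_minor N (coordinate_matroid (edges_of es) (range coboundary))"
    then show "N \<in> M_class TYPE(3)"
    proof (rule graphic.proper_minors_in_M_class[OF G.finite_E, rotated 2])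
      fix s assume "s \<in> edges_of es"
      then obtain e where e: "e \<in> set es" "s = edge_set e" unfolding edges_of_eq by blast
      then obtain i where i: "i < length es" "es ! i = e" by (auto simp: in_set_conv_nth)
      have "certifies es vs e (\<lambda>x. x) (Ds ! i)"
        using list_all2_nthD[OF del i(1)] i(2) by simp
      from certified_deletion[OF lt dist(2) ends this e(1)]
      show "solvable (edges_of es - {s}) (residue_space (range coboundary) {} (edges_of es - {s}))"
        unfolding e(2) .
      have "certifies es vs e (merge e) (Cs ! i)"
        using list_all2_nthD[OF con i(1)] i(2) by simp
      from certified_contraction[OF lt dist(2) ends this e(1)]
      show "solvable (edges_of es - {s}) (residue_space (range coboundary) {s} (edges_of es - {s}))"
        unfolding e(2) .
    qed
  qed
qed

lemmas obstructs_simps = obstructs_def edge_flow.simps poly_difference.simps difference.simps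
  shift.simps scale.simps times_var.simps lookup.simps sum_trits.simps certifies_simps

section \<open>Explicit data for the six graphs\<close>

section \<open>Certificates for the six graphs\<close>

text \<open>For almost all minors the certificate comes from a cellular embedding into the projective
  plane: its faces form a basis of the cycles modulo 3, so every edge is, up to signs, the sum of
  two elements \<open>\<epsilon>\<close> of the dual basis, and the edge lies on two faces; one face supplies the
  base point \<open>u\<close>, the other \<open>- u - \<rho>\<close>. The three exceptions, whose longer lists were found by
  linear algebra, are the deletion of \<open>69\<close> from \<open>G\<^sub>3\<close> and the contractions of \<open>18\<close> and of \<open>27\<close> in
  \<open>G\<^sub>5\<close>. The polynomials in the obstructions were also found by linear algebra.\<close>

definition K35_edges :: "(nat \<times> nat) list" where
  "K35_edges = [
     (0, 3), (0, 4), (0, 5), (0, 6), (0, 7), (1, 3), (1, 4), (1, 5), (1, 6), (1, 7), (2, 3),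
     (2, 4), (2, 5), (2, 6), (2, 7)]"

definition K35_vertices :: "nat list" where
  "K35_vertices = [0, 1, 2, 3, 4, 5, 6, 7]"

lemmas K35_defs = K35_edges_def K35_vertices_def

lemma K35_graph_check: "graph_check K35_edges K35_vertices"
  by (simp add: graph_check_def K35_defs)

text \<open>There are 8 coordinates, the dimension of the cycle space. Adding one function to all
  \<Phi> alters no difference, so one polynomial can be normalized to 0: vertex 0 is left out, and
  the other five obstructions leave out one vertex likewise. The only nonzero \<kappa> belongs to
  the edge from 1 to 6.\<close>

lemma K35_obstructs: "obstructs K35_edges K35_vertices
  [
    ((0, 3), [(0, P1)], Z0), ((0, 4), [(1, P1)], Z0), ((0, 5), [(2, P1)], Z0), ((0, 6), [(0, M1),
    (1, M1), (2, M1), (3, M1)], Z0), ((0, 7), [(3, P1)], Z0), ((1, 3), [(0, M1), (4, M1)], Z0),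
    ((1, 4), [(1, M1), (4, P1), (5, P1), (6, P1), (7, P1)], Z0), ((1, 5), [(2, M1), (5, M1)], Z0),
    ((1, 6), [(0, P1), (1, P1), (2, P1), (3, P1), (6, M1)], P1), ((1, 7), [(3, M1), (7, M1)], Z0),
    ((2, 3), [(4, P1)], Z0), ((2, 4), [(4, M1), (5, M1), (6, M1), (7, M1)], Z0), ((2, 5), [(5,
    P1)], Z0), ((2, 6), [(6, P1)], Z0), ((2, 7), [(7, P1)], Z0)]
  [
    (1, [(P1, [0, 1, 2]), (P1, [0, 1, 3]), (P1, [0, 2, 3]), (P1, [1, 2, 3])]), (2, [(P1, [0, 1,
    5]), (P1, [0, 1, 6]), (P1, [0, 1, 7]), (P1, [0, 2, 6]), (P1, [0, 2, 7]), (P1, [0, 3, 5]), (P1,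
    [0, 3, 6]), (P1, [1, 2, 4]), (P1, [1, 2, 6]), (P1, [1, 2, 7]), (P1, [1, 3, 4]), (P1, [1, 3,
    5]), (P1, [1, 3, 6]), (P1, [2, 3, 4]), (P1, [2, 3, 6])]), (3, [(P1, [1, 2, 4]), (P1, [1, 3,
    4]), (P1, [2, 3, 4])]), (4, [(M1, [0, 2, 5]), (M1, [0, 3, 4]), (M1, [2, 3, 7])]), (5, [(P1,
    [0, 1, 5]), (P1, [0, 3, 5]), (P1, [1, 3, 5])]), (6, [(P1, [0, 1, 6]), (P1, [0, 2, 6]), (P1,
    [0, 3, 6]), (P1, [1, 2, 6]), (P1, [1, 3, 6]), (P1, [2, 3, 6])]), (7, [(P1, [0, 1, 7]), (P1,
    [0, 2, 7]), (P1, [1, 2, 7])])]"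
  by (simp only: obstructs_simps K35_defs cong: if_weak_cong trit.case_cong_weak)

text \<open>Deleting an edge leaves a cycle space of dimension 7, so the leading digit of the codes
  stands for 4^7 = 16384.\<close>

lemma K35_deletions:
  "list_all2 (\<lambda>e. certifies K35_edges K35_vertices e (\<lambda>x. x))
  K35_edges [
    ([((0,5),16898,[26890]), ((0,6),18440,[26633]), ((0,7),24608,[26650]), ((0,4),21781,[22021]),
    ((1,3),16512,[26693]), ((1,4),16490,[26650]), ((2,4),27264,[26890])], [((1,5),[26633]),
    ((1,6),[21510]), ((1,7),[21541]), ((2,3),[21642]), ((2,5),[22021]), ((2,6),[25605]),
    ((2,7),[22538])]),
    ([((0,5),16898,[19049]), ((0,6),18440,[18792]), ((0,7),24608,[23208]), ((0,3),21781,[25940]),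
    ((1,4),16512,[17812]), ((1,3),16490,[19049]), ((2,3),27264,[23208])], [((1,5),[17814]),
    ((1,6),[17764]), ((1,7),[19096]), ((2,4),[19048]), ((2,5),[18792]), ((2,6),[18068]),
    ((2,7),[25940])]),
    ([((0,4),16514,[27234]), ((0,6),18440,[26918]), ((0,7),24608,[27169]), ((0,3),21589,[22041]),
    ((1,5),16896,[27170]), ((1,3),16682,[26918]), ((2,3),27264,[27234])], [((1,4),[27169]),
    ((1,6),[22041]), ((1,7),[21778]), ((2,4),[21905]), ((2,5),[21777]), ((2,6),[25890]),
    ((2,7),[23057])]),
    ([((0,4),16514,[25162]), ((0,5),16904,[25097]), ((0,7),24608,[25114]), ((0,3),20821,[20773]),
    ((1,6),18432,[26117]), ((1,3),17450,[25114]), ((2,3),27264,[25162])], [((1,4),[25097]),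
    ((1,5),[20742]), ((1,7),[20773]), ((2,4),[20869]), ((2,5),[24837]), ((2,6),[22794]),
    ((2,7),[21002])]),
    ([((0,4),16514,[22697]), ((0,5),16904,[27048]), ((0,6),18464,[22632]), ((0,3),17749,[25686]),
    ((1,7),24576,[25684]), ((1,3),20522,[22697]), ((2,3),27264,[27048])], [((1,4),[25686]),
    ((1,5),[26788]), ((1,6),[21592]), ((2,4),[22632]), ((2,5),[22100]), ((2,6),[25748]),
    ((2,7),[22696])]),
    ([((0,5),16898,[18962]), ((0,6),18440,[18982]), ((0,7),24608,[23074]), ((1,4),16426,[18982]),
    ((0,4),16533,[19025]), ((0,3),21824,[17826]), ((2,3),27264,[19025])], [((1,5),[17697]),
    ((1,6),[17689]), ((1,7),[18962]), ((2,4),[17826]), ((2,5),[18705]), ((2,6),[17954]),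
    ((2,7),[25873])]),
    ([((0,4),16512,[18856]), ((0,5),16898,[19113]), ((0,6),18440,[18792]), ((0,7),24608,[23208]),
    ((0,3),21845,[25940]), ((1,3),16426,[19113]), ((2,3),27264,[23208])], [((1,5),[17750]),
    ((1,6),[17764]), ((1,7),[19096]), ((2,4),[18004]), ((2,5),[18856]), ((2,6),[18068]),
    ((2,7),[25940])]),
    ([((0,4),16514,[25257]), ((0,5),16896,[25192]), ((0,6),18440,[26280]), ((0,7),24608,[24936]),
    ((0,3),21845,[20822]), ((1,3),16426,[25257]), ((2,3),27264,[26280])], [((1,4),[20822]),
    ((1,6),[25252]), ((1,7),[20824]), ((2,4),[25192]), ((2,5),[20884]), ((2,6),[22868]),
    ((2,7),[21140])]),
    ([((0,4),16514,[17065]), ((0,5),16904,[17000]), ((0,6),18432,[22184]), ((0,7),24608,[16740]),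
    ((0,3),21845,[26964]), ((1,3),16426,[17065]), ((2,3),27264,[22184])], [((1,4),[16726]),
    ((1,5),[16740]), ((1,7),[17048]), ((2,4),[17000]), ((2,5),[16788]), ((2,6),[26964]),
    ((2,7),[24916])]),
    ([((0,4),16514,[18601]), ((0,5),16904,[17496]), ((0,6),18464,[18536]), ((0,7),24576,[22952]),
    ((0,3),21845,[26196]), ((1,3),16426,[18601]), ((2,3),27264,[22952])], [((1,4),[17494]),
    ((1,5),[18596]), ((1,6),[17496]), ((2,4),[18536]), ((2,5),[18004]), ((2,6),[17556]),
    ((2,7),[26196])]),
    ([((0,5),16904,[18953]), ((0,6),18464,[18970]), ((0,7),24704,[17738]), ((1,3),16554,[17738]),
    ((0,3),16469,[19077]), ((0,4),21762,[17670]), ((2,4),27136,[23045])], [((1,4),[18953]),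
    ((1,5),[17670]), ((1,6),[17701]), ((1,7),[19077]), ((2,5),[18693]), ((2,6),[17930]),
    ((2,7),[25866])]),
    ([((0,4),16386,[26662]), ((0,5),16904,[26922]), ((0,6),18464,[26661]), ((0,7),24704,[26730]),
    ((0,3),21845,[21653]), ((1,3),16554,[26730]), ((2,3),27136,[26922])], [((1,4),[21529]),
    ((1,5),[26662]), ((1,6),[21530]), ((1,7),[21653]), ((2,5),[22037]), ((2,6),[25621]),
    ((2,7),[22570])]),
    ([((0,4),16898,[25257]), ((0,5),16392,[25240]), ((0,6),18464,[26280]), ((0,7),24704,[25000]),
    ((0,3),21845,[20822]), ((1,3),16554,[25257]), ((2,3),27136,[26280])], [((1,4),[20822]),
    ((1,5),[20836]), ((1,6),[25240]), ((1,7),[20840]), ((2,4),[25000]), ((2,6),[22868]),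
    ((2,7),[21076])]),
    ([((0,4),16898,[18082]), ((0,5),18440,[19110]), ((0,6),16416,[17825]), ((0,7),24704,[23202]),
    ((0,3),21845,[25937]), ((1,3),16554,[19110]), ((2,3),27136,[23202])], [((1,4),[17825]),
    ((1,5),[17753]), ((1,6),[19026]), ((1,7),[19042]), ((2,4),[18769]), ((2,5),[18082]),
    ((2,7),[25937])]),
    ([((0,4),16898,[19113]), ((0,5),18440,[18856]), ((0,6),24608,[23208]), ((0,7),16512,[17828]),
    ((0,3),21845,[25940]), ((1,3),16554,[19113]), ((2,3),27136,[23208])], [((1,4),[17750]),
    ((1,5),[17828]), ((1,6),[19096]), ((1,7),[19032]), ((2,4),[18856]), ((2,5),[18004]),
    ((2,6),[25940])])]"
  by (simp only: K35_defs list.rel_inject certifies_simps cong: if_weak_cong trit.case_cong_weak)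

text \<open>Contracting an edge keeps the dimension 8 of the cycle space, so the leading digit of
  the codes stands for 4^8 = 65536.\<close>

lemma K35_contractions:
  "list_all2 (\<lambda>e. certifies K35_edges K35_vertices e (merge e))
  K35_edges [
    ([((0,4),66050,[68162]), ((0,5),67592,[67905]), ((0,6),73760,[66962]), ((0,7),98432,[66945]),
    ((1,3),65706,[68230]), ((2,3),109056,[72257])], [((1,4),[66945]), ((1,5),[66889]),
    ((1,6),[68193]), ((1,7),[68162]), ((2,4),[67905]), ((2,5),[67202]), ((2,6),[75138]),
    ((2,7),[99649])]),
    ([((0,5),67592,[100518]), ((0,6),73760,[104610]), ((0,7),98432,[99490]),
    ((0,3),87381,[83033]), ((1,3),65706,[100518]), ((2,3),109056,[104866])], [((1,4),[83041]),
    ((1,5),[83033]), ((1,6),[100498]), ((1,7),[83042]), ((2,4),[91729]), ((2,5),[99490]),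
    ((2,6),[91217]), ((2,7),[84049])]),
    ([((0,4),66050,[98977]), ((0,6),73760,[82272]), ((0,7),98432,[98720]), ((0,3),87381,[92496]),
    ((1,3),65706,[98981]), ((2,3),109056,[104096])], [((1,4),[82258]), ((1,5),[82266]),
    ((1,6),[98960]), ((1,7),[82272]), ((2,4),[98720]), ((2,5),[92496]), ((2,6),[90448]),
    ((2,7),[82512])]),
    ([((0,4),66050,[67234]), ((0,5),67592,[68262]), ((0,7),98432,[66961]), ((0,3),87381,[107857]),
    ((1,3),65706,[68262]), ((2,3),109056,[88738])], [((1,4),[66977]), ((1,5),[66905]),
    ((1,6),[68178]), ((1,7),[68194]), ((2,4),[67921]), ((2,5),[67234]), ((2,6),[107857]),
    ((2,7),[99665])]),
    ([((0,4),66050,[70662]), ((0,5),67592,[75785]), ((0,6),73760,[74757]), ((0,3),87381,[103941]),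
    ((1,3),65706,[75866]), ((2,3),109056,[92426])], [((1,4),[75785]), ((1,5),[70662]),
    ((1,6),[70693]), ((1,7),[70821]), ((2,4),[71173]), ((2,5),[74757]), ((2,6),[71690]),
    ((2,7),[103941])]),
    ([((0,4),66050,[104745]), ((0,5),67592,[84008]), ((0,6),73760,[104488]),
    ((0,7),98432,[100456]), ((0,3),87381,[91670]), ((2,3),109056,[104744])], [((1,4),[91670]),
    ((1,5),[82980]), ((1,6),[100376]), ((1,7),[83092]), ((2,4),[104488]), ((2,5),[99348]),
    ((2,6),[91156]), ((2,7),[84008])]),
    ([((0,4),66133,[76370]), ((0,5),67592,[76196]), ((0,6),73760,[75168]), ((0,7),98432,[92832]),
    ((0,3),87298,[103760]), ((2,3),109056,[92832])], [((1,3),[76370]), ((1,5),[71256]),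
    ((1,6),[71056]), ((1,7),[76384]), ((2,4),[76192]), ((2,5),[75168]), ((2,6),[72272]),
    ((2,7),[103760])]),
    ([((0,4),66056,[72272]), ((0,5),67669,[76370]), ((0,6),73760,[75168]), ((0,7),98432,[92832]),
    ((0,3),87298,[71073]), ((2,3),109056,[92832])], [((1,3),[76370]), ((1,4),[72024]),
    ((1,6),[71056]), ((1,7),[76384]), ((2,4),[75168]), ((2,5),[75424]), ((2,6),[72272]),
    ((2,7),[103760])]),
    ([((0,4),66056,[108865]), ((0,5),67616,[104594]), ((0,6),73813,[108617]),
    ((0,7),98432,[108673]), ((0,3),87298,[87106]), ((2,3),109056,[108865])], [((1,3),[108673]),
    ((1,4),[108617]), ((1,5),[91233]), ((1,7),[87106]), ((2,4),[87682]), ((2,5),[103554]),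
    ((2,6),[87105]), ((2,7),[92225])]),
    ([((0,4),66056,[86568]), ((0,5),67616,[108072]), ((0,6),73856,[106772]),
    ((0,7),98389,[107030]), ((0,3),87298,[88340]), ((2,3),109056,[108072])], [((1,3),[107030]),
    ((1,4),[86308]), ((1,5),[107032]), ((1,6),[102804]), ((2,4),[106772]), ((2,5),[88340]),
    ((2,6),[86568]), ((2,7),[86292])]),
    ([((0,4),66050,[98822]), ((0,5),67592,[99850]), ((0,6),73760,[103002]), ((0,7),98432,[98565]),
    ((0,3),87381,[90533]), ((1,3),65706,[98906])], [((1,4),[82185]), ((1,5),[98822]),
    ((1,6),[98890]), ((1,7),[82309]), ((2,4),[98565]), ((2,5),[84229]), ((2,6),[90533]),
    ((2,7),[82442])]),
    ([((0,4),87298,[83618]), ((0,5),67592,[100518]), ((0,6),73760,[104609]),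
    ((0,7),98432,[99490]), ((0,3),66133,[83033]), ((1,3),65706,[100518])], [((1,4),[100513]),
    ((1,5),[83033]), ((1,6),[100497]), ((1,7),[83042]), ((2,3),[83618]), ((2,5),[99490]),
    ((2,6),[91218]), ((2,7),[84049])]),
    ([((0,4),67586,[86042]), ((0,5),87304,[86570]), ((0,6),73760,[106533]),
    ((0,7),98432,[106602]), ((0,3),66133,[106773]), ((1,3),65706,[106602])], [((1,4),[106533]),
    ((1,5),[106534]), ((1,6),[86042]), ((1,7),[86165]), ((2,3),[86570]), ((2,4),[88089]),
    ((2,6),[102421]), ((2,7),[90154])]),
    ([((0,4),67586,[75913]), ((0,5),73736,[74888]), ((0,6),87328,[71320]), ((0,7),98432,[70788]),
    ((0,3),66133,[76132]), ((1,3),65706,[75913])], [((1,4),[70726]), ((1,5),[70788]),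
    ((1,6),[75876]), ((1,7),[75848]), ((2,3),[71320]), ((2,4),[74888]), ((2,5),[71748]),
    ((2,7),[103492])]),
    ([((0,4),67586,[67978]), ((0,5),73736,[66953]), ((0,6),98336,[66970]), ((0,7),87424,[75141]),
    ((0,3),66133,[68197]), ((1,3),65706,[66970])], [((1,4),[66953]), ((1,5),[68166]),
    ((1,6),[68197]), ((1,7),[66885]), ((2,3),[67978]), ((2,4),[67141]), ((2,5),[75141]),
    ((2,6),[99722])])]"
  by (simp only: K35_defs list.rel_inject certifies_simps cong: if_weak_cong trit.case_cong_weak)

definition G1_edges :: "(nat \<times> nat) list" where
  "G1_edges = [
     (1, 5), (2, 5), (3, 5), (1, 6), (2, 6), (4, 6), (1, 7), (3, 7), (4, 7), (2, 8), (3, 8),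
     (4, 8), (1, 9), (2, 9), (3, 9), (4, 9)]"

definition G1_vertices :: "nat list" where
  "G1_vertices = [1, 2, 3, 4, 5, 6, 7, 8, 9]"

lemmas G1_defs = G1_edges_def G1_vertices_def

lemma G1_graph_check: "graph_check G1_edges G1_vertices"
  by (simp add: graph_check_def G1_defs)

lemma G1_obstructs: "obstructs G1_edges G1_vertices
  [
    ((1, 5), [(0, M1), (2, M1), (5, M1)], Z0), ((2, 5), [(0, P1), (1, P1), (3, M1), (6, M1)], Z0),
    ((3, 5), [(1, M1), (2, P1), (3, P1), (5, P1), (6, P1)], Z0), ((1, 6), [(0, P1)], Z0), ((2, 6),
    [(0, M1), (1, M1)], Z0), ((4, 6), [(1, P1)], Z0), ((1, 7), [(2, P1)], Z0), ((3, 7), [(1, P1),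
    (2, M1), (3, M1), (4, M1), (5, M1), (6, M1), (7, M1)], P1), ((4, 7), [(1, M1), (3, P1), (4,
    P1), (5, P1), (6, P1), (7, P1)], Z0), ((2, 8), [(3, P1)], Z0), ((3, 8), [(4, P1)], Z0), ((4,
    8), [(3, M1), (4, M1)], Z0), ((1, 9), [(5, P1)], Z0), ((2, 9), [(6, P1)], Z0), ((3, 9), [(7,
    P1)], Z0), ((4, 9), [(5, M1), (6, M1), (7, M1)], Z0)]
  [
    (1, [(P1, [0, 3, 7]), (P1, [0, 4, 6]), (P1, [1, 1, 2]), (M1, [1, 1, 5]), (M1, [1, 2, 4]), (M1,
    [2, 2, 4]), (P1, [2, 2, 7]), (P1, [2, 4, 7])]), (2, [(P1, [0, 0, 7]), (P1, [0, 1, 7]), (M1,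
    [0, 2, 3]), (P1, [0, 2, 4]), (P1, [0, 2, 6]), (P1, [0, 4, 7]), (P1, [1, 2, 3]), (M1, [1, 2,
    6]), (M1, [1, 2, 7]), (P1, [1, 3, 7]), (P1, [1, 4, 6])]), (4, [(M1, [0, 2, 3]), (P1, [0, 2,
    6]), (M1, [1, 1, 7]), (P1, [1, 2, 4]), (M1, [1, 2, 7]), (P1, [1, 4, 7])]), (5, [(M1, [0, 1,
    4]), (M1, [0, 4, 6]), (P1, [0, 4, 7]), (P1, [1, 1, 4]), (M1, [1, 4, 6]), (P1, [2, 2, 7]), (P1,
    [2, 3, 7]), (P1, [2, 4, 5]), (M1, [2, 4, 6]), (P1, [3, 3, 7]), (P1, [4, 5, 5])]), (6, [(P1,
    [0, 3, 7]), (P1, [0, 4, 6]), (M1, [1, 1, 7]), (P1, [1, 2, 4]), (M1, [1, 2, 7]), (P1, [1, 4,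
    7])]), (7, [(P1, [1, 1, 2]), (M1, [1, 1, 5]), (M1, [1, 2, 4]), (P1, [1, 4, 6]), (M1, [1, 5,
    5]), (M1, [1, 6, 7]), (M1, [1, 7, 7]), (M1, [2, 2, 4]), (P1, [2, 2, 7]), (P1, [2, 4, 7]), (M1,
    [4, 5, 5]), (M1, [4, 5, 7]), (M1, [4, 6, 6]), (M1, [5, 7, 7]), (P1, [6, 6, 7])]), (8, [(M1,
    [0, 2, 3]), (P1, [1, 2, 3]), (P1, [1, 3, 7])]), (9, [(P1, [0, 2, 6]), (M1, [1, 1, 5]), (M1,
    [1, 2, 6]), (P1, [1, 4, 6])])]"
  by (simp only: obstructs_simps G1_defs cong: if_weak_cong trit.case_cong_weak)

lemma G1_deletions:
  "list_all2 (\<lambda>e. certifies G1_edges G1_vertices e (\<lambda>x. x))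
  G1_edges [
    ([((2,5),16386,[21542]), ((4,6),24712,[25625]), ((3,7),18466,[22566]), ((1,7),17433,[25625]),
    ((2,8),16544,[21541]), ((2,6),16977,[26905]), ((1,6),20774,[22054]), ((1,9),27136,[26905])],
    [((3,5),[26649]), ((4,7),[26662]), ((3,8),[26650]), ((4,8),[21653]), ((2,9),[26649]),
    ((3,9),[21542]), ((4,9),[22566])]),
    ([((3,5),18466,[16681]), ((1,5),17425,[16918]), ((4,6),24712,[21016]), ((1,7),16394,[16681]),
    ((2,8),16544,[16744]), ((2,6),16976,[16920]), ((1,6),20772,[24868]), ((1,9),27136,[17956])],
    [((3,7),[16918]), ((4,7),[16676]), ((3,8),[16916]), ((4,8),[17044]), ((2,9),[16676]),
    ((3,9),[18712]), ((4,9),[24868])]),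
    ([((4,6),24712,[21016]), ((1,6),20550,[17045]), ((3,7),18464,[17956]), ((1,7),17432,[16920]),
    ((2,8),16544,[16744]), ((2,5),16978,[17045]), ((1,5),16801,[16746]), ((1,9),27136,[21016])],
    [((2,6),[16746]), ((4,7),[16676]), ((3,8),[16916]), ((4,8),[17044]), ((2,9),[16676]),
    ((3,9),[18712]), ((4,9),[16920])]),
    ([((3,5),18466,[26122]), ((4,6),24712,[24842]), ((2,6),20548,[20997]), ((1,7),16394,[25098]),
    ((2,8),16544,[20758]), ((2,5),25112,[25098]), ((1,5),21765,[22789]), ((1,9),27136,[26122])],
    [((3,7),[20741]), ((4,7),[25093]), ((3,8),[25129]), ((4,8),[20870]), ((2,9),[20741]),
    ((3,9),[22789]), ((4,9),[20997])]),
    ([((3,5),18466,[22594]), ((4,6),24712,[25729]), ((1,6),20548,[22594]), ((1,7),16394,[26758]),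
    ((2,8),16544,[26770]), ((2,5),16976,[26946]), ((1,5),17793,[25729]), ((1,9),27136,[26946])],
    [((3,7),[26753]), ((4,7),[21577]), ((3,8),[21601]), ((4,8),[21569]), ((2,9),[22145]),
    ((3,9),[25729]), ((4,9),[22594])]),
    ([((3,5),18472,[22596]), ((1,6),16386,[26945]), ((4,7),24704,[26752]), ((1,7),20552,[22596]),
    ((2,8),16544,[26768]), ((2,5),16978,[26945]), ((1,5),17797,[25736]), ((1,9),27136,[26944])],
    [((2,6),[22146]), ((3,7),[25736]), ((3,8),[21600]), ((4,8),[21568]), ((2,9),[22144]),
    ((3,9),[21568]), ((4,9),[22592])]),
    ([((4,6),24712,[24969]), ((1,6),20550,[21062]), ((3,7),16392,[25162]), ((3,5),18468,[26182]),
    ((2,8),16544,[20885]), ((2,5),16978,[21062]), ((1,5),17801,[22921]), ((1,9),27136,[26182])],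
    [((2,6),[25225]), ((4,7),[20869]), ((3,8),[25194]), ((4,8),[20805]), ((2,9),[24969]),
    ((3,9),[22921]), ((4,9),[21062])]),
    ([((3,5),18464,[18976]), ((4,6),24712,[23060]), ((1,6),20550,[19089]), ((1,7),16392,[23060]),
    ((2,8),16544,[18976]), ((2,5),16978,[19089]), ((1,5),17793,[17762]), ((1,9),27136,[18976])],
    [((2,6),[17762]), ((4,7),[25896]), ((3,8),[17680]), ((4,8),[19088]), ((2,9),[17680]),
    ((3,9),[17936]), ((4,9),[25888])]),
    ([((3,5),18472,[18502]), ((4,6),24704,[22657]), ((1,6),20546,[18498]), ((1,7),16392,[18502]),
    ((2,8),16544,[18577]), ((2,5),16978,[18754]), ((1,5),17797,[18049]), ((1,9),27136,[18754])],
    [((2,6),[17537]), ((3,7),[17545]), ((3,8),[17506]), ((4,8),[18497]), ((2,9),[18049]),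
    ((3,9),[17537]), ((4,9),[25666])]),
    ([((2,5),16898,[26882]), ((4,6),24736,[25681]), ((1,6),20562,[21506]), ((1,7),16424,[22662]),
    ((3,8),16512,[25665]), ((3,5),18504,[22662]), ((1,5),17797,[22017]), ((1,9),27136,[26882])],
    [((2,6),[26625]), ((3,7),[25673]), ((4,7),[22690]), ((4,8),[22658]), ((2,9),[22017]),
    ((3,9),[21506]), ((4,9),[21505])]),
    ([((3,5),18440,[22598]), ((4,6),24736,[25745]), ((1,6),20562,[21570]), ((1,7),16424,[22598]),
    ((2,8),16512,[26754]), ((2,5),16962,[26946]), ((1,5),17797,[22145]), ((1,9),27136,[26946])],
    [((2,6),[26753]), ((3,7),[25737]), ((4,7),[22626]), ((4,8),[21569]), ((2,9),[22145]),
    ((3,9),[21570]), ((4,9),[22594])]),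
    ([((3,5),18568,[22534]), ((4,6),24608,[25617]), ((1,6),20498,[22562]), ((1,7),16424,[22534]),
    ((2,8),16512,[26689]), ((2,5),16962,[26882]), ((1,5),17669,[22017]), ((1,9),27136,[26882])],
    [((2,6),[26625]), ((3,7),[25609]), ((4,7),[22562]), ((3,8),[21634]), ((2,9),[22017]),
    ((3,9),[21506]), ((4,9),[21505])]),
    ([((3,5),18568,[18692]), ((4,6),25120,[17936]), ((1,6),20754,[25857]), ((1,7),16424,[18692]),
    ((1,5),25093,[17928]), ((2,5),21826,[25857]), ((2,8),17024,[19008]), ((2,9),26624,[23040])],
    [((2,6),[23042]), ((3,7),[17928]), ((4,7),[18720]), ((3,8),[17792]), ((4,8),[18688]),
    ((3,9),[17920]), ((4,9),[25856])]),
    ([((3,5),18568,[26660]), ((4,6),25120,[26656]), ((1,6),20754,[23057]), ((1,7),16424,[26660]),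
    ((2,8),17024,[22608]), ((2,5),16706,[23057]), ((1,5),17925,[25890]), ((1,9),26624,[26656])],
    [((2,6),[25890]), ((3,7),[21528]), ((4,7),[21520]), ((3,8),[25760]), ((4,8),[23056]),
    ((3,9),[21520]), ((4,9),[21536])]),
    ([((3,5),16520,[16678]), ((4,6),25120,[21025]), ((1,6),20754,[24850]), ((1,7),16424,[16678]),
    ((2,8),17024,[16977]), ((2,5),18754,[17682]), ((1,5),17925,[16921]), ((1,9),26624,[17682])],
    [((2,6),[16929]), ((3,7),[16921]), ((4,7),[16658]), ((3,8),[16802]), ((4,8),[16657]),
    ((2,9),[18977]), ((4,9),[24850])]),
    ([((3,5),24712,[26760]), ((4,6),16928,[26712]), ((1,6),16658,[27209]), ((1,7),16424,[26712]),
    ((2,8),17024,[26760]), ((2,5),18754,[27209]), ((1,5),22021,[21572]), ((1,9),26624,[26760])],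
    [((2,6),[21894]), ((3,7),[26692]), ((4,7),[21668]), ((3,8),[21572]), ((4,8),[27208]),
    ((2,9),[21572]), ((3,9),[22596])])]"
  by (simp only: G1_defs list.rel_inject certifies_simps cong: if_weak_cong trit.case_cong_weak)

lemma G1_contractions:
  "list_all2 (\<lambda>e. certifies G1_edges G1_vertices e (merge e))
  G1_edges [
    ([((3,5),73864,[102528]), ((4,6),98848,[98384]), ((1,6),82194,[82497]), ((1,7),65576,[82052]),
    ((2,8),66176,[98688]), ((2,5),67906,[82497]), ((1,9),108544,[99392])], [((2,6),[98690]),
    ((3,7),[98376]), ((4,7),[82080]), ((3,8),[98368]), ((4,8),[82496]), ((2,9),[84096]),
    ((3,9),[90176]), ((4,9),[82048])]),
    ([((3,5),73864,[90376]), ((4,6),98848,[102916]), ((1,6),82194,[90377]),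
    ((1,7),65576,[107032]), ((2,8),66176,[107080]), ((1,5),71173,[88580]),
    ((1,9),108544,[107784])], [((2,6),[102918]), ((3,7),[107012]), ((4,7),[86308]),
    ((3,8),[86404]), ((4,8),[86276]), ((2,9),[88580]), ((3,9),[102916]), ((4,9),[90376])]),
    ([((4,6),98848,[99857]), ((1,6),82194,[84258]), ((1,7),65576,[84230]), ((2,8),66176,[83521]),
    ((2,5),67906,[84226]), ((1,5),71173,[91649]), ((1,9),108544,[104706])], [((2,6),[100865]),
    ((3,7),[99849]), ((4,7),[99841]), ((3,8),[100738]), ((4,8),[83201]), ((2,9),[99841]),
    ((3,9),[91649]), ((4,9),[84226])]),
    ([((3,5),73864,[71944]), ((4,6),98848,[84484]), ((1,7),65576,[67848]), ((2,8),66176,[67144]),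
    ((2,5),67906,[67849]), ((1,5),71173,[75268]), ((1,9),108544,[71944])], [((2,6),[67078]),
    ((3,7),[67076]), ((4,7),[67876]), ((3,8),[67972]), ((4,8),[67844]), ((2,9),[67076]),
    ((3,9),[75268]), ((4,9),[99592])]),
    ([((3,5),73864,[106660]), ((4,6),98848,[102496]), ((1,7),65576,[106660]),
    ((2,8),66176,[106912]), ((2,5),100449,[107618]), ((1,5),87062,[88209]),
    ((1,9),108544,[107616])], [((1,6),[107618]), ((3,7),[86104]), ((4,7),[106640]),
    ((3,8),[86096]), ((4,8),[86608]), ((2,9),[88208]), ((3,9),[102496]), ((4,9),[90256])]),
    ([((3,5),73864,[90374]), ((1,6),82194,[90402]), ((1,7),65576,[90374]), ((2,8),66176,[107073]),
    ((2,5),67906,[107778]), ((1,5),71173,[88577]), ((1,9),108544,[107778])], [((2,6),[86529]),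
    ((3,7),[102921]), ((4,7),[90402]), ((3,8),[86402]), ((4,8),[86274]), ((2,9),[88577]),
    ((3,9),[86274]), ((4,9),[86529])]),
    ([((3,5),73864,[73990]), ((4,6),98848,[90641]), ((1,6),82194,[102690]), ((2,8),66176,[74305]),
    ((2,5),67906,[75010]), ((1,5),71173,[70153]), ((1,9),108544,[75010])], [((2,6),[70145]),
    ((3,7),[70153]), ((4,7),[102690]), ((3,8),[70018]), ((4,8),[73985]), ((2,9),[72193]),
    ((3,9),[70145]), ((4,9),[102658])]),
    ([((3,5),73876,[71832]), ((4,6),98848,[84064]), ((1,6),82194,[68177]), ((2,8),66176,[66976]),
    ((2,5),67906,[68177]), ((1,5),71209,[74852]), ((1,9),108544,[84064])], [((2,6),[66978]),
    ((1,7),[71832]), ((4,7),[66704]), ((3,8),[67664]), ((4,8),[68176]), ((2,9),[66704]),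
    ((3,9),[74848]), ((4,9),[67680])]),
    ([((3,5),73888,[74018]), ((4,6),98836,[90649]), ((1,6),82218,[74018]), ((2,8),66176,[74337]),
    ((2,5),67906,[75042]), ((1,5),71185,[70161]), ((1,9),108544,[75042])], [((2,6),[70161]),
    ((1,7),[90649]), ((3,7),[74257]), ((3,8),[70034]), ((4,8),[74017]), ((2,9),[74018]),
    ((3,9),[70161]), ((4,9),[102690])]),
    ([((2,5),67906,[92689]), ((3,5),73864,[108580]), ((1,5),71173,[103714]),
    ((4,6),98848,[108576]), ((1,6),82194,[92689]), ((1,7),65576,[108580]),
    ((1,9),108544,[108576])], [((2,6),[103714]), ((3,7),[87064]), ((4,7),[87056]),
    ((3,8),[104608]), ((4,8),[92688]), ((2,9),[91152]), ((3,9),[87056]), ((4,9),[87072])]),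
    ([((2,5),67714,[92425]), ((3,5),74056,[108808]), ((1,5),71173,[87556]),
    ((4,6),98848,[109080]), ((1,6),82194,[92425]), ((1,7),65576,[109080]),
    ((1,9),108544,[108808])], [((2,6),[103942]), ((3,7),[109060]), ((4,7),[87332]),
    ((2,8),[91528]), ((4,8),[108808]), ((2,9),[103940]), ((3,9),[87304]), ((4,9),[87556])]),
    ([((2,5),67714,[107650]), ((3,5),74248,[90502]), ((1,5),70981,[88129]),
    ((4,6),98656,[102993]), ((1,6),82578,[86146]), ((1,7),65576,[90502]),
    ((1,9),108544,[107650])], [((2,6),[106561]), ((3,7),[102985]), ((4,7),[90530]),
    ((2,8),[106562]), ((3,8),[102977]), ((2,9),[88129]), ((3,9),[86146]), ((4,9),[86081])]),
    ([((3,5),73864,[73764]), ((4,6),98848,[90144]), ((1,6),82194,[102416]), ((1,7),65576,[73764]),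
    ((1,5),71173,[71970]), ((2,5),67906,[75281]), ((2,8),66176,[73808])], [((2,6),[69922]),
    ((3,7),[69656]), ((4,7),[73744]), ((3,8),[69792]), ((4,8),[74256]), ((2,9),[71970]),
    ((3,9),[69664]), ((4,9),[102416])]),
    ([((3,5),73864,[65668]), ((4,6),98848,[65616]), ((1,6),82194,[98881]), ((1,7),65576,[65668]),
    ((1,5),100869,[65608]), ((2,5),87362,[100929]), ((2,8),66176,[65664])], [((2,6),[82306]),
    ((3,7),[65608]), ((4,7),[65696]), ((3,8),[65600]), ((4,8),[65664]), ((1,9),[100929]),
    ((3,9),[73792]), ((4,9),[98880])]),
    ([((3,5),87176,[100612]), ((4,6),98848,[82448]), ((1,6),82194,[65793]), ((1,7),65576,[82448]),
    ((1,5),100869,[66050]), ((2,5),74050,[65793]), ((2,8),66176,[66048])], [((2,6),[66050]),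
    ((3,7),[82440]), ((4,7),[98592]), ((3,8),[66048]), ((4,8),[65792]), ((1,9),[100612]),
    ((2,9),[74304]), ((4,9),[66048])]),
    ([((3,5),98440,[98308]), ((4,6),87584,[83984]), ((1,6),108818,[102913]),
    ((1,7),65576,[98308]), ((1,5),86533,[81928]), ((2,5),74050,[102913]), ((2,8),66176,[98368])],
    [((2,6),[90370]), ((3,7),[81928]), ((4,7),[98336]), ((3,8),[82048]), ((4,8),[81920]),
    ((1,9),[83984]), ((2,9),[90368]), ((3,9),[81920])])]"
  by (simp only: G1_defs list.rel_inject certifies_simps cong: if_weak_cong trit.case_cong_weak)

definition G2_edges :: "(nat \<times> nat) list" where
  "G2_edges = [
     (1, 12), (2, 12), (0, 12), (1, 13), (3, 13), (0, 13), (1, 14), (4, 14), (0, 14), (2, 23),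
     (3, 23), (0, 23), (2, 24), (4, 24), (0, 24), (3, 34), (4, 34), (0, 34)]"

definition G2_vertices :: "nat list" where
  "G2_vertices = [0, 1, 2, 3, 4, 12, 13, 14, 23, 24, 34]"

lemmas G2_defs = G2_edges_def G2_vertices_def

lemma G2_graph_check: "graph_check G2_edges G2_vertices"
  by (simp add: graph_check_def G2_defs)

text \<open>Two constants \<kappa> are nonzero, at the edges from 1 and from 3 to the vertex 13;
  they add up to -1 - 1 = 1 modulo 3.\<close>

lemma G2_obstructs: "obstructs G2_edges G2_vertices
  [
    ((1, 12), [(0, P1), (2, P1), (3, P1), (4, P1), (5, M1), (7, P1)], Z0), ((2, 12), [(3, M1), (5,
    P1), (6, P1)], Z0), ((0, 12), [(0, M1), (2, M1), (4, M1), (6, M1), (7, M1)], Z0), ((1, 13),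
    [(0, M1), (1, M1), (2, M1), (3, M1), (4, M1), (5, P1), (7, M1)], M1), ((3, 13), [(1, P1), (2,
    P1), (3, P1), (4, P1), (5, M1), (7, P1)], M1), ((0, 13), [(0, P1)], Z0), ((1, 14), [(1, P1)],
    Z0), ((4, 14), [(1, M1), (2, M1)], Z0), ((0, 14), [(2, P1)], Z0), ((2, 23), [(3, P1)], Z0),
    ((3, 23), [(3, M1), (4, M1)], Z0), ((0, 23), [(4, P1)], Z0), ((2, 24), [(5, M1), (6, M1)],
    Z0), ((4, 24), [(5, P1)], Z0), ((0, 24), [(6, P1)], Z0), ((3, 34), [(1, M1), (2, M1), (5, P1),
    (7, M1)], Z0), ((4, 34), [(1, P1), (2, P1), (5, M1)], Z0), ((0, 34), [(7, P1)], Z0)]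
  [
    (0, [(P1, [0, 1, 3]), (P1, [0, 1, 5]), (P1, [0, 3, 5]), (P1, [0, 5, 5]), (P1, [1, 3, 6]), (M1,
    [1, 3, 7]), (P1, [2, 5, 5]), (M1, [3, 5, 7]), (P1, [4, 5, 5])]), (1, [(M1, [1, 3, 5]), (M1,
    [1, 5, 5])]), (3, [(M1, [1, 3, 5]), (M1, [1, 3, 7]), (P1, [1, 4, 5]), (P1, [1, 4, 7]), (M1,
    [3, 5, 7]), (P1, [4, 5, 5]), (P1, [4, 5, 7])]), (4, [(M1, [1, 3, 5])]), (12, [(P1, [1, 3, 4]),
    (P1, [1, 4, 5])]), (13, [(P1, [0, 1, 3]), (P1, [0, 1, 5]), (P1, [0, 3, 5]), (P1, [0, 5, 5]),
    (P1, [1, 5, 5]), (M1, [1, 5, 7]), (P1, [1, 7, 7]), (M1, [2, 3, 3]), (M1, [2, 3, 7]), (M1, [2,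
    7, 7]), (P1, [3, 3, 4]), (P1, [3, 4, 4]), (M1, [3, 4, 7]), (P1, [3, 5, 7]), (M1, [4, 4, 7])]),
    (14, [(M1, [1, 3, 5]), (M1, [1, 5, 5]), (P1, [2, 5, 5])]), (23, [(P1, [4, 5, 5])]), (24, [(M1,
    [1, 3, 5]), (P1, [1, 3, 6])]), (34, [(M1, [1, 3, 5]), (M1, [1, 3, 7]), (M1, [3, 5, 7])])]"
  by (simp only: obstructs_simps G2_defs cong: if_weak_cong trit.case_cong_weak)

lemma G2_deletions:
  "list_all2 (\<lambda>e. certifies G2_edges G2_vertices e (\<lambda>x. x))
  G2_edges [
    ([((2,12),16520,[25605]), ((0,12),16452,[22538]), ((1,13),16386,[26626]),
    ((3,13),18464,[26625]), ((0,13),17425,[21505]), ((4,14),25088,[26626]),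
    ((0,14),20738,[21506]), ((0,23),16424,[25605]), ((0,24),17024,[22594]),
    ((0,34),26624,[26626])], [((1,14),[21505]), ((2,23),[22538]), ((3,23),[25633]),
    ((2,24),[25729]), ((4,24),[23042]), ((3,34),[21506]), ((4,34),[21505])]),
    ([((1,12),16394,[26113]), ((0,12),16389,[22786]), ((3,13),18464,[22784]),
    ((0,13),17426,[26113]), ((4,14),25088,[26112]), ((0,14),20744,[22788]),
    ((2,23),16512,[21760]), ((0,23),16480,[27152]), ((0,24),17024,[27200]),
    ((0,34),26624,[27136])], [((1,13),[22786]), ((1,14),[26120]), ((3,23),[21792]),
    ((2,24),[27136]), ((4,24),[21760]), ((3,34),[26112]), ((4,34),[22784])]),
    ([((1,12),16386,[18722]), ((1,13),16393,[17937]), ((3,13),18464,[18722]),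
    ((0,13),17430,[17946]), ((4,14),25088,[17938]), ((0,14),20744,[18725]),
    ((2,23),16514,[18722]), ((0,23),16481,[18849]), ((0,24),17024,[18977]),
    ((0,34),26624,[23073])], [((2,12),[17937]), ((1,14),[18721]), ((3,23),[17937]),
    ((2,24),[17938]), ((4,24),[18721]), ((3,34),[17682]), ((4,34),[18977])]),
    ([((1,12),16386,[21905]), ((2,12),16520,[21904]), ((0,12),16453,[27234]),
    ((3,13),18464,[22880]), ((0,13),17424,[26256]), ((4,14),25088,[27232]),
    ((0,14),20738,[21905]), ((0,23),16424,[27300]), ((0,24),17024,[27296]),
    ((0,34),26624,[27280])], [((1,14),[27234]), ((2,23),[21848]), ((3,23),[21840]),
    ((2,24),[27232]), ((4,24),[21904]), ((3,34),[26256]), ((4,34),[22880])]),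
    ([((1,12),16394,[17984]), ((2,12),16544,[18816]), ((0,12),16469,[17994]),
    ((0,13),16386,[18821]), ((4,14),25088,[17984]), ((0,14),20744,[18820]),
    ((3,23),18432,[18752]), ((0,23),17440,[18064]), ((0,24),17024,[18048]),
    ((0,34),26624,[23168])], [((1,13),[17994]), ((1,14),[18816]), ((2,23),[18784]),
    ((2,24),[17984]), ((4,24),[18816]), ((3,34),[18048]), ((4,34),[25920])]),
    ([((2,12),16520,[21784]), ((3,13),18464,[27172]), ((1,13),17424,[21784]),
    ((1,12),18466,[27172]), ((0,12),17493,[26134]), ((4,14),25088,[26132]),
    ((0,14),20738,[22825]), ((0,23),16424,[27176]), ((0,24),17024,[27240]),
    ((0,34),26624,[27156])], [((1,14),[26134]), ((2,23),[27172]), ((3,23),[21784]),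
    ((2,24),[21908]), ((4,24),[21780]), ((3,34),[26132]), ((4,34),[22824])]),
    ([((1,12),16386,[18073]), ((2,12),16520,[18072]), ((0,12),16453,[18790]),
    ((3,13),18464,[18788]), ((0,13),17426,[18073]), ((4,14),25088,[18004]),
    ((0,14),20736,[18856]), ((0,23),16424,[18792]), ((0,24),17024,[19112]),
    ((0,34),26624,[23208])], [((1,13),[18790]), ((2,23),[18788]), ((3,23),[18072]),
    ((2,24),[18004]), ((4,24),[18856]), ((3,34),[17748]), ((4,34),[19112])]),
    ([((1,12),16394,[24677]), ((2,12),16928,[24672]), ((0,12),16661,[20634]),
    ((3,13),18560,[20624]), ((0,13),17474,[24673]), ((0,14),16392,[24677]),
    ((0,23),16544,[20640]), ((4,24),24576,[24656]), ((0,24),20992,[20896]),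
    ((0,34),26624,[25760])], [((1,13),[24672]), ((1,14),[20634]), ((2,23),[20624]),
    ((3,23),[24672]), ((2,24),[25168]), ((3,34),[22608]), ((4,34),[20640])]),
    ([((2,12),16520,[21896]), ((3,13),18464,[22852]), ((0,13),17426,[26249]),
    ((4,14),25088,[27204]), ((1,14),20736,[21896]), ((1,12),25090,[27204]),
    ((0,12),20805,[22854]), ((0,23),16424,[27288]), ((0,24),17024,[27268]),
    ((0,34),26624,[27272])], [((1,13),[22854]), ((2,23),[21828]), ((3,23),[27272]),
    ((2,24),[27204]), ((4,24),[21896]), ((3,34),[21828]), ((4,34),[22852])]),
    ([((1,12),16394,[27144]), ((2,12),16512,[21764]), ((0,12),16453,[27142]),
    ((3,13),18464,[27140]), ((0,13),17426,[21769]), ((4,14),25088,[27144]),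
    ((0,14),20744,[21768]), ((0,23),16416,[22808]), ((0,24),17024,[27208]),
    ((0,34),26624,[27140])], [((1,13),[27142]), ((1,14),[21764]), ((3,23),[26148]),
    ((2,24),[27144]), ((4,24),[21764]), ((3,34),[21768]), ((4,34),[22792])]),
    ([((1,12),16394,[25090]), ((2,12),16544,[20737]), ((0,12),16469,[25097]),
    ((3,13),18432,[20738]), ((0,13),17410,[25090]), ((4,14),25088,[25090]),
    ((0,14),20744,[20737]), ((0,23),16416,[25170]), ((0,24),17024,[25154]),
    ((0,34),26624,[26113])], [((1,13),[20737]), ((1,14),[25097]), ((2,23),[20897]),
    ((2,24),[25090]), ((4,24),[20737]), ((3,34),[25089]), ((4,34),[20738])]),
    ([((1,12),16394,[16930]), ((3,13),18464,[16930]), ((0,13),17426,[16658]),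
    ((4,14),25088,[16929]), ((0,14),20744,[16662]), ((2,23),16416,[16930]),
    ((2,12),16528,[16657]), ((0,12),16485,[16937]), ((0,24),17024,[16978]),
    ((0,34),26624,[17697])], [((1,13),[16657]), ((1,14),[16937]), ((3,23),[16657]),
    ((2,24),[16801]), ((4,24),[16658]), ((3,34),[18962]), ((4,34),[24865])]),
    ([((1,12),16394,[18568]), ((2,12),16416,[17476]), ((0,12),16405,[18566]),
    ((3,13),18560,[18568]), ((0,13),17474,[17476]), ((4,14),25088,[17480]),
    ((0,14),20744,[18568]), ((0,23),16544,[18584]), ((0,24),16896,[22916]),
    ((0,34),26624,[18504])], [((1,13),[18566]), ((1,14),[17476]), ((2,23),[18568]),
    ((3,23),[17476]), ((4,24),[26184]), ((3,34),[17480]), ((4,34),[18564])]),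
    ([((1,12),16394,[18438]), ((2,12),16928,[18433]), ((0,12),16661,[17417]),
    ((3,13),18560,[18434]), ((0,13),17474,[17410]), ((4,14),24576,[17409]),
    ((0,14),20488,[18438]), ((0,23),16544,[18497]), ((0,24),16896,[17682]),
    ((0,34),26624,[18433])], [((1,13),[18433]), ((1,14),[17417]), ((2,23),[17410]),
    ((3,23),[18433]), ((2,24),[18977]), ((3,34),[17410]), ((4,34),[18434])]),
    ([((1,12),16394,[18698]), ((3,13),18560,[18698]), ((0,13),17474,[17926]),
    ((4,14),25088,[17930]), ((0,14),20744,[18697]), ((0,23),16544,[17690]),
    ((2,24),16896,[17930]), ((2,12),16672,[18693]), ((0,12),16917,[17925]),
    ((0,34),26624,[18698])], [((1,13),[17925]), ((1,14),[18693]), ((2,23),[18981]),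
    ((3,23),[17802]), ((4,24),[18693]), ((3,34),[17925]), ((4,34),[25866])]),
    ([((1,12),16394,[16937]), ((2,12),16928,[16932]), ((0,12),16661,[16662]),
    ((3,13),16512,[16660]), ((0,13),16450,[16937]), ((4,14),26624,[16664]),
    ((0,14),21512,[16936]), ((0,23),16544,[17000]), ((0,24),18944,[16920]),
    ((0,34),24576,[22052])], [((1,13),[16662]), ((1,14),[16932]), ((2,23),[16660]),
    ((3,23),[16936]), ((2,24),[16664]), ((4,24),[16932]), ((4,34),[26904])]),
    ([((1,12),16394,[25098]), ((2,12),16928,[25093]), ((0,12),16661,[20741]),
    ((3,13),24704,[25098]), ((0,13),20546,[20742]), ((4,14),18432,[20746]),
    ((0,14),17416,[25097]), ((0,23),16544,[21018]), ((0,24),18944,[26117]),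
    ((0,34),24576,[25098])], [((1,13),[20741]), ((1,14),[25093]), ((2,23),[24869]),
    ((3,23),[21130]), ((2,24),[20746]), ((4,24),[25093]), ((3,34),[20741])]),
    ([((1,12),16394,[20504]), ((2,12),16928,[24612]), ((0,12),16661,[20502]),
    ((4,14),26624,[24616]), ((0,14),21512,[20504]), ((0,23),16544,[24612]),
    ((0,24),18944,[20776]), ((0,13),24642,[24617]), ((3,13),20608,[20500]),
    ((3,34),24576,[24616])], [((1,13),[20502]), ((1,14),[24612]), ((2,23),[20504]),
    ((3,23),[24724]), ((2,24),[25108]), ((4,24),[22568]), ((4,34),[20500])])]"
  by (simp only: G2_defs list.rel_inject certifies_simps cong: if_weak_cong trit.case_cong_weak)

lemma G2_contractions:
  "list_all2 (\<lambda>e. certifies G2_edges G2_vertices e (merge e))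
  G2_edges [
    ([((2,12),66080,[72000]), ((0,12),100490,[92289]), ((3,23),65696,[74896]),
    ((4,24),68096,[72000]), ((4,14),75008,[75392]), ((1,14),72200,[72000]),
    ((1,13),106658,[74896]), ((3,13),86096,[71776]), ((3,34),106496,[92288])], [((0,13),[103490]),
    ((0,14),[74824]), ((2,23),[71776]), ((0,23),[74816]), ((2,24),[75392]), ((0,24),[74880]),
    ((4,34),[71808]), ((0,34),[103488])]),
    ([((1,12),65570,[86122]), ((0,13),65546,[86106]), ((0,14),65696,[106661]),
    ((0,12),100949,[106837]), ((4,24),73856,[106645]), ((2,24),71744,[86122]),
    ((2,23),107012,[106662]), ((3,23),86024,[86105]), ((3,34),106496,[106666])],
    [((1,13),[86105]), ((3,13),[106662]), ((1,14),[106645]), ((4,14),[86122]), ((0,23),[86698]),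
    ((0,24),[92330]), ((4,34),[86186]), ((0,34),[86101])]),
    ([((4,14),74240,[102480]), ((1,14),69896,[98900]), ((2,23),65696,[98464]),
    ((2,24),68096,[83360]), ((2,12),66896,[82000]), ((1,12),82469,[82344]),
    ((1,13),106514,[98449]), ((3,13),86048,[90272]), ((3,34),106496,[98464])], [((0,13),[82018]),
    ((0,14),[82344]), ((3,23),[82000]), ((0,23),[82016]), ((4,24),[98896]), ((0,24),[100944]),
    ((4,34),[90272]), ((0,34),[82000])]),
    ([((2,12),66080,[100960]), ((0,12),65810,[83345]), ((3,13),73856,[83344]),
    ((0,23),65696,[83360]), ((0,13),100937,[100962]), ((1,14),109064,[105120]),
    ((4,14),87296,[91472]), ((4,24),68096,[100944]), ((4,34),106496,[105120])],
    [((1,12),[100962]), ((0,14),[83368]), ((2,23),[83344]), ((3,23),[100960]), ((2,24),[100688]),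
    ((0,24),[83616]), ((3,34),[91472]), ((0,34),[83280])]),
    ([((1,12),65546,[70738]), ((2,12),67712,[75937]), ((0,12),66629,[70745]),
    ((0,14),65576,[75942]), ((3,23),66176,[75937]), ((0,24),75776,[75922]),
    ((0,13),103058,[71058]), ((3,34),102416,[70737]), ((4,34),73760,[74849])], [((1,13),[75937]),
    ((1,14),[70745]), ((4,14),[70737]), ((2,23),[70738]), ((0,23),[76385]), ((2,24),[74849]),
    ((4,24),[71826]), ((0,34),[71826])]),
    ([((2,12),66080,[100640]), ((0,12),65810,[83473]), ((3,23),65696,[82976]),
    ((4,24),68096,[100640]), ((4,14),75008,[83472]), ((1,14),72200,[100640]),
    ((1,13),75014,[83473]), ((3,13),86096,[83088]), ((3,34),106496,[100368])], [((1,12),[100642]),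
    ((0,14),[103464]), ((2,23),[100368]), ((0,23),[83088]), ((2,24),[83472]), ((0,24),[82960]),
    ((4,34),[92176]), ((0,34),[82976])]),
    ([((2,12),66080,[87616]), ((0,12),65810,[108929]), ((3,13),73856,[91520]),
    ((0,13),69704,[105028]), ((4,14),100352,[108928]), ((0,14),82949,[87618]),
    ((0,23),65696,[109200]), ((0,24),68096,[109184]), ((0,34),106496,[109120])],
    [((1,12),[108928]), ((1,13),[91528]), ((2,23),[87392]), ((3,23),[87360]), ((2,24),[108928]),
    ((4,24),[87616]), ((3,34),[105024]), ((4,34),[91520])]),
    ([((1,12),65546,[70185]), ((2,12),66080,[70180]), ((0,12),65813,[74006]),
    ((3,13),73856,[74004]), ((0,13),69698,[70185]), ((0,23),65696,[74344]),
    ((0,14),109064,[75288]), ((4,24),68096,[70180]), ((4,34),106496,[74004])], [((1,13),[74006]),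
    ((1,14),[70180]), ((2,23),[69908]), ((3,23),[74280]), ((2,24),[74008]), ((0,24),[71972]),
    ((3,34),[69908]), ((0,34),[74280])]),
    ([((2,12),66080,[68192]), ((0,12),65810,[66961]), ((3,13),73856,[66960]),
    ((0,13),69704,[68196]), ((1,14),65546,[66961]), ((0,23),65696,[66976]),
    ((4,14),87296,[66976]), ((4,24),68096,[68176]), ((4,34),106496,[88736])], [((1,12),[68194]),
    ((1,13),[68192]), ((2,23),[66960]), ((3,23),[68192]), ((2,24),[67920]), ((0,24),[67232]),
    ((3,34),[75088]), ((0,34),[72352])]),
    ([((1,12),65576,[107048]), ((0,12),65558,[107028]), ((3,13),74240,[107048]),
    ((0,13),69896,[86296]), ((0,14),65696,[107044]), ((0,23),109121,[107050]),
    ((2,24),108608,[106792]), ((4,24),86144,[86376]), ((4,34),106496,[107028])],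
    [((2,12),[86292]), ((1,13),[86292]), ((1,14),[107028]), ((4,14),[86312]), ((3,23),[86292]),
    ((0,24),[107156]), ((3,34),[102696]), ((0,34),[86312])]),
    ([((1,12),65570,[70162]), ((2,12),68096,[70145]), ((0,12),66833,[74017]),
    ((0,13),65546,[70146]), ((0,14),65696,[70162]), ((0,24),75776,[75266]),
    ((0,23),102980,[70153]), ((3,34),102464,[69889]), ((4,34),73856,[74049])], [((1,13),[70145]),
    ((3,13),[73986]), ((1,14),[74017]), ((4,14),[73985]), ((2,23),[73986]), ((2,24),[71937]),
    ((4,24),[70146]), ((0,34),[70274])]),
    ([((1,12),65672,[69896]), ((0,12),65606,[70020]), ((0,13),65576,[74248]),
    ((0,14),66176,[74312]), ((4,24),74240,[74244]), ((2,24),71936,[69896]),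
    ((2,23),75266,[74245]), ((3,23),86048,[69912]), ((3,34),106496,[74244])], [((2,12),[74244]),
    ((1,13),[74244]), ((3,13),[69896]), ((1,14),[70020]), ((4,14),[69892]), ((0,24),[69892]),
    ((4,34),[69896]), ((0,34),[73992])]),
    ([((1,12),65576,[66852]), ((0,12),65558,[68120]), ((3,13),74240,[68112]),
    ((0,13),69896,[66852]), ((4,14),100352,[68128]), ((0,14),82976,[66848]),
    ((0,23),66176,[68112]), ((0,24),67649,[68130]), ((0,34),106496,[71200])], [((2,12),[66832]),
    ((1,13),[68120]), ((1,14),[66832]), ((2,23),[67984]), ((3,23),[66848]), ((4,24),[66832]),
    ((3,34),[76048]), ((4,34),[99872])]),
    ([((1,12),65546,[70666]), ((2,12),67712,[75781]), ((0,12),66629,[70661]),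
    ((3,13),74240,[75786]), ((0,13),69890,[70662]), ((0,14),65576,[75785]),
    ((0,23),66176,[71754]), ((0,24),108560,[75813]), ((4,34),106496,[74757])], [((1,13),[70661]),
    ((1,14),[75781]), ((4,14),[70666]), ((2,23),[74885]), ((3,23),[72202]), ((2,24),[70666]),
    ((3,34),[70661]), ((0,34),[75786])]),
    ([((1,12),65576,[70692]), ((0,12),65558,[75800]), ((3,13),75776,[75808]),
    ((0,13),70664,[70692]), ((0,14),65696,[75808]), ((0,23),68096,[76064]),
    ((2,24),66050,[70673]), ((4,24),86144,[70752]), ((4,34),106496,[75792])], [((2,12),[70672]),
    ((1,13),[75800]), ((1,14),[70672]), ((4,14),[70688]), ((2,23),[75808]), ((3,23),[70672]),
    ((3,34),[70688]), ((0,34),[74784])]),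
    ([((1,12),65570,[82016]), ((2,12),67712,[98448]), ((0,12),66641,[82002]),
    ((0,13),65546,[98465]), ((4,14),106496,[98464]), ((0,14),86048,[82016]),
    ((0,23),66176,[98448]), ((0,24),75776,[83104]), ((0,34),98564,[98472])], [((1,13),[82002]),
    ((3,13),[82000]), ((1,14),[98448]), ((2,23),[82016]), ((3,23),[82080]), ((2,24),[100432]),
    ((4,24),[90272]), ((4,34),[82000])]),
    ([((1,12),65546,[100358]), ((2,12),67712,[100353]), ((0,12),66629,[82953]),
    ((3,13),98816,[100354]), ((0,13),82178,[82946]), ((0,14),65576,[100358]),
    ((0,23),66176,[84034]), ((0,24),75776,[100353]), ((0,34),102416,[100386])],
    [((1,13),[100353]), ((1,14),[82953]), ((4,14),[82945]), ((2,23),[99457]), ((3,23),[84482]),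
    ((2,24),[82946]), ((4,24),[83970]), ((3,34),[82945])]),
    ([((1,12),65570,[86306]), ((2,12),74240,[107025]), ((0,12),69905,[86289]),
    ((0,13),65546,[107026]), ((0,14),65696,[86305]), ((0,23),68096,[86562]),
    ((0,24),106496,[107042]), ((3,34),67592,[86310]), ((4,34),98432,[102673])],
    [((1,13),[107025]), ((3,13),[86306]), ((1,14),[86289]), ((4,14),[107042]), ((2,23),[86306]),
    ((3,23),[107025]), ((2,24),[102673]), ((4,24),[86289])])]"
  by (simp only: G2_defs list.rel_inject certifies_simps cong: if_weak_cong trit.case_cong_weak)

definition G3_edges :: "(nat \<times> nat) list" where
  "G3_edges = [
     (0, 4), (0, 6), (0, 7), (1, 5), (1, 6), (1, 7), (2, 6), (2, 7), (2, 8), (3, 7), (3, 8),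
     (3, 9), (4, 8), (4, 9), (5, 8), (5, 9), (6, 9)]"

definition G3_vertices :: "nat list" where
  "G3_vertices = [0, 1, 2, 3, 4, 5, 6, 7, 8, 9]"

lemmas G3_defs = G3_edges_def G3_vertices_def

lemma G3_graph_check: "graph_check G3_edges G3_vertices"
  by (simp add: graph_check_def G3_defs)

lemma G3_obstructs: "obstructs G3_edges G3_vertices
  [
    ((0, 4), [(0, M1), (1, M1)], Z0), ((0, 6), [(0, P1)], Z0), ((0, 7), [(1, P1)], Z0), ((1, 5),
    [(2, P1)], Z0), ((1, 6), [(3, P1)], Z0), ((1, 7), [(2, M1), (3, M1)], Z0), ((2, 6), [(4, P1)],
    Z0), ((2, 7), [(4, M1), (5, M1)], Z0), ((2, 8), [(5, P1)], Z0), ((3, 7), [(1, M1), (2, P1),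
    (3, P1), (4, P1), (5, P1)], Z0), ((3, 8), [(5, M1), (6, M1), (7, M1)], Z0), ((3, 9), [(1, P1),
    (2, M1), (3, M1), (4, M1), (6, P1), (7, P1)], P1), ((4, 8), [(6, P1)], Z0), ((4, 9), [(0, M1),
    (1, M1), (6, M1)], Z0), ((5, 8), [(7, P1)], Z0), ((5, 9), [(2, P1), (7, M1)], Z0), ((6, 9),
    [(0, P1), (3, P1), (4, P1)], Z0)]
  [
    (0, [(P1, [0, 2, 4])]), (1, [(P1, [1, 2, 4]), (M1, [1, 3, 4])]), (2, [(P1, [0, 2, 4]), (M1,
    [0, 2, 5]), (M1, [1, 3, 4]), (P1, [1, 3, 5])]), (3, [(M1, [0, 0, 7]), (P1, [0, 1, 7]), (P1,
    [0, 4, 7]), (P1, [1, 1, 6]), (M1, [1, 1, 7]), (M1, [1, 2, 6]), (M1, [1, 3, 6]), (P1, [1, 3,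
    7]), (P1, [1, 4, 6]), (P1, [2, 3, 6]), (P1, [2, 4, 6]), (M1, [3, 3, 6]), (P1, [3, 4, 7]), (P1,
    [4, 4, 7])]), (4, [(P1, [0, 2, 6]), (P1, [1, 2, 4]), (M1, [1, 2, 6]), (P1, [2, 3, 6]), (P1,
    [2, 4, 6]), (P1, [3, 3, 6]), (P1, [4, 4, 6])]), (5, [(M1, [0, 0, 7]), (P1, [0, 1, 7]), (P1,
    [0, 4, 7]), (P1, [1, 2, 4]), (M1, [1, 3, 7]), (P1, [1, 4, 7]), (P1, [3, 3, 7]), (P1, [3, 4,
    7])]), (6, [(P1, [0, 2, 4]), (M1, [1, 3, 4])]), (8, [(M1, [0, 0, 7]), (P1, [0, 1, 7]), (M1,
    [0, 2, 5]), (P1, [0, 2, 6]), (P1, [0, 4, 7]), (M1, [1, 2, 6]), (P1, [1, 3, 5]), (M1, [1, 3,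
    7]), (P1, [1, 4, 7]), (P1, [2, 3, 6]), (P1, [2, 4, 6]), (P1, [3, 3, 6]), (P1, [3, 3, 7]), (P1,
    [3, 4, 7]), (P1, [4, 4, 6])]), (9, [(P1, [0, 0, 2]), (M1, [0, 1, 2]), (M1, [0, 2, 4]), (P1,
    [1, 2, 3]), (P1, [1, 3, 3]), (P1, [1, 4, 4]), (M1, [2, 3, 3]), (M1, [2, 3, 4])])]"
  by (simp only: obstructs_simps G3_defs cong: if_weak_cong trit.case_cong_weak)

text \<open>In the last certificate, for the edge 69, each list has four or seven entries. An entry
  written twice stands for the coefficient 2 = -1, so the weights still add up to 1 modulo 3 before
  mirroring.\<close>

lemma G3_deletions:
  "list_all2 (\<lambda>e. certifies G3_edges G3_vertices e (\<lambda>x. x))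
  G3_edges [
    ([((1,6),16394,[24614]), ((3,9),27136,[24594]), ((3,7),21888,[23122]), ((0,7),27240,[26017]),
    ((0,6),21908,[23122]), ((2,6),19041,[26017]), ((2,8),17794,[23122]), ((4,8),16896,[25889]),
    ((5,8),18433,[20497])], [((1,5),[24609]), ((1,7),[20505]), ((2,7),[20497]), ((3,8),[26017]),
    ((4,9),[23058]), ((5,9),[24609]), ((6,9),[20498])]),
    ([((0,4),17664,[18709]), ((0,7),18944,[17962]), ((1,7),16394,[16682]), ((5,8),24577,[16917]),
    ((2,8),21122,[16938]), ((2,7),24929,[16677]), ((3,7),21652,[18709]), ((3,9),26664,[17962]),
    ((6,9),16404,[16918])], [((1,5),[16917]), ((1,6),[16918]), ((2,6),[16922]), ((3,8),[20905]),
    ((4,8),[16682]), ((4,9),[18709]), ((5,9),[16681])]),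
    ([((0,4),16704,[20865]), ((0,6),17024,[25154]), ((3,9),27136,[25090]), ((3,7),21792,[20737]),
    ((1,7),27160,[25090]), ((1,6),21798,[20738]), ((2,6),18521,[20865]), ((2,8),17570,[25154]),
    ((5,8),18433,[20737])], [((1,5),[20737]), ((2,7),[22810]), ((3,8),[26145]), ((4,8),[20865]),
    ((4,9),[24834]), ((5,9),[25089]), ((6,9),[20993])]),
    ([((0,4),16704,[17701]), ((1,6),16386,[18970]), ((3,9),27136,[23066]), ((3,7),21792,[25893]),
    ((0,7),27162,[18970]), ((0,6),21669,[18021]), ((2,6),18520,[18842]), ((2,8),17568,[18021]),
    ((5,8),18432,[18981])], [((1,7),[17701]), ((2,7),[17702]), ((3,8),[18965]), ((4,8),[18842]),
    ((4,9),[17701]), ((5,9),[17690]), ((6,9),[18970])]),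
    ([((0,4),16704,[21826]), ((1,7),16386,[21826]), ((3,9),27136,[27266]), ((3,7),21792,[21825]),
    ((0,7),27161,[27265]), ((0,6),21670,[22146]), ((2,6),18521,[27237]), ((2,8),17570,[26242]),
    ((5,8),18433,[27265])], [((1,5),[27265]), ((2,7),[21914]), ((3,8),[27233]), ((4,8),[21826]),
    ((4,9),[26945]), ((5,9),[21825]), ((6,9),[22146])]),
    ([((0,4),16704,[22080]), ((1,6),16386,[22592]), ((3,9),27136,[27008]), ((3,7),21792,[22080]),
    ((0,7),27160,[27008]), ((0,6),21668,[21632]), ((2,6),18521,[26724]), ((2,8),17570,[25729]),
    ((5,8),18433,[22594])], [((1,5),[25728]), ((2,7),[21656]), ((3,8),[21632]), ((4,8),[26688]),
    ((4,9),[22080]), ((5,9),[25728]), ((6,9),[21632])]),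
    ([((0,4),16704,[22080]), ((1,6),16394,[25733]), ((0,6),20485,[21632]), ((0,7),25226,[27008]),
    ((3,9),27136,[27008]), ((3,7),21792,[22080]), ((2,7),18513,[22594]), ((2,8),17570,[25729]),
    ((5,8),18433,[22594])], [((1,5),[25728]), ((1,7),[22602]), ((3,8),[21632]), ((4,8),[26688]),
    ((4,9),[22080]), ((5,9),[25728]), ((6,9),[21632])]),
    ([((0,4),16704,[24912]), ((1,6),16394,[26196]), ((3,9),27136,[26192]), ((3,7),21792,[20832]),
    ((0,7),27160,[25232]), ((0,6),21668,[21152]), ((2,6),18513,[26194]), ((2,8),17570,[22945]),
    ((5,8),18433,[26194])], [((1,5),[22944]), ((1,7),[22952]), ((3,8),[25232]), ((4,8),[20832]),
    ((4,9),[24912]), ((5,9),[22944]), ((6,9),[21152])]),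
    ([((0,4),16704,[24834]), ((1,6),16394,[20738]), ((2,6),16416,[25110]), ((0,6),20501,[20993]),
    ((0,7),25258,[25154]), ((3,7),20801,[20865]), ((3,9),27136,[25090]), ((3,8),17538,[25154]),
    ((5,8),18433,[20737])], [((1,5),[20737]), ((1,7),[25090]), ((2,7),[20777]), ((4,8),[20865]),
    ((4,9),[24834]), ((5,9),[25089]), ((6,9),[20993])]),
    ([((0,4),16704,[24594]), ((0,7),16424,[20513]), ((0,6),17044,[24914]), ((1,6),16394,[24614]),
    ((2,6),20833,[20513]), ((2,8),25218,[24914]), ((3,9),27136,[24850]), ((3,8),21760,[21025]),
    ((5,8),18433,[20497])], [((1,5),[24609]), ((1,7),[20505]), ((2,7),[24594]), ((4,8),[21153]),
    ((4,9),[24594]), ((5,9),[24609]), ((6,9),[20513])]),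
    ([((0,4),16704,[23058]), ((1,6),16394,[24614]), ((3,9),27136,[25889]), ((3,7),21760,[23058]),
    ((0,7),27176,[25889]), ((0,6),21652,[22610]), ((2,6),18529,[25761]), ((2,8),17538,[22610]),
    ((5,8),18433,[20497])], [((1,5),[24609]), ((1,7),[20505]), ((2,7),[20497]), ((4,8),[25761]),
    ((4,9),[23058]), ((5,9),[24609]), ((6,9),[20498])]),
    ([((1,6),16394,[18788]), ((3,7),16512,[18832]), ((0,7),16488,[18016]), ((4,9),26624,[22880]),
    ((0,4),26880,[18832]), ((0,6),22164,[26256]), ((2,6),18785,[18786]), ((2,8),18050,[18065]),
    ((5,8),18433,[18786])], [((1,5),[18786]), ((1,7),[18072]), ((2,7),[18064]), ((3,8),[18016]),
    ((4,8),[18832]), ((5,9),[18064]), ((6,9),[26256])]),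
    ([((0,4),16640,[22624]), ((1,6),16394,[18532]), ((3,9),27136,[22880]), ((3,7),21888,[26256]),
    ((0,7),27240,[22880]), ((0,6),21652,[25744]), ((2,6),18529,[18528]), ((2,8),17538,[17553]),
    ((5,8),18433,[18530])], [((1,5),[17552]), ((1,7),[17560]), ((2,7),[17552]), ((3,8),[18512]),
    ((4,9),[22624]), ((5,9),[17552]), ((6,9),[25744])]),
    ([((0,4),16640,[19049]), ((1,6),16394,[18538]), ((3,9),26624,[22634]), ((3,7),21632,[25749]),
    ((0,7),26728,[18537]), ((0,6),22164,[17814]), ((2,6),18785,[19049]), ((2,8),18050,[17814]),
    ((5,8),18433,[18537])], [((1,5),[18537]), ((1,7),[17558]), ((2,7),[17562]), ((3,8),[18517]),
    ((4,8),[19049]), ((5,9),[17557]), ((6,9),[25749])]),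
    ([((0,4),17664,[17556]), ((1,6),16394,[18537]), ((2,8),17024,[18836]), ((2,6),16736,[18024]),
    ((0,6),21141,[18836]), ((0,7),26730,[18536]), ((3,7),21633,[25750]), ((3,9),26626,[22633]),
    ((5,9),16385,[18536])], [((1,5),[18536]), ((1,7),[17556]), ((2,7),[17560]), ((3,8),[18516]),
    ((4,8),[18024]), ((4,9),[17556]), ((6,9),[25750])]),
    ([((0,4),17664,[21764]), ((1,6),16394,[27145]), ((3,9),26624,[27140]), ((3,7),21632,[21768]),
    ((0,7),26728,[27144]), ((0,6),21140,[23044]), ((2,6),16737,[27032]), ((2,8),17026,[27145]),
    ((5,8),16385,[27144])], [((1,5),[27144]), ((1,7),[21764]), ((2,7),[22116]), ((3,8),[27016]),
    ((4,8),[21764]), ((4,9),[25864]), ((6,9),[23044])]),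
    ([((0,4),17664,[17664,17664,26689,26689]), ((1,6),16394,[16394,16394,21636,21636]),
    ((3,9),26624,[20480,20480,16448,16448,20544,16449,16449]),
    ((3,7),21632,[21632,21632,26689,26689]),
    ((0,7),26728,[26728,26728,16389,16389,24897,24897,24929]),
    ((0,6),21140,[24929,24929,17664,17664,22953,22953,22937]),
    ((2,6),24929,[24929,24929,26728,26696,26696,18944,18944]),
    ((2,8),21122,[16384,16384,17664,17664]),
    ((5,8),24577,[18496,18496,20544,16448,16448,20480,20480])],
    [((1,5),[26688,26688,16384,16384]), ((1,7),[21632,21632,16385,16385]),
    ((2,7),[24929,24929,26721,26721,21636,21636,22937]),
    ((3,8),[20480,16448,16448,16385,16385,18432,18432]), ((4,8),[24641,24641,17408,17408]),
    ((4,9),[17408,17408,26689,26689]), ((5,9),[16448,26688,26688,24641,24641,16384,16384])])]"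
  by (simp only: G3_defs list.rel_inject certifies_simps cong: if_weak_cong trit.case_cong_weak)

lemma G3_contractions:
  "list_all2 (\<lambda>e. certifies G3_edges G3_vertices e (merge e))
  G3_edges [
    ([((1,6),65546,[73834]), ((3,9),108544,[91242]), ((3,7),87168,[104597]),
    ((0,7),108648,[73833]), ((0,6),86676,[102549]), ((2,6),74081,[74345]), ((2,8),70274,[70038]),
    ((5,8),73729,[73833])], [((1,5),[73833]), ((1,7),[69782]), ((2,7),[69786]), ((3,8),[73813]),
    ((4,8),[74345]), ((4,9),[90218]), ((5,9),[69781]), ((6,9),[102549])]),
    ([((0,4),66816,[99458]), ((1,6),65546,[100422]), ((3,9),108544,[104513]),
    ((3,7),87168,[83073]), ((0,7),108648,[104529]), ((2,6),74081,[83521]), ((2,8),70274,[100738]),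
    ((5,8),73729,[83073])], [((1,5),[83073]), ((1,7),[83081]), ((2,7),[91298]), ((3,8),[100418]),
    ((4,8),[83521]), ((4,9),[99458]), ((5,9),[100417]), ((6,9),[84033])]),
    ([((0,4),66816,[98562]), ((1,6),65546,[98566]), ((3,9),108544,[99842]), ((3,7),87168,[84225]),
    ((0,6),86676,[90722]), ((2,6),74081,[102801]), ((2,8),70274,[98818]), ((5,8),73729,[82433])],
    [((1,5),[82433]), ((1,7),[98562]), ((2,7),[90722]), ((3,8),[102785]), ((4,8),[98562]),
    ((4,9),[84225]), ((5,9),[98561]), ((6,9),[82434])]),
    ([((0,4),65856,[106818]), ((1,6),75778,[108162]), ((2,8),67744,[108162]),
    ((2,6),66648,[107110]), ((0,6),86181,[86657]), ((0,7),107034,[107138]), ((3,7),86304,[86338]),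
    ((3,9),107008,[107137])], [((1,7),[86337]), ((2,7),[86425]), ((3,8),[107106]),
    ((4,8),[86337]), ((4,9),[106818]), ((5,8),[107138]), ((5,9),[103041]), ((6,9),[86657])]),
    ([((0,4),65856,[106560]), ((1,5),70656,[102528]), ((2,8),67744,[107648]),
    ((2,6),66648,[88128]), ((0,6),86181,[86144]), ((0,7),107034,[106880]), ((3,7),86304,[86592]),
    ((3,9),107008,[106560])], [((1,7),[86170]), ((2,7),[86168]), ((3,8),[86144]),
    ((4,8),[106560]), ((4,9),[86592]), ((5,8),[88128]), ((5,9),[102528]), ((6,9),[86144])]),
    ([((0,4),65856,[84288]), ((1,5),70656,[99968]), ((2,8),67744,[100992]), ((2,6),66648,[99940]),
    ((0,6),84134,[84608]), ((0,7),99865,[99968]), ((3,7),86304,[91456]), ((3,9),107008,[105088])],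
    [((1,6),[99942]), ((2,7),[84376]), ((3,8),[99936]), ((4,8),[84288]), ((4,9),[99648]),
    ((5,8),[99968]), ((5,9),[91456]), ((6,9),[84608])]),
    ([((0,4),66816,[99648]), ((1,6),65546,[91777]), ((3,9),108544,[104768]),
    ((3,7),87168,[83328]), ((0,7),108648,[100928]), ((0,6),86676,[84608]), ((2,8),70274,[91777]),
    ((5,8),73729,[104770])], [((1,5),[104770]), ((1,7),[104768]), ((2,7),[91816]),
    ((3,8),[100928]), ((4,8),[83328]), ((4,9),[99648]), ((5,9),[91776]), ((6,9),[84608])]),
    ([((0,4),66816,[83521]), ((1,6),65546,[83074]), ((0,6),81957,[84033]),
    ((0,7),100890,[100738]), ((3,9),108544,[104513]), ((3,7),87168,[83073]),
    ((2,8),70274,[100738]), ((5,8),73729,[83073])], [((1,5),[83073]), ((1,7),[100418]),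
    ((2,6),[100454]), ((3,8),[100418]), ((4,8),[83521]), ((4,9),[99458]), ((5,9),[100417]),
    ((6,9),[84033])]),
    ([((0,4),66816,[92306]), ((1,6),65546,[98406]), ((3,9),108544,[103521]),
    ((3,7),87168,[92306]), ((0,7),108648,[103521]), ((0,6),86676,[90514]), ((2,6),74081,[103009]),
    ((5,8),73729,[82065])], [((1,5),[98401]), ((1,7),[82073]), ((2,7),[82065]), ((3,8),[82017]),
    ((4,8),[103009]), ((4,9),[92306]), ((5,9),[98401]), ((6,9),[82066])]),
    ([((0,4),66816,[99680]), ((1,6),65546,[104804]), ((3,9),108544,[104800]),
    ((0,7),108648,[100960]), ((0,6),86676,[84624]), ((2,6),74081,[104802]), ((2,8),70274,[91793]),
    ((5,8),73729,[104802])], [((1,5),[91792]), ((1,7),[91800]), ((2,7),[101008]),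
    ((3,8),[100960]), ((4,8),[83344]), ((4,9),[99680]), ((5,9),[91792]), ((6,9),[84624])]),
    ([((0,4),66816,[99754]), ((0,7),65704,[101034]), ((0,6),68180,[84565]), ((1,6),65546,[83370]),
    ((2,6),83361,[83369]), ((2,8),100930,[100950]), ((3,9),108544,[100778]),
    ((5,8),73729,[83369])], [((1,5),[83369]), ((1,7),[100950]), ((2,7),[100954]), ((3,7),[83285]),
    ((4,8),[83285]), ((4,9),[99754]), ((5,9),[100949]), ((6,9),[84565])]),
    ([((0,4),66816,[103073]), ((1,6),65546,[98342]), ((3,7),87168,[92242]),
    ((0,7),108648,[103585]), ((0,6),86676,[90450]), ((2,6),74081,[103073]), ((2,8),70274,[90450]),
    ((5,8),73729,[81937])], [((1,5),[81937]), ((1,7),[81945]), ((2,7),[81937]), ((3,8),[102561]),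
    ((4,8),[103073]), ((4,9),[92242]), ((5,9),[98337]), ((6,9),[81938])]),
    ([((1,6),65546,[76074]), ((2,6),65696,[71274]), ((0,6),82005,[76181]), ((3,9),108544,[92458]),
    ((3,7),87552,[103957]), ((0,7),108840,[76073]), ((0,4),71298,[71190]), ((5,8),73729,[76073])],
    [((1,5),[76073]), ((1,7),[71190]), ((2,7),[71194]), ((2,8),[76181]), ((3,8),[76053]),
    ((4,9),[70954]), ((5,9),[71189]), ((6,9),[103957])]),
    ([((0,4),108032,[75152]), ((1,6),65546,[74852]), ((3,7),66176,[75152]), ((0,7),65896,[72288]),
    ((0,6),88212,[104592]), ((2,6),74849,[74848]), ((2,8),71810,[71825]), ((5,8),73729,[74850])],
    [((1,5),[71824]), ((1,7),[71832]), ((2,7),[71824]), ((3,8),[74832]), ((3,9),[72288]),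
    ((4,8),[74896]), ((5,9),[71824]), ((6,9),[104592])]),
    ([((0,4),66816,[99592]), ((1,6),65546,[100873]), ((2,8),70274,[100873]),
    ((2,6),74081,[104856]), ((0,6),86676,[84484]), ((0,7),108648,[100872]), ((3,7),87168,[83208]),
    ((3,9),108544,[100868])], [((1,5),[100872]), ((1,7),[83204]), ((2,7),[91748]),
    ((3,8),[104840]), ((4,8),[83204]), ((4,9),[99592]), ((5,9),[91652]), ((6,9),[84484])]),
    ([((0,4),66816,[99626]), ((1,6),65546,[83242]), ((2,8),74368,[100906]),
    ((2,6),69984,[108970]), ((0,6),90773,[84501]), ((0,7),104554,[100906]), ((3,7),91265,[87637]),
    ((3,9),104450,[100886])], [((1,5),[100885]), ((1,7),[100886]), ((2,7),[83221]),
    ((3,8),[108970]), ((4,8),[83221]), ((4,9),[99626]), ((5,8),[108842]), ((6,9),[84501])]),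
    ([((0,4),70656,[75016]), ((1,6),65546,[67849]), ((3,7),66176,[67080]), ((0,7),65896,[67848]),
    ((0,6),76436,[72196]), ((2,6),99425,[66968]), ((2,8),84098,[100617]), ((5,8),98305,[67848])],
    [((1,5),[67848]), ((1,7),[67076]), ((2,7),[68196]), ((3,8),[66952]), ((3,9),[67844]),
    ((4,8),[67076]), ((4,9),[75016]), ((5,9),[67078])])]"
  by (simp only: G3_defs list.rel_inject certifies_simps cong: if_weak_cong trit.case_cong_weak)

definition G4_edges :: "(nat \<times> nat) list" where
  "G4_edges = [
     (0, 5), (0, 7), (0, 8), (1, 5), (1, 7), (1, 8), (2, 6), (2, 7), (2, 9), (3, 6), (3, 8),
     (3, 9), (4, 7), (4, 8), (4, 9), (5, 6), (5, 9)]"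

definition G4_vertices :: "nat list" where
  "G4_vertices = [0, 1, 2, 3, 4, 5, 6, 7, 8, 9]"

lemmas G4_defs = G4_edges_def G4_vertices_def

lemma G4_graph_check: "graph_check G4_edges G4_vertices"
  by (simp add: graph_check_def G4_defs)

lemma G4_obstructs: "obstructs G4_edges G4_vertices
  [
    ((0, 5), [(0, P1)], Z0), ((0, 7), [(0, M1), (1, M1)], Z0), ((0, 8), [(1, P1)], Z0), ((1, 5),
    [(2, P1)], Z0), ((1, 7), [(2, M1), (3, M1)], Z0), ((1, 8), [(3, P1)], Z0), ((2, 6), [(0, M1),
    (2, M1), (5, M1), (7, P1)], Z0), ((2, 7), [(0, P1), (2, P1), (4, M1), (5, P1), (7, M1)], Z0),
    ((2, 9), [(4, P1)], Z0), ((3, 6), [(5, P1)], Z0), ((3, 8), [(4, P1), (5, M1), (6, P1), (7,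
    P1)], Z0), ((3, 9), [(4, M1), (6, M1), (7, M1)], Z0), ((4, 7), [(1, P1), (3, P1), (4, P1), (5,
    M1), (7, P1)], Z0), ((4, 8), [(1, M1), (3, M1), (4, M1), (5, P1), (6, M1), (7, M1)], P1), ((4,
    9), [(6, P1)], Z0), ((5, 6), [(0, P1), (2, P1), (7, M1)], Z0), ((5, 9), [(7, P1)], Z0)]
  [
    (0, [(M1, [0, 3, 5]), (M1, [0, 5, 5]), (P1, [1, 3, 5]), (P1, [1, 5, 5])]), (1, [(M1, [1, 2,
    5]), (P1, [1, 3, 5]), (M1, [2, 5, 5]), (P1, [3, 5, 5])]), (2, [(M1, [0, 0, 3]), (M1, [0, 2,
    3]), (M1, [1, 2, 2]), (M1, [1, 2, 4]), (P1, [1, 2, 5]), (P1, [1, 4, 5]), (M1, [2, 3, 4]), (P1,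
    [3, 4, 4])]), (3, [(M1, [1, 2, 5]), (M1, [1, 2, 6]), (M1, [1, 3, 7]), (P1, [1, 5, 5]), (M1,
    [2, 3, 4]), (M1, [2, 3, 5]), (P1, [3, 4, 4]), (M1, [3, 4, 5]), (M1, [3, 5, 5])]), (4, [(M1,
    [1, 3, 6]), (M1, [1, 5, 6]), (M1, [3, 5, 6]), (M1, [5, 5, 6])]), (5, [(M1, [0, 3, 5]), (M1,
    [0, 5, 5]), (M1, [1, 2, 5]), (M1, [2, 5, 5]), (P1, [5, 5, 7])]), (6, [(M1, [1, 2, 5]), (P1,
    [1, 5, 5]), (M1, [2, 3, 5]), (M1, [3, 4, 5]), (M1, [3, 5, 5])]), (8, [(P1, [1, 3, 5]), (P1,
    [1, 5, 5]), (P1, [3, 5, 5])]), (9, [(M1, [1, 2, 4]), (M1, [1, 3, 6]), (P1, [1, 4, 5]), (M1,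
    [1, 5, 6]), (M1, [2, 3, 4]), (P1, [3, 4, 4]), (M1, [3, 5, 6]), (M1, [5, 5, 6]), (P1, [5, 5,
    7])])]"
  by (simp only: obstructs_simps G4_defs cong: if_weak_cong trit.case_cong_weak)

lemma G4_deletions:
  "list_all2 (\<lambda>e. certifies G4_edges G4_vertices e (\<lambda>x. x))
  G4_edges [
    ([((1,7),16394,[20566]), ((2,6),24608,[24738]), ((3,8),16544,[24737]), ((0,8),16984,[20566]),
    ((0,7),16804,[24745]), ((4,7),18944,[24913]), ((2,7),17489,[20561]), ((2,9),22658,[20626]),
    ((5,9),24577,[24737])], [((1,5),[20561]), ((1,8),[24745]), ((3,6),[20626]), ((3,9),[20562]),
    ((4,8),[21154]), ((4,9),[26705]), ((5,6),[20561])]),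
    ([((2,9),26752,[24720]), ((2,7),21576,[20580]), ((3,8),16544,[20640]), ((0,8),16978,[20817]),
    ((0,5),16801,[25250]), ((4,7),18944,[20816]), ((1,7),24964,[24728]), ((1,5),21066,[20817]),
    ((5,6),16424,[20580])], [((1,8),[25250]), ((2,6),[24728]), ((3,6),[24720]), ((3,9),[24656]),
    ((4,8),[25248]), ((4,9),[22608]), ((5,9),[20640])]),
    ([((2,9),26752,[24592]), ((2,7),21576,[20516]), ((3,8),16544,[20512]), ((1,8),16976,[24592]),
    ((1,5),16802,[25185]), ((4,7),18944,[20880]), ((0,7),24966,[25185]), ((0,5),21065,[20882]),
    ((5,6),16424,[20516])], [((1,7),[20882]), ((2,6),[24600]), ((3,6),[24592]), ((3,9),[24608]),
    ((4,8),[25184]), ((4,9),[22672]), ((5,9),[20512])]),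
    ([((1,7),16386,[20881]), ((2,9),26752,[24592]), ((2,7),21576,[20516]), ((3,8),16544,[20512]),
    ((0,8),16978,[24592]), ((4,7),18944,[20880]), ((0,7),24965,[24600]), ((0,5),20520,[20516]),
    ((5,6),16424,[20516])], [((1,8),[25186]), ((2,6),[24600]), ((3,6),[24592]), ((3,9),[24608]),
    ((4,8),[25184]), ((4,9),[22672]), ((5,9),[20512])]),
    ([((1,5),16386,[24738]), ((2,9),26752,[24722]), ((2,7),21576,[20581]), ((3,8),16544,[20641]),
    ((0,8),16978,[24658]), ((4,7),18944,[20818]), ((0,7),24964,[24730]), ((0,5),20521,[20641]),
    ((5,6),16424,[20581])], [((1,8),[20561]), ((2,6),[24730]), ((3,6),[20561]), ((3,9),[24658]),
    ((4,8),[25249]), ((4,9),[24737]), ((5,9),[20641])]),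
    ([((1,5),16386,[24581]), ((2,9),26752,[24584]), ((2,7),21576,[20488]), ((3,8),16544,[20504]),
    ((0,8),16976,[24612]), ((4,7),18944,[20872]), ((0,7),24966,[24581]), ((0,5),20521,[20490]),
    ((5,6),16424,[20504])], [((1,7),[20490]), ((2,6),[24580]), ((3,6),[24612]), ((3,9),[24580]),
    ((4,8),[25156]), ((4,9),[22664]), ((5,9),[20488])]),
    ([((1,5),16394,[24713]), ((2,9),26752,[24712]), ((2,7),21568,[20548]), ((3,8),16544,[20628]),
    ((0,8),16984,[24680]), ((4,7),18944,[20808]), ((0,7),24962,[24713]), ((0,5),20517,[20550]),
    ((5,6),16416,[20628])], [((1,7),[20550]), ((1,8),[24708]), ((3,6),[24680]), ((3,9),[20548]),
    ((4,8),[25220]), ((4,9),[24708]), ((5,9),[20552])]),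
    ([((1,5),16394,[17673]), ((2,6),16416,[25860]), ((3,9),26656,[23064]), ((3,8),21648,[25956]),
    ((0,8),27240,[23192]), ((4,7),18944,[18952]), ((0,7),17666,[17673]), ((0,5),20629,[18950]),
    ((5,6),16528,[25956])], [((1,7),[18950]), ((1,8),[17668]), ((2,9),[23048]), ((3,6),[23192]),
    ((4,8),[17672]), ((4,9),[17668]), ((5,9),[18952])]),
    ([((1,5),16394,[27222]), ((2,7),16416,[27233]), ((3,9),26624,[27297]), ((3,8),21632,[21906]),
    ((0,8),27208,[27222]), ((4,7),18944,[23201]), ((0,7),17682,[25938]), ((0,5),20645,[21929]),
    ((5,6),16544,[21922])], [((1,7),[27217]), ((1,8),[21929]), ((2,6),[21906]), ((3,6),[27233]),
    ((4,8),[21921]), ((4,9),[25938]), ((5,9),[23201])]),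
    ([((1,5),16394,[24601]), ((2,9),26752,[24616]), ((2,7),21600,[20516]), ((3,8),16512,[20520]),
    ((0,8),16968,[24600]), ((4,7),18944,[20904]), ((0,7),24978,[24601]), ((0,5),20517,[20516]),
    ((5,6),16416,[20516])], [((1,7),[24600]), ((1,8),[20516]), ((2,6),[24600]), ((3,9),[24596]),
    ((4,8),[25172]), ((4,9),[22696]), ((5,9),[20520])]),
    ([((0,8),16904,[25176]), ((1,5),16394,[24921]), ((3,9),16512,[21144]), ((2,9),26688,[24932]),
    ((2,7),21664,[21160]), ((4,7),18944,[21156]), ((0,7),24914,[24921]), ((0,5),20645,[21158]),
    ((5,6),16544,[21160])], [((1,7),[21158]), ((1,8),[24916]), ((2,6),[24916]), ((3,6),[24932]),
    ((4,8),[20900]), ((4,9),[25176]), ((5,9),[20900])]),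
    ([((1,5),16394,[24601]), ((2,9),26624,[24616]), ((2,7),21536,[20516]), ((3,8),16512,[20580]),
    ((0,8),16968,[24728]), ((4,7),18944,[20776]), ((0,7),24850,[24601]), ((0,5),20645,[20518]),
    ((5,6),16544,[20580])], [((1,7),[20518]), ((1,8),[24596]), ((2,6),[24600]), ((3,6),[24728]),
    ((4,8),[25108]), ((4,9),[24596]), ((5,9),[20520])]),
    ([((1,5),16394,[17706]), ((2,9),27136,[23066]), ((2,7),21792,[25893]), ((0,7),27154,[23066]),
    ((3,8),17024,[19045]), ((4,8),18432,[18970]), ((0,8),17736,[17818]), ((0,5),20645,[19045]),
    ((5,6),16544,[19045])], [((1,7),[17705]), ((1,8),[18966]), ((2,6),[18965]), ((3,6),[17818]),
    ((3,9),[17690]), ((4,9),[17701]), ((5,9),[25893])]),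
    ([((1,5),16394,[16682]), ((2,9),27136,[16933]), ((2,7),21792,[16682]), ((3,8),17024,[16997]),
    ((0,8),16712,[16794]), ((4,7),18432,[24869]), ((0,7),25106,[21018]), ((0,5),20645,[16997]),
    ((5,6),16544,[16997])], [((1,7),[16681]), ((1,8),[16918]), ((2,6),[16917]), ((3,6),[16794]),
    ((3,9),[16677]), ((4,9),[21018]), ((5,9),[24869])]),
    ([((1,5),16394,[16682]), ((2,9),25088,[21018]), ((2,7),20768,[24869]), ((3,8),17024,[16997]),
    ((0,8),18760,[16794]), ((4,7),18432,[17705]), ((0,7),26130,[21018]), ((0,5),20645,[16997]),
    ((5,6),16544,[16997])], [((1,7),[16917]), ((1,8),[16677]), ((2,6),[16917]), ((3,6),[16794]),
    ((3,9),[16677]), ((4,8),[18966]), ((5,9),[24869])]),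
    ([((1,5),16394,[17494]), ((0,5),20485,[25681]), ((2,6),16416,[18593]), ((2,9),26752,[22690]),
    ((2,7),21584,[25681]), ((3,8),16544,[18593]), ((0,8),16984,[17494]), ((0,7),24994,[22690]),
    ((4,7),18944,[18769])], [((1,7),[17489]), ((1,8),[18601]), ((3,6),[17490]), ((3,9),[17506]),
    ((4,8),[18082]), ((4,9),[17489]), ((5,9),[25681])]),
    ([((1,5),16394,[17946]), ((2,9),25088,[17957]), ((2,7),20768,[18730]), ((3,8),17024,[18021]),
    ((0,8),18760,[18842]), ((4,7),26624,[18725]), ((0,7),17938,[17946]), ((0,5),16549,[18021]),
    ((5,6),16544,[18021])], [((1,7),[18729]), ((1,8),[18725]), ((2,6),[17941]), ((3,6),[18842]),
    ((3,9),[18714]), ((4,8),[17946]), ((4,9),[25893])])]"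
  by (simp only: G4_defs list.rel_inject certifies_simps cong: if_weak_cong trit.case_cong_weak)

lemma G4_contractions:
  "list_all2 (\<lambda>e. certifies G4_edges G4_vertices e (merge e))
  G4_edges [
    ([((1,5),65546,[100737]), ((2,9),107008,[98368]), ((2,7),86304,[82064]),
    ((3,8),66176,[82048]), ((0,8),67912,[83524]), ((4,7),75776,[83520]), ((0,7),99858,[98400]),
    ((5,6),65696,[82064])], [((1,7),[83522]), ((1,8),[100744]), ((2,6),[98400]), ((3,6),[98368]),
    ((3,9),[98432]), ((4,8),[100736]), ((4,9),[90688]), ((5,9),[82048])]),
    ([((1,5),65546,[98373]), ((2,9),107008,[98368]), ((2,7),86304,[82064]), ((3,8),66176,[82048]),
    ((0,8),67912,[98372]), ((4,7),75776,[83520]), ((0,5),82085,[82064]), ((5,6),65696,[82064])],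
    [((1,7),[82058]), ((1,8),[82056]), ((2,6),[98400]), ((3,6),[98368]), ((3,9),[98432]),
    ((4,8),[100736]), ((4,9),[90688]), ((5,9),[82048])]),
    ([((1,5),65546,[98405]), ((2,9),107008,[98368]), ((2,7),86304,[82064]), ((3,8),66176,[82048]),
    ((4,7),75776,[83520]), ((0,7),99858,[100736]), ((0,5),82085,[82074]), ((5,6),65696,[82064])],
    [((1,7),[82066]), ((1,8),[82074]), ((2,6),[82048]), ((3,6),[98368]), ((3,9),[98432]),
    ((4,8),[100736]), ((4,9),[90688]), ((5,9),[82048])]),
    ([((2,9),107008,[98368]), ((2,7),86304,[82064]), ((3,8),66176,[82048]), ((0,8),67912,[98372]),
    ((4,7),75776,[83520]), ((0,7),99858,[98401]), ((0,5),82085,[82056]), ((5,6),65696,[82064])],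
    [((1,7),[82066]), ((1,8),[82056]), ((2,6),[98400]), ((3,6),[98368]), ((3,9),[98432]),
    ((4,8),[100736]), ((4,9),[90688]), ((5,9),[82048])]),
    ([((2,9),107008,[98368]), ((2,7),86304,[82064]), ((3,8),66176,[82048]), ((0,8),67912,[98368]),
    ((4,7),75776,[83520]), ((0,7),99861,[98402]), ((0,5),82082,[82048]), ((5,6),65696,[82064])],
    [((1,5),[98402]), ((1,8),[100744]), ((2,6),[82048]), ((3,6),[98368]), ((3,9),[98432]),
    ((4,8),[100736]), ((4,9),[90688]), ((5,9),[82048])]),
    ([((2,9),107008,[90640]), ((2,7),86304,[102688]), ((3,8),66176,[74336]),
    ((0,8),67909,[70034]), ((4,7),75776,[75040]), ((0,7),99864,[90640]), ((0,5),82082,[102688]),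
    ((5,6),65696,[74336])], [((1,5),[70034]), ((1,7),[75048]), ((2,6),[74256]), ((3,6),[70032]),
    ((3,9),[69904]), ((4,8),[72208]), ((4,9),[69920]), ((5,9),[102688])]),
    ([((0,8),66088,[66598]), ((1,5),65546,[66598]), ((0,5),86021,[107553]),
    ((0,7),106770,[88082]), ((2,9),100480,[83986]), ((3,6),65696,[66594]), ((2,7),87072,[107553]),
    ((4,7),68096,[67873])], [((1,7),[66593]), ((1,8),[67609]), ((3,8),[67601]), ((3,9),[66706]),
    ((4,8),[67090]), ((4,9),[66593]), ((5,6),[107553]), ((5,9),[67602])]),
    ([((0,8),66088,[74310]), ((1,5),65546,[74310]), ((0,5),86021,[102977]),
    ((0,7),106770,[90498]), ((2,9),100480,[90498]), ((3,6),65696,[70289]), ((2,6),73808,[74082]),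
    ((4,7),68096,[74306])], [((1,7),[74305]), ((1,8),[70025]), ((3,8),[74082]), ((3,9),[70209]),
    ((4,8),[70017]), ((4,9),[76098]), ((5,6),[70018]), ((5,9),[102977])]),
    ([((1,5),65546,[99866]), ((2,7),86304,[84266]), ((3,8),66176,[83557]), ((0,8),67912,[100762]),
    ((4,7),75776,[84261]), ((0,7),99858,[99866]), ((0,5),82085,[83557]), ((5,6),65696,[83557])],
    [((1,7),[84265]), ((1,8),[84261]), ((2,6),[100634]), ((3,6),[100762]), ((3,9),[100634]),
    ((4,8),[99866]), ((4,9),[91429]), ((5,9),[84266])]),
    ([((1,5),65546,[98457]), ((0,5),86021,[82022]), ((2,9),100480,[98472]), ((2,7),83040,[82020]),
    ((3,8),69776,[90260]), ((0,8),74344,[102504]), ((0,7),98706,[98457]), ((4,7),68096,[82280])],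
    [((1,7),[82022]), ((1,8),[98452]), ((2,6),[98456]), ((3,9),[82004]), ((4,8),[98964]),
    ((4,9),[98452]), ((5,6),[90260]), ((5,9),[82024])]),
    ([((1,5),65546,[106889]), ((0,5),86021,[86404]), ((2,9),100480,[102788]),
    ((2,7),83040,[90712]), ((3,6),73760,[90712]), ((0,8),74344,[107080]), ((0,7),98706,[106889]),
    ((4,7),68096,[86596])], [((1,7),[86598]), ((1,8),[106884]), ((2,6),[102820]),
    ((3,9),[107080]), ((4,8),[106888]), ((4,9),[88388]), ((5,6),[86600]), ((5,9),[86404])]),
    ([((0,8),66184,[106502]), ((1,5),65546,[106502]), ((0,5),86021,[86017]),
    ((0,7),106818,[106498]), ((3,6),73760,[106513]), ((2,9),108640,[106513]),
    ((2,7),87168,[86018]), ((4,7),68096,[86337])], [((1,7),[86017]), ((1,8),[106498]),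
    ((2,6),[106497]), ((3,8),[86017]), ((4,8),[107138]), ((4,9),[88129]), ((5,6),[86018]),
    ((5,9),[86017])]),
    ([((1,5),65546,[66074]), ((2,9),107008,[66085]), ((2,7),86304,[65834]), ((0,7),99858,[82458]),
    ((3,8),66176,[66149]), ((0,8),67912,[65946]), ((0,5),82085,[66149]), ((5,6),65696,[66149])],
    [((1,7),[66069]), ((1,8),[65829]), ((2,6),[66069]), ((3,6),[65946]), ((3,9),[65829]),
    ((4,8),[68118]), ((4,9),[82458]), ((5,9),[98597])]),
    ([((1,5),65546,[86346]), ((2,9),107008,[107141]), ((2,7),86304,[86421]),
    ((0,7),109074,[107114]), ((3,8),66176,[107146]), ((0,8),70984,[102730]),
    ((0,5),82085,[86421]), ((5,6),65696,[86421])], [((1,7),[107141]), ((1,8),[86341]),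
    ((2,6),[107114]), ((3,6),[86341]), ((3,9),[86405]), ((4,7),[88393]), ((4,9),[102730]),
    ((5,9),[90757])]),
    ([((1,5),65546,[70170]), ((2,9),103936,[70181]), ((2,7),92448,[74026]),
    ((0,7),102930,[86554]), ((3,8),66176,[70245]), ((0,8),74056,[74138]), ((0,5),82085,[70245]),
    ((5,6),65696,[70245])], [((1,7),[74025]), ((1,8),[70166]), ((2,6),[70165]), ((3,6),[74138]),
    ((3,9),[74010]), ((4,7),[106789]), ((4,8),[70170]), ((5,9),[106789])]),
    ([((0,8),67720,[67718]), ((1,5),65546,[67718]), ((2,9),107008,[83330]), ((2,6),86304,[74898]),
    ((3,6),66176,[67713]), ((0,5),73813,[66633]), ((0,7),70690,[74898]), ((4,7),75776,[67714])],
    [((1,7),[67713]), ((1,8),[66633]), ((2,7),[71777]), ((3,8),[66626]), ((3,9),[68161]),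
    ((4,8),[66625]), ((4,9),[74882]), ((5,9),[100929])]),
    ([((1,5),65546,[83206]), ((2,7),65696,[100945]), ((3,8),68096,[100865]),
    ((0,8),75016,[83206]), ((4,7),106496,[103681]), ((0,7),86098,[83362]),
    ((0,5),101029,[100945]), ((5,6),66080,[100881])], [((1,7),[83201]), ((1,8),[100873]),
    ((2,6),[100865]), ((2,9),[83362]), ((3,6),[83202]), ((3,9),[83458]), ((4,8),[92674]),
    ((4,9),[83201])])]"
  by (simp only: G4_defs list.rel_inject certifies_simps cong: if_weak_cong trit.case_cong_weak)

definition G5_edges :: "(nat \<times> nat) list" where
  "G5_edges = [
     (0, 3), (0, 5), (0, 6), (1, 4), (1, 6), (1, 8), (2, 5), (2, 6), (2, 7), (3, 7), (3, 8),
     (3, 9), (4, 7), (4, 9), (5, 8), (5, 9), (6, 9)]"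

definition G5_vertices :: "nat list" where
  "G5_vertices = [0, 1, 2, 3, 4, 5, 6, 7, 8, 9]"

lemmas G5_defs = G5_edges_def G5_vertices_def

lemma G5_graph_check: "graph_check G5_edges G5_vertices"
  by (simp add: graph_check_def G5_defs)

lemma G5_obstructs: "obstructs G5_edges G5_vertices
  [
    ((0, 3), [(0, M1), (1, M1)], Z0), ((0, 5), [(0, P1)], Z0), ((0, 6), [(1, P1)], Z0), ((1, 4),
    [(2, M1), (3, M1)], Z0), ((1, 6), [(2, P1)], Z0), ((1, 8), [(3, P1)], Z0), ((2, 5), [(0, M1),
    (5, P1), (6, P1)], Z0), ((2, 6), [(1, M1), (2, M1), (7, P1)], Z0), ((2, 7), [(0, P1), (1, P1),
    (2, P1), (5, M1), (6, M1), (7, M1)], Z0), ((3, 7), [(0, M1), (1, M1), (3, P1), (4, P1), (5,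
    P1), (6, P1), (7, P1)], Z0), ((3, 8), [(3, M1), (5, M1)], Z0), ((3, 9), [(4, M1), (6, M1), (7,
    M1)], Z0), ((4, 7), [(2, M1), (3, M1), (4, M1)], P1), ((4, 9), [(4, P1)], Z0), ((5, 8), [(5,
    P1)], Z0), ((5, 9), [(6, P1)], Z0), ((6, 9), [(7, P1)], Z0)]
  [
    (0, [(P1, [0, 2, 3]), (M1, [0, 2, 4]), (M1, [0, 3, 7]), (M1, [1, 2, 5]), (P1, [1, 3, 7])]),
    (1, [(M1, [1, 2, 5]), (P1, [2, 2, 4]), (P1, [2, 4, 5])]), (2, [(M1, [0, 0, 3]), (M1, [0, 2,
    3]), (P1, [0, 3, 5]), (M1, [0, 3, 7]), (M1, [1, 2, 3]), (M1, [1, 2, 5]), (M1, [1, 3, 3]), (M1,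
    [1, 3, 5]), (M1, [2, 2, 3]), (P1, [2, 2, 4]), (P1, [2, 3, 6]), (P1, [2, 4, 5]), (P1, [3, 5,
    6]), (M1, [3, 5, 7])]), (3, [(P1, [0, 2, 3]), (M1, [0, 2, 5]), (M1, [1, 2, 4]), (M1, [2, 3,
    6]), (P1, [2, 5, 6])]), (4, [(M1, [1, 3, 5]), (M1, [2, 3, 4]), (P1, [2, 4, 5]), (M1, [3, 3,
    4])]), (5, [(P1, [0, 2, 3]), (M1, [0, 2, 4]), (M1, [0, 3, 7]), (M1, [1, 2, 6]), (M1, [1, 3,
    6]), (M1, [3, 6, 6]), (M1, [3, 6, 7])]), (6, [(M1, [1, 2, 5]), (P1, [1, 3, 7]), (P1, [2, 2,
    4]), (P1, [2, 4, 5]), (P1, [3, 3, 7]), (M1, [3, 6, 7]), (M1, [3, 7, 7])]), (7, [(M1, [1, 2,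
    5]), (M1, [2, 2, 3]), (P1, [2, 2, 4]), (M1, [2, 3, 3]), (P1, [2, 4, 5])]), (9, [(M1, [1, 2,
    6]), (M1, [1, 3, 6]), (P1, [1, 3, 7]), (M1, [2, 3, 4]), (P1, [2, 4, 5]), (M1, [3, 3, 4]), (P1,
    [3, 3, 7]), (M1, [3, 6, 6]), (M1, [3, 6, 7]), (M1, [3, 7, 7])])]"
  by (simp only: obstructs_simps G5_defs cong: if_weak_cong trit.case_cong_weak)

lemma G5_deletions:
  "list_all2 (\<lambda>e. certifies G5_edges G5_vertices e (\<lambda>x. x))
  G5_edges [
    ([((1,8),16928,[22048]), ((1,6),16658,[26897]), ((0,6),21033,[23072]), ((0,5),24854,[25872]),
    ((2,5),21545,[22054]), ((2,7),26642,[26897]), ((3,9),26752,[27168]), ((3,7),21600,[21792]),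
    ((4,7),16513,[22050])], [((1,4),[22050]), ((2,6),[26905]), ((3,8),[21776]), ((4,9),[26896]),
    ((5,8),[26896]), ((5,9),[25872]), ((6,9),[23072])]),
    ([((3,9),27136,[23106]), ((0,3),27216,[23106]), ((0,6),21920,[25985]), ((4,7),16897,[19009]),
    ((2,7),16674,[17810]), ((2,6),16921,[19041]), ((1,6),18502,[19010]), ((1,8),17544,[17794]),
    ((5,8),18436,[18762])], [((1,4),[19009]), ((2,5),[18762]), ((3,7),[19041]), ((3,8),[19009]),
    ((4,9),[17793]), ((5,9),[18049]), ((6,9),[25985])]),
    ([((1,4),16394,[24602]), ((2,6),20482,[20518]), ((3,8),16904,[24857]), ((3,9),26752,[25690]),
    ((0,3),27288,[24857]), ((0,5),21860,[21030]), ((2,5),24728,[24601]), ((2,7),16485,[20645]),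
    ((4,7),16522,[20522])], [((1,6),[20517]), ((1,8),[24597]), ((3,7),[24597]), ((4,9),[24602]),
    ((5,8),[21030]), ((5,9),[22693]), ((6,9),[20517])]),
    ([((1,8),16928,[27302]), ((1,6),16656,[21849]), ((0,6),21026,[22122]), ((3,9),26752,[27302]),
    ((0,3),26772,[27029]), ((0,5),17737,[21865]), ((2,5),16518,[27030]), ((2,7),16456,[22122]),
    ((4,7),16512,[22182])], [((2,6),[27029]), ((3,7),[27029]), ((3,8),[27286]), ((4,9),[26969]),
    ((5,8),[21865]), ((5,9),[25945]), ((6,9),[23206])]),
    ([((0,6),20488,[25761]), ((1,4),16386,[17442]), ((3,8),16898,[18706]), ((3,9),26752,[22610]),
    ((0,3),27282,[18706]), ((0,5),17765,[17953]), ((2,5),16538,[18518]), ((2,7),16481,[18465]),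
    ((4,7),16514,[17442])], [((1,8),[18449]), ((2,6),[17577]), ((3,7),[18449]), ((4,9),[18450]),
    ((5,8),[17953]), ((5,9),[17441]), ((6,9),[25761])]),
    ([((1,6),16386,[19024]), ((0,6),20489,[26016]), ((3,8),16896,[18976]), ((3,9),26752,[23120]),
    ((0,3),27280,[18960]), ((0,5),17766,[17696]), ((2,5),16537,[19030]), ((2,7),16482,[17825]),
    ((4,7),16513,[17696])], [((1,4),[17824]), ((2,6),[17833]), ((3,7),[18960]), ((4,9),[18960]),
    ((5,8),[17680]), ((5,9),[17696]), ((6,9),[26016])]),
    ([((0,5),17664,[21792]), ((1,8),16928,[22048]), ((1,6),16658,[26897]), ((3,9),26752,[27168]),
    ((0,3),26772,[26968]), ((0,6),21096,[22180]), ((2,6),16517,[26968]), ((2,7),16458,[22180]),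
    ((4,7),16513,[22050])], [((1,4),[22050]), ((3,7),[26968]), ((3,8),[27152]), ((4,9),[26896]),
    ((5,8),[21792]), ((5,9),[25872]), ((6,9),[23072])]),
    ([((1,8),16928,[22033]), ((1,6),16658,[26914]), ((0,6),21025,[22033]), ((3,9),26752,[27201]),
    ((0,3),26772,[27209]), ((0,5),17738,[21894]), ((2,5),16517,[27209]), ((2,7),16458,[21894]),
    ((4,7),16513,[21761])], [((1,4),[21761]), ((3,7),[27209]), ((3,8),[26914]), ((4,9),[27137]),
    ((5,8),[21761]), ((5,9),[25858]), ((6,9),[23041])]),
    ([((1,8),16928,[18986]), ((1,6),16658,[17686]), ((0,6),21033,[26153]), ((2,5),16392,[18714]),
    ((0,5),17668,[17701]), ((0,3),26642,[18970]), ((3,9),26752,[22806]), ((3,7),16450,[18986]),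
    ((4,7),16513,[17685])], [((1,4),[18985]), ((2,6),[17957]), ((3,8),[18970]), ((4,9),[18985]),
    ((5,8),[17701]), ((5,9),[17686]), ((6,9),[26153])]),
    ([((1,8),16928,[19104]), ((1,6),16658,[17745]), ((0,6),21033,[26208]), ((3,9),26752,[22928]),
    ((0,3),26768,[22928]), ((0,5),17734,[17760]), ((2,5),16521,[19110]), ((2,7),16450,[17745]),
    ((4,7),16513,[19106])], [((1,4),[17744]), ((2,6),[17753]), ((3,8),[19088]), ((4,9),[17744]),
    ((5,8),[17760]), ((5,9),[18016]), ((6,9),[26208])]),
    ([((1,8),16896,[18697]), ((1,6),16642,[17926]), ((0,6),21001,[25609]), ((3,9),26752,[22534]),
    ((0,3),26768,[22534]), ((0,5),17766,[17558]), ((2,5),16537,[18537]), ((2,7),16482,[17558]),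
    ((4,7),16513,[17413])], [((1,4),[17413]), ((2,6),[17413]), ((3,7),[18537]), ((4,9),[18441]),
    ((5,8),[17926]), ((5,9),[17414]), ((6,9),[25609])]),
    ([((0,3),16464,[16724]), ((1,8),17024,[17048]), ((1,6),16706,[16741]), ((0,6),21129,[17064]),
    ((0,5),24870,[16804]), ((2,5),21529,[16728]), ((2,7),26658,[17064]), ((4,7),21505,[16740]),
    ((4,9),26624,[17050])], [((1,4),[16740]), ((2,6),[16724]), ((3,7),[16724]), ((3,8),[16984]),
    ((5,8),[16804]), ((5,9),[20837]), ((6,9),[25242])]),
    ([((1,8),17024,[20889]), ((1,6),16706,[25190]), ((0,6),21129,[20649]), ((2,7),16416,[20649]),
    ((2,5),16408,[24666]), ((0,5),17700,[22693]), ((0,3),26706,[25690]), ((3,9),26626,[25690]),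
    ((4,9),16385,[24741])], [((1,4),[24741]), ((2,6),[24662]), ((3,7),[24662]), ((3,8),[20569]),
    ((5,8),[25190]), ((5,9),[22693]), ((6,9),[20570])]),
    ([((1,8),17024,[19088]), ((1,6),16706,[17761]), ((0,6),21129,[26272]), ((3,9),26624,[22864]),
    ((0,3),26704,[22864]), ((0,5),17702,[17824]), ((2,5),16409,[19094]), ((2,7),16418,[17761]),
    ((4,7),16385,[17760])], [((1,4),[17760]), ((2,6),[17769]), ((3,7),[19088]), ((3,8),[19024]),
    ((5,8),[17824]), ((5,9),[18080]), ((6,9),[26272])]),
    ([((1,8),16512,[20577]), ((1,6),16450,[24722]), ((0,6),20617,[20577]), ((3,9),27136,[25873]),
    ((0,3),27216,[24722]), ((0,5),17702,[23074]), ((2,5),16921,[20501]), ((2,7),16674,[21026]),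
    ((4,7),16897,[20513])], [((1,4),[24593]), ((2,6),[24618]), ((3,7),[24594]), ((3,8),[24722]),
    ((4,9),[24593]), ((5,9),[23074]), ((6,9),[20514])]),
    ([((1,8),18560,[18850]), ((1,6),17474,[18002]), ((0,6),22665,[27041]), ((3,9),25088,[22098]),
    ((0,3),25168,[19025]), ((0,5),17702,[17826]), ((2,5),16921,[19093]), ((2,7),16674,[18850]),
    ((4,7),16897,[18001])], [((1,4),[18001]), ((2,6),[17770]), ((3,7),[19089]), ((3,8),[19025]),
    ((4,9),[18849]), ((5,8),[17826]), ((6,9),[27041])]),
    ([((1,8),18560,[18784]), ((1,6),17474,[18064]), ((0,6),18569,[18784]), ((3,9),25088,[23056]),
    ((0,3),25168,[23056]), ((0,5),21798,[25888]), ((2,5),16921,[18966]), ((2,7),16674,[17697]),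
    ((4,7),16897,[18962])], [((1,4),[18962]), ((2,6),[17705]), ((3,7),[17936]), ((3,8),[18064]),
    ((4,9),[17696]), ((5,8),[17696]), ((5,9),[25888])])]"
  by (simp only: G5_defs list.rel_inject certifies_simps cong: if_weak_cong trit.case_cong_weak)

text \<open>The sixth and the ninth certificate, for the edges 18 and 27, use repeated entries as
  coefficients -1.\<close>

lemma G5_contractions:
  "list_all2 (\<lambda>e. certifies G5_edges G5_vertices e (merge e))
  G5_edges [
    ([((1,8),67712,[67736]), ((1,6),66626,[66661]), ((0,6),84105,[100506]),
    ((3,9),107008,[72090]), ((0,5),70950,[66724]), ((2,5),66073,[66648]), ((2,7),65826,[67752]),
    ((4,7),66049,[66660])], [((1,4),[67738]), ((2,6),[66644]), ((3,7),[66644]), ((3,8),[67672]),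
    ((4,9),[67738]), ((5,8),[66724]), ((5,9),[75365]), ((6,9),[100506])]),
    ([((1,8),67712,[68002]), ((1,6),66626,[67154]), ((0,6),84105,[68245]), ((3,9),107008,[87634]),
    ((0,3),107088,[87634]), ((2,5),66073,[68245]), ((2,7),65826,[68002]), ((4,7),66049,[67153])],
    [((1,4),[67153]), ((2,6),[66922]), ((3,7),[68241]), ((3,8),[68177]), ((4,9),[68001]),
    ((5,8),[66978]), ((5,9),[108961]), ((6,9),[100769])]),
    ([((1,8),67712,[75393]), ((1,6),66626,[72002]), ((3,9),107008,[90690]),
    ((0,3),107088,[74337]), ((0,5),70950,[72002]), ((2,5),66073,[74341]), ((2,7),65826,[70034]),
    ((4,7),66049,[74305])], [((1,4),[70017]), ((2,6),[74337]), ((3,7),[74337]), ((3,8),[74305]),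
    ((4,9),[70017]), ((5,8),[72002]), ((5,9),[70273]), ((6,9),[102785])]),
    ([((1,8),67616,[71720]), ((1,6),67216,[70744]), ((0,6),84322,[105000]), ((2,7),65672,[70744]),
    ((2,5),65606,[75941]), ((0,5),70793,[70696]), ((0,3),107028,[75796]), ((3,9),107008,[91412])],
    [((2,6),[70746]), ((3,7),[75812]), ((3,8),[75796]), ((4,7),[75940]), ((4,9),[72232]),
    ((5,8),[70696]), ((5,9),[71720]), ((6,9),[105000])]),
    ([((1,4),65856,[99592]), ((1,8),67616,[84248]), ((0,6),84322,[84248]), ((2,7),65672,[99912]),
    ((2,5),65606,[84357]), ((0,5),70793,[91400]), ((0,3),107028,[99876]),
    ((3,9),107008,[104964])], [((2,6),[99914]), ((3,7),[99844]), ((3,8),[99876]), ((4,7),[84356]),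
    ((4,9),[99592]), ((5,8),[83208]), ((5,9),[91400]), ((6,9),[84484])]),
    ([((1,6),66626,[65830,65830,66854,99622,99622,70950,70950]),
    ((0,6),84105,[76305,76305,65536,65536,65540,66065,66065]),
    ((3,9),107008,[71205,71205,83993,83993,70949,71013,71013]),
    ((0,3),107088,[71189,71189,84105,84105]),
    ((0,5),70950,[65544,65826,65826,70950,70950,99394,99394]),
    ((2,5),66073,[76305,76305,84097,84097,65536,65536,65540]),
    ((2,7),65826,[99398,99398,70950,70950]), ((4,7),66049,[71205,71205,99685,99685])],
    [((1,4),[99429,99429,99365,99621,99621,70949,70949]),
    ((2,6),[65540,66073,66073,76313,76313,84105,84105]), ((3,7),[71189,71189,84105,84105]),
    ((3,8),[84121,84121,70949,70949,99621,99621,99365]),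
    ((4,9),[84505,84505,70949,70949,99429,99429,99365]),
    ((5,8),[71013,71013,66917,99685,99685,68121,68121]),
    ((5,9),[66917,66917,100709,100709,76313,76313,67941]),
    ((6,9),[99685,99685,100709,104805,104805,68121,68121])]),
    ([((1,8),67712,[70018]), ((1,6),66626,[74306]), ((0,6),84105,[102785]),
    ((3,9),107008,[90690]), ((0,3),107088,[74337]), ((0,5),70950,[70034]), ((2,7),65826,[70034]),
    ((4,7),66049,[74305])], [((1,4),[74305]), ((2,6),[72010]), ((3,7),[74337]), ((3,8),[74305]),
    ((4,9),[70017]), ((5,8),[72002]), ((5,9),[70273]), ((6,9),[102785])]),
    ([((0,5),70664,[87168]), ((1,8),67712,[88192]), ((1,6),66626,[107585]),
    ((3,9),107008,[108672]), ((0,3),107088,[108608]), ((0,6),84388,[88720]),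
    ((2,7),65826,[88720]), ((4,7),66049,[88194])], [((1,4),[107584]), ((2,5),[92296]),
    ((3,7),[107872]), ((3,8),[108608]), ((4,9),[107584]), ((5,8),[87168]), ((5,9),[88192]),
    ((6,9),[87104])]),
    ([((3,7),66626,[66086,66086,67110,83494,83494,75302,75302]),
    ((0,3),83014,[75298,75298,65536,65536,65544,66082,66082]),
    ((6,9),107008,[72218,72218,82982,82982,71962,72090,72090]),
    ((0,6),107168,[72234,72234,83014,83014]),
    ((0,5),71961,[65540,65809,65809,71961,71961,100481,100481]),
    ((5,8),65817,[71953,71953,100481,100481,65536,65536,65540]),
    ((1,8),66082,[83014,83014,75302,75302]), ((1,4),65793,[75045,75045,83557,83557])],
    [((4,7),[83045,83045,82981,83493,83493,75301,75301]),
    ((3,8),[65540,65817,65817,71961,71961,100489,100489]), ((1,6),[75029,75029,100489,100489]),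
    ((2,6),[100505,100505,75301,75301,83493,83493,82981]),
    ((4,9),[83494,83494,71962,71962,100506,100506,100378]),
    ((2,5),[75365,75365,67173,83557,83557,67865,67865]),
    ((5,9),[67994,67994,99738,99738,75302,75302,66970]),
    ((3,9),[100762,100762,99738,103834,103834,67110,67110])]),
    ([((1,8),67712,[108714]), ((1,6),66626,[87126]), ((0,6),84105,[88217]),
    ((2,5),65576,[107626]), ((0,5),70676,[87189]), ((0,3),106594,[107622]),
    ((3,9),107008,[107606]), ((4,7),66049,[87125])], [((1,4),[108713]), ((2,6),[107622]),
    ((2,7),[88217]), ((3,8),[108650]), ((4,9),[108713]), ((5,8),[87189]), ((5,9),[103510]),
    ((6,9),[92329])]),
    ([((1,6),65546,[98374]), ((0,6),81957,[82057]), ((3,9),107008,[98434]),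
    ((0,3),109128,[98374]), ((0,5),71058,[92802]), ((2,5),66145,[82001]), ((2,7),65922,[82562]),
    ((4,7),66049,[82049])], [((1,4),[98369]), ((1,8),[82057]), ((2,6),[98466]), ((3,7),[98370]),
    ((4,9),[98369]), ((5,8),[92802]), ((5,9),[98625]), ((6,9),[82050])]),
    ([((0,3),107088,[90182]), ((1,8),67712,[74889]), ((1,6),66626,[71750]),
    ((0,6),84105,[102537]), ((0,5),70950,[70294]), ((2,5),66073,[74089]), ((2,7),65826,[70294]),
    ((4,7),66049,[69765])], [((1,4),[73801]), ((2,6),[69765]), ((3,7),[74089]), ((3,8),[73801]),
    ((4,9),[73801]), ((5,8),[71750]), ((5,9),[69769]), ((6,9),[102537])]),
    ([((1,8),67712,[76432]), ((1,6),66626,[71009]), ((0,6),84105,[104864]), ((2,7),65826,[71009]),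
    ((2,5),66073,[76438]), ((0,5),70950,[71072]), ((0,3),107088,[76368]), ((3,9),107008,[91728])],
    [((1,4),[76434]), ((2,6),[71017]), ((3,7),[76432]), ((3,8),[76368]), ((4,9),[76192]),
    ((5,8),[71072]), ((5,9),[72096]), ((6,9),[104864])]),
    ([((1,8),67712,[72352]), ((1,6),66626,[75089]), ((0,6),84105,[105122]), ((2,7),66080,[71264]),
    ((2,5),65816,[76180]), ((0,5),71204,[71328]), ((0,3),106834,[91473]), ((3,9),106754,[91473])],
    [((1,4),[75088]), ((2,6),[71272]), ((3,7),[76176]), ((3,8),[76112]), ((4,7),[70992]),
    ((5,8),[71328]), ((5,9),[72352]), ((6,9),[105122])]),
    ([((1,6),65546,[69654]), ((0,6),81957,[102433]), ((3,9),108544,[90130]),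
    ((0,3),108864,[75425]), ((0,5),71322,[72018]), ((2,5),67681,[69665]), ((2,7),66690,[73762]),
    ((4,7),67585,[69649])], [((1,4),[69649]), ((1,8),[73769]), ((2,6),[69649]), ((3,7),[74913]),
    ((3,8),[75425]), ((4,9),[73761]), ((5,9),[69650]), ((6,9),[102433])]),
    ([((0,3),65872,[74328]), ((1,8),73856,[73880]), ((1,6),69698,[69733]), ((0,6),90249,[73896]),
    ((0,5),102950,[70052]), ((2,5),67609,[69720]), ((2,7),66594,[73896]), ((4,7),67585,[69732])],
    [((1,4),[69732]), ((2,6),[69716]), ((3,7),[69716]), ((3,8),[69732]), ((3,9),[74328]),
    ((4,9),[73882]), ((5,8),[69720]), ((6,9),[106650])]),
    ([((0,3),65872,[70228]), ((1,8),73856,[73880]), ((1,6),69698,[69733]), ((0,6),109193,[74152]),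
    ((0,5),87078,[69796]), ((2,5),67609,[69720]), ((2,7),66594,[71781]), ((4,7),67585,[69732])],
    [((1,4),[73882]), ((2,6),[73892]), ((3,7),[73880]), ((3,8),[73816]), ((3,9),[70228]),
    ((4,9),[73882]), ((5,8),[69796]), ((5,9),[104549])])]"
  by (simp only: G5_defs list.rel_inject certifies_simps cong: if_weak_cong trit.case_cong_weak)

lemma K35_eq: "complete_bipartite 3 5 = ({..<8}, edges_of K35_edges)"
proof -
  have "K35_edges = List.product [0, 1, 2] [3, 4, 5, 6, 7]" by (simp add: K35_defs)
  then have "set K35_edges = set (List.product [0, 1, 2] [3, 4, 5, 6, 7])" by (rule arg_cong)
  also have "\<dots> = set [0, 1, 2] \<times> set [3, 4, 5, 6, 7]" by (rule List.set_product)
  also have "\<dots> = {0, 1, 2} \<times> {3, 4, 5, 6, 7}" by (simp only: list.set)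
  finally have "set K35_edges = {0, 1, 2} \<times> {3, 4, 5, 6, 7}" .
  moreover have "{0, 1, 2} = {i. i < (3 :: nat)}" by auto
  moreover have "{3, 4, 5, 6, 7} = {j. 3 \<le> j \<and> j < (8 :: nat)}" by auto
  ultimately have "set K35_edges = {i. i < 3} \<times> {j. 3 \<le> j \<and> j < 8}" by simp
  then have "edges_of K35_edges = {{i, j} | i j. i < 3 \<and> 3 \<le> j \<and> j < 8}"
    unfolding edges_of_def by auto
  then show ?thesis by (simp add: complete_bipartite_def)
qed

lemma G2_eq: "G2 = ({0} \<union> {1..4} \<union> {10 * i + j | i j. 1 \<le> i \<and> i < j \<and> j \<le> 4}, edges_of G2_edges)"
proof -
  let ?f = "\<lambda>i j. {{i, 10 * i + j}, {j, 10 * i + j}, {0, 10 * i + j :: nat}}"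
  let ?S = "{(3, 4), (2, 4), (2, 3), (1, 4), (1, 3), (1, 2)} :: (nat \<times> nat) set"
  have "1 \<le> i \<and> i < j \<and> j \<le> 4 \<longleftrightarrow> (i, j) \<in> ?S" for i j by auto
  then have "{?f i j | i j. 1 \<le> i \<and> i < j \<and> j \<le> 4} = {?f i j | i j. (i, j) \<in> ?S}" by (simp only:)
  also have "\<dots> = (\<lambda>(i, j). ?f i j) ` ?S"
  proof -
    have "{g i j | i j. (i, j) \<in> S} = (\<lambda>(i, j). g i j) ` S"
      for g :: "nat \<Rightarrow> nat \<Rightarrow> nat set set" and S by auto
    then show ?thesis .
  qed
  finally have "\<Union> {?f i j | i j. 1 \<le> i \<and> i < j \<and> j \<le> 4} = \<Union> ((\<lambda>(i, j). ?f i j) ` ?S)"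
    by (rule arg_cong)
  also have "\<dots> = edges_of G2_edges" by (simp add: edges_of_def G2_defs)
  finally show ?thesis by (simp only: G2_def)
qed

lemma G1_eq: "G1 = ({1..9}, edges_of G1_edges)"
  by (simp only: G1_def G1_edges_def)

lemma G3_eq: "G3 = ({0..9}, edges_of G3_edges)"
  by (simp only: G3_def G3_edges_def)

lemma G4_eq: "G4 = ({0..9}, edges_of G4_edges)"
  by (simp only: G4_def G4_edges_def)

lemma G5_eq: "G5 = ({0..9}, edges_of G5_edges)"
  by (simp only: G5_def G5_edges_def)

lemma K35_excluded:
  "excluded_minor TYPE(3) (cycle_matroid (complete_bipartite 3 5))" "rank (cycle_matroid (complete_bipartite 3 5)) = 7"
  unfolding K35_eq
  by (rule excluded_minor_certified(1)[OF K35_graph_check K35_obstructs K35_deletions K35_contractions])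
    (simp add: excluded_minor_certified(2)[OF K35_graph_check K35_obstructs K35_deletions K35_contractions]
      K35_vertices_def)

lemma G1_excluded:
  "excluded_minor TYPE(3) (cycle_matroid G1)" "rank (cycle_matroid G1) = 8"
  unfolding G1_eq
  by (rule excluded_minor_certified(1)[OF G1_graph_check G1_obstructs G1_deletions G1_contractions])
    (simp add: excluded_minor_certified(2)[OF G1_graph_check G1_obstructs G1_deletions G1_contractions]
      G1_vertices_def)

lemma G2_excluded:
  "excluded_minor TYPE(3) (cycle_matroid G2)" "rank (cycle_matroid G2) = 10"
  unfolding G2_eq
  by (rule excluded_minor_certified(1)[OF G2_graph_check G2_obstructs G2_deletions G2_contractions])
    (simp add: excluded_minor_certified(2)[OF G2_graph_check G2_obstructs G2_deletions G2_contractions]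
      G2_vertices_def)

lemma G3_excluded:
  "excluded_minor TYPE(3) (cycle_matroid G3)" "rank (cycle_matroid G3) = 9"
  unfolding G3_eq
  by (rule excluded_minor_certified(1)[OF G3_graph_check G3_obstructs G3_deletions G3_contractions])
    (simp add: excluded_minor_certified(2)[OF G3_graph_check G3_obstructs G3_deletions G3_contractions]
      G3_vertices_def)

lemma G4_excluded:
  "excluded_minor TYPE(3) (cycle_matroid G4)" "rank (cycle_matroid G4) = 9"
  unfolding G4_eq
  by (rule excluded_minor_certified(1)[OF G4_graph_check G4_obstructs G4_deletions G4_contractions])
    (simp add: excluded_minor_certified(2)[OF G4_graph_check G4_obstructs G4_deletions G4_contractions]
      G4_vertices_def)

lemma G5_excluded:
  "excluded_minor TYPE(3) (cycle_matroid G5)" "rank (cycle_matroid G5) = 9"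
  unfolding G5_eq
  by (rule excluded_minor_certified(1)[OF G5_graph_check G5_obstructs G5_deletions G5_contractions])
    (simp add: excluded_minor_certified(2)[OF G5_graph_check G5_obstructs G5_deletions G5_contractions]
      G5_vertices_def)

theorem corollary2p3:
  shows "(\<forall>r \<in> {7..10}. \<exists>R :: nat set matroid. excluded_minor TYPE(3) R \<and> rank R = r) \<and>
    excluded_minor TYPE(3) (cycle_matroid (complete_bipartite 3 5)) \<and>
    excluded_minor TYPE(3) (cycle_matroid G1) \<and>
    excluded_minor TYPE(3) (cycle_matroid G2) \<and>
    excluded_minor TYPE(3) (cycle_matroid G3) \<and>
    excluded_minor TYPE(3) (cycle_matroid G4) \<and>
    excluded_minor TYPE(3) (cycle_matroid G5) \<and>
    rank (cycle_matroid (complete_bipartite 3 5)) = 7 \<and>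
    rank (cycle_matroid G1) = 8 \<and>
    rank (cycle_matroid G3) = 9 \<and>
    rank (cycle_matroid G4) = 9 \<and>
    rank (cycle_matroid G5) = 9 \<and>
    rank (cycle_matroid G2) = 10"
proof -
  have "\<exists>R :: nat set matroid. excluded_minor TYPE(3) R \<and> rank R = r" if "r \<in> {7..10}" for r
  proof -
    have "r = 7 \<or> r = 8 \<or> r = 9 \<or> r = 10" using that by auto
    then show ?thesis using K35_excluded G1_excluded G3_excluded G2_excluded by blast
  qed
  then show ?thesis
    using K35_excluded G1_excluded G2_excluded G3_excluded G4_excluded G5_excluded by blast
qed

end
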